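(* Let $\alpha\in\mathbb{R}$, $\alpha>0$, and let $p(z)=|z|^{\alpha}$ for $z\in\mathbb{C}$. Then the Szegő kernel of $H^2(\partial\Omega_p)$ is given by $$S((z,t),(w,s))=\frac{2\pi}{\alpha^2}\,A^{-1-2/\alpha}\left(1-\frac{z\overline{w}}{A^{2/\alpha}}\right)^{-2},\qquad A=\frac12\left(|z|^{\alpha}+|w|^{\alpha}+i(s-t)\right),$$ where $z,w\in\mathbb{C}$ and $s,t\in\mathbb{R}$.
   Context: $\Omega_p=\{(z_1,z_2)\in\mathbb{C}^2:\ \Im z_2>p(z_1)\}$. The boundary $\partial\Omega_p$ is identified with $\mathbb{C}\times\mathbb{R}$ via $(z,t)\mapsto(z,t+ip(z))$, and $d\lambda$ denotes Lebesgue measure on $\mathbb{C}$. $H^2(\partial\Omega_p)$ is the space of all functions $f\in L^2(\partial\Omega_p)=L^2(d\lambda(z)\,dt)$ which are holomorphic in $\Omega_p$ and satisfy $\sup_{y>0}\int_{\mathbb{C}}\int_{\mathbb{R}}|f(z,t+ip(z)+iy)|^2\,d\lambda(z)\,dt<\infty$. The Szegő kernel $S((z,t),(w,s))$ is the integral kernel of the orthogonal projection (Szegő projection) of $L^2(d\lambda\,dt)$ onto $H^2(\partial\Omega_p)$.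
   Formalization: The constant 2π/α² is replaced by 1/(4π²): the printed value is false with Lebesgue measure (for α=2 the reproducing property forces 1/(4π²), not π/2); the rest of the formula is unchanged, and the integral kernel is understood off the diagonal. *)

theory Defs
  imports "HOL-Analysis.Analysis"
begin

definition Omega :: "(complex \<Rightarrow> real) \<Rightarrow> (complex \<times> complex) set" where
  "Omega p = {(z1, z2). Im z2 > p z1}"

text \<open>
  Holomorphy in two variables: Frechet differentiable with complex linear derivative. The product
  type only carries a real vector space structure, so complex scaling is written componentwise.
\<close>

definition holomorphic2_on :: "(complex \<times> complex \<Rightarrow> complex) \<Rightarrow> (complex \<times> complex) set \<Rightarrow> bool" where
  "holomorphic2_on F U \<longleftrightarrow>
    (\<forall>Z\<in>U. \<exists>D. (F has_derivative D) (at Z) \<and> (\<forall>c a b. D (c * a, c * b) = c * D (a, b)))"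

text \<open>
  The point \<open>(z, t + i p(z) + i y)\<close>. For \<open>y = 0\<close> this is the identification of
  \<open>\<complex> \<times> \<real>\<close> with the boundary of the domain.
\<close>

definition lift_pt :: "(complex \<Rightarrow> real) \<Rightarrow> real \<Rightarrow> complex \<times> real \<Rightarrow> complex \<times> complex" where
  "lift_pt p y x = (fst x, Complex (snd x) (p (fst x) + y))"

text \<open>
  Square integrable functions on \<open>\<complex> \<times> \<real>\<close>; elements of the Lebesgue space are represented
  by Borel functions.
\<close>

definition L2 :: "(complex \<times> real \<Rightarrow> complex) set" where
  "L2 = {f \<in> borel_measurable lborel. integrable lborel (\<lambda>x. (norm (f x))\<^sup>2)}"

definition L2_inner :: "(complex \<times> real \<Rightarrow> complex) \<Rightarrow> (complex \<times> real \<Rightarrow> complex) \<Rightarrow> complex" where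
  "L2_inner f g = (\<integral>x. f x * cnj (g x) \<partial>lborel)"

definition hardy_extension ::
  "(complex \<Rightarrow> real) \<Rightarrow> (complex \<times> real \<Rightarrow> complex) \<Rightarrow> (complex \<times> complex \<Rightarrow> complex) \<Rightarrow> bool" where
  "hardy_extension p f F \<longleftrightarrow>
     holomorphic2_on F (Omega p) \<and>
     (SUP y\<in>{0<..}. \<integral>\<^sup>+ x. ennreal ((norm (F (lift_pt p y x)))\<^sup>2) \<partial>lborel) < \<infinity> \<and>
     ((\<lambda>y. \<integral>\<^sup>+ x. ennreal ((norm (F (lift_pt p y x) - f x))\<^sup>2) \<partial>lborel) \<longlongrightarrow> 0) (at_right 0)"

definition H2 :: "(complex \<Rightarrow> real) \<Rightarrow> (complex \<times> real \<Rightarrow> complex) set" where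
  "H2 p = {f \<in> L2. \<exists>F. hardy_extension p f F}"

text \<open>\<open>g\<close> is (a representative of) the orthogonal projection of \<open>f\<close> onto \<open>H2 p\<close>.\<close>

definition szego_projection ::
  "(complex \<Rightarrow> real) \<Rightarrow> (complex \<times> real \<Rightarrow> complex) \<Rightarrow> (complex \<times> real \<Rightarrow> complex) \<Rightarrow> bool" where
  "szego_projection p f g \<longleftrightarrow>
     f \<in> L2 \<and> g \<in> H2 p \<and> (\<forall>h \<in> H2 p. L2_inner (\<lambda>x. f x - g x) h = 0)"

text \<open>
  Integral kernel of the projection with the first argument inside the domain: every \<open>f\<close> has a
  projection, and its holomorphic extension is obtained by integrating \<open>f\<close> against \<open>K\<close>.
\<close>

definition szego_kernel_interior ::
  "(complex \<Rightarrow> real) \<Rightarrow> (complex \<times> complex \<Rightarrow> complex \<times> real \<Rightarrow> complex) \<Rightarrow> bool" where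
  "szego_kernel_interior p K \<longleftrightarrow>
     (\<forall>f \<in> L2.
        (\<forall>Z \<in> Omega p. integrable lborel (\<lambda>x. K Z x * f x)) \<and>
        (\<exists>g. szego_projection p f g \<and>
             hardy_extension p g (\<lambda>Z. \<integral>x. K Z x * f x \<partial>lborel)))"

text \<open>
  With both arguments on the boundary the projection is a singular integral operator, whose kernel
  lives off the diagonal. It is the boundary value of the interior kernel (this determines the
  operator completely), and it represents the projection of \<open>f\<close> by an absolutely convergent integral
  outside the support of \<open>f\<close>.
\<close>

definition is_szego_kernel ::
  "(complex \<Rightarrow> real) \<Rightarrow> (complex \<times> real \<Rightarrow> complex \<times> real \<Rightarrow> complex) \<Rightarrow> bool" where
  "is_szego_kernel p S \<longleftrightarrow>
     (\<exists>K. szego_kernel_interior p K \<and>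
          (\<forall>x x'. x \<noteq> x' \<longrightarrow> ((\<lambda>y. K (lift_pt p y x) x') \<longlongrightarrow> S x x') (at_right 0))) \<and>
     (\<forall>f g. szego_projection p f g \<longrightarrow>
          (AE x in lborel. x \<notin> closure {x'. f x' \<noteq> 0} \<longrightarrow>
             integrable lborel (\<lambda>x'. S x x' * f x') \<and>
             g x = (\<integral>x'. S x x' * f x' \<partial>lborel)))"

text \<open>
  The quantity \<open>A\<close> for \<open>p(z) = |z|^\<alpha>\<close>. It has nonnegative real part and vanishes only for
  \<open>z = w = 0\<close>, \<open>s = t\<close>, so its complex powers are principal values.
\<close>

definition szego_A :: "real \<Rightarrow> complex \<times> real \<Rightarrow> complex \<times> real \<Rightarrow> complex" where
  "szego_A \<alpha> = (\<lambda>(z, t) (w, s).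
     (1 / 2) * (of_real (norm z powr \<alpha>) + of_real (norm w powr \<alpha>) + \<i> * of_real (s - t)))"

text \<open>
  With Lebesgue measure the constant in the kernel for \<open>p(z) = |z|^\<alpha>\<close> is \<open>1 / (4 \<pi>\<^sup>2)\<close> for every
  \<open>\<alpha>\<close>, not the \<open>2 \<pi> / \<alpha>\<^sup>2\<close> of the literature source. At a point \<open>(0, i y)\<close> the kernel with
  constant \<open>c\<close> has squared norm \<open>4 \<pi>\<^sup>2 c\<^sup>2 y powr (- 1 - 2 / \<alpha>)\<close>, which must equal its diagonal
  value \<open>c y powr (- 1 - 2 / \<alpha>)\<close>. For \<open>\<alpha> = 2\<close> it is the classical Cauchy-Szego kernel of the
  Siegel domain.
\<close>

end

theory Submission
  imports Defs "HOL-Complex_Analysis.Complex_Analysis" "HOL-Probability.Sinc_Integral"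
begin

text \<open>
  Point evaluations on the Hardy space are bounded, so the space is closed in \<open>L\<^sup>2\<close>, the projection
  exists, and its kernel is whatever function reproduces the elements of the space. To see that the
  given kernel reproduces, expand it in powers of \<open>z cnj w\<close>. For each power the integral over the
  angle of \<open>w\<close> extracts a Taylor coefficient \<open>a\<^sub>n\<close> of the Hardy function in its first variable, a
  holomorphic function on a half-plane; with \<open>v = |w|\<^sup>\<alpha>\<close> as a new variable the remaining double
  integral is the weighted Bergman formula of the upper half-plane with weight
  \<open>v\<^sup>\<beta>\<^sup>-\<^sup>1\<close>, \<open>\<beta> = (2 n + 2) / \<alpha>\<close>, and it returns \<open>a\<^sub>n\<close>. Dividing by \<open>1 - \<i> \<delta> z\<^sub>2\<close> and shifting upwards
  provide the decay needed for moving lines of integration.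
\<close>

section \<open>Lebesgue measure on the complex plane\<close>

text \<open>The constant and the exponent come from one bookkeeping. The radial density contributes
  2 pi / \<alpha>, the half-plane formula 4 pi / \<beta> with \<beta> = (2 n + 2) / \<alpha>, and
  the product is 4 pi^2 / (n + 1). The n-th term of the kernel must therefore carry (n + 1) / (4
  pi^2), and the sum of (n + 1) q^n is (1 - q)^(-2); \<alpha> survives only in exponents. The
  expansion converges because the inequality of arithmetic and geometric means bounds |q| by a
  number below 1 that depends on the interior point alone. That number tends to 1 at the boundary,
  so the boundary values of the kernel need another argument: the equality case shows that the
  singularity sits on the diagonal only, and away from it compactness replaces the uniform ratio.
  Bounded point evaluations give a holomorphic limit of a convergent sequence, but its slices must
  also converge to the limit at the boundary. This is why the slice norms of an extension have to be
  controlled by its boundary values, which is obtained from their monotonicity in the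
  height.\<close>

lemma measurable_Complex [measurable]:
  "(\<lambda>(x, y). Complex x y) \<in> borel_measurable (borel \<Otimes>\<^sub>M borel)"
proof -
  have "(\<lambda>z::real \<times> real. Complex (fst z) (snd z)) \<in> borel_measurable borel"
    unfolding Complex_eq by (intro borel_measurable_continuous_onI continuous_intros)
  then show ?thesis
    by (simp add: case_prod_unfold borel_prod)
qed

text \<open>Lebesgue measure is determined by its values on boxes, and a box in the plane pulls back
  to a product of two intervals. This reduces plane integrals to iterated real ones.\<close>

lemma lborel_complex_eq:
  "(lborel :: complex measure) = distr (lborel \<Otimes>\<^sub>M lborel) borel (\<lambda>(x, y). Complex x y)"
proof (rule lborel_eqI)
  fix l u :: complex
  assume le: "\<And>b. b \<in> Basis \<Longrightarrow> l \<bullet> b \<le> u \<bullet> b"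
  have le': "Re l \<le> Re u" "Im l \<le> Im u"
    using le[of 1] le[of \<i>] by (auto simp: Basis_complex_def)
  have vim: "(\<lambda>(x, y). Complex x y) -` box l u = {Re l<..<Re u} \<times> {Im l<..<Im u}"
    by (auto simp: box_def Basis_complex_def)
  have "emeasure (distr (lborel \<Otimes>\<^sub>M lborel) borel (\<lambda>(x, y). Complex x y)) (box l u)
      = emeasure (lborel \<Otimes>\<^sub>M lborel) ({Re l<..<Re u} \<times> {Im l<..<Im u})"
    by (subst emeasure_distr) (auto simp: vim space_pair_measure)
  also have "\<dots> = ennreal (Re u - Re l) * ennreal (Im u - Im l)"
    using le' by (simp add: lborel.emeasure_pair_measure_Times)
  also have "\<dots> = (\<Prod>b\<in>Basis. (u - l) \<bullet> b)"
    using le' by (simp add: Basis_complex_def ennreal_mult)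
  finally show "emeasure (distr (lborel \<Otimes>\<^sub>M lborel) borel (\<lambda>(x, y). Complex x y)) (box l u)
      = (\<Prod>b\<in>Basis. (u - l) \<bullet> b)" .
qed simp

lemma nn_integral_complex:
  assumes [measurable]: "f \<in> borel_measurable borel"
  shows "(\<integral>\<^sup>+w. f w \<partial>lborel) = (\<integral>\<^sup>+y. \<integral>\<^sup>+x. f (Complex x y) \<partial>lborel \<partial>lborel)"
    and "(\<integral>\<^sup>+w. f w \<partial>lborel) = (\<integral>\<^sup>+x. \<integral>\<^sup>+y. f (Complex x y) \<partial>lborel \<partial>lborel)"
proof -
  have "(\<integral>\<^sup>+w. f w \<partial>lborel) = (\<integral>\<^sup>+z. f (Complex (fst z) (snd z)) \<partial>(lborel \<Otimes>\<^sub>M lborel))"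
    by (subst lborel_complex_eq, subst nn_integral_distr) (auto simp: case_prod_unfold)
  then show "(\<integral>\<^sup>+w. f w \<partial>lborel) = (\<integral>\<^sup>+y. \<integral>\<^sup>+x. f (Complex x y) \<partial>lborel \<partial>lborel)"
    and "(\<integral>\<^sup>+w. f w \<partial>lborel) = (\<integral>\<^sup>+x. \<integral>\<^sup>+y. f (Complex x y) \<partial>lborel \<partial>lborel)"
    using lborel_pair.nn_integral_snd[of "\<lambda>(x, y). f (Complex x y)"]
      lborel.nn_integral_fst[of "\<lambda>(x, y). f (Complex x y)" lborel]
    by (simp_all add: case_prod_unfold)
qed

text \<open>For a fixed imaginary part the shear is a translation of the real line.\<close>

lemma nn_integral_shear_Re:
  assumes [measurable]: "f \<in> borel_measurable borel"
  shows "(\<integral>\<^sup>+w. f (Complex (Re w + a * Im w) (Im w)) \<partial>lborel) = (\<integral>\<^sup>+w. f w \<partial>lborel)"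
proof -
  have m: "(\<lambda>w. f (Complex (Re w + a * Im w) (Im w))) \<in> borel_measurable borel"
    unfolding Complex_eq by measurable
  have "(\<integral>\<^sup>+x. f (Complex (x + a * y) y) \<partial>lborel) = (\<integral>\<^sup>+x. f (Complex x y) \<partial>lborel)" for y
  proof -
    have "(\<lambda>x. f (Complex x y)) \<in> borel_measurable borel"
      unfolding Complex_eq by measurable
    from nn_integral_real_affine[OF this, of 1 "a * y"] show ?thesis
      by (simp add: add.commute)
  qed
  then show ?thesis
    by (simp add: nn_integral_complex(1)[OF m] nn_integral_complex(1)[of f])
qed

lemma nn_integral_shear_Im:
  assumes [measurable]: "f \<in> borel_measurable borel"
  shows "(\<integral>\<^sup>+w. f (Complex (Re w) (Im w + a * Re w)) \<partial>lborel) = (\<integral>\<^sup>+w. f w \<partial>lborel)"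
proof -
  have m: "(\<lambda>w. f (Complex (Re w) (Im w + a * Re w))) \<in> borel_measurable borel"
    unfolding Complex_eq by measurable
  have "(\<integral>\<^sup>+y. f (Complex x (y + a * x)) \<partial>lborel) = (\<integral>\<^sup>+y. f (Complex x y) \<partial>lborel)" for x
  proof -
    have "(\<lambda>y. f (Complex x y)) \<in> borel_measurable borel"
      unfolding Complex_eq by measurable
    from nn_integral_real_affine[OF this, of 1 "a * x"] show ?thesis
      by (simp add: add.commute)
  qed
  then show ?thesis
    by (simp add: nn_integral_complex(2)[OF m] nn_integral_complex(2)[of f])
qed

text \<open>A rotation other than \<open>-1\<close> is a product of three shears.\<close>

lemma nn_integral_rotate:
  fixes u :: complex
  assumes [measurable]: "f \<in> borel_measurable borel" and u: "norm u = 1"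
  shows "(\<integral>\<^sup>+w. f (u * w) \<partial>lborel) = (\<integral>\<^sup>+w. f w \<partial>lborel)"
proof -
  have main: "(\<integral>\<^sup>+w. g (v * w) \<partial>lborel) = (\<integral>\<^sup>+w. g w \<partial>lborel)"
    if gm[measurable]: "g \<in> borel_measurable borel" and v: "norm v = 1" "v \<noteq> -1"
    for g :: "complex \<Rightarrow> ennreal" and v :: complex
  proof -
    \<comment> \<open>For \<open>v = cis \<theta>\<close> this is
      \<open>- tan (\<theta> / 2)\<close>. The two outer shears use \<open>a\<close>, the middle one
      uses \<open>Im v\<close>, that is \<open>sin \<theta>\<close>.\<close>
    define a where "a = - Im v / (1 + Re v)"
    have sq: "(Re v)\<^sup>2 + (Im v)\<^sup>2 = 1"
      using v(1) by (simp add: cmod_def)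
    have nz: "1 + Re v \<noteq> 0"
      using sq v(2) by (auto simp: complex_eq_iff add_eq_0_iff)
    have 1: "1 + a * Im v = Re v"
      unfolding a_def using nz sq by (simp add: field_simps power2_eq_square)
    have "2 * a + a * a * Im v = a * (1 + (1 + a * Im v))"
      by (simp add: algebra_simps)
    also have "\<dots> = - Im v"
      unfolding 1 unfolding a_def using nz by simp
    finally have 2: "2 * a + a * a * Im v = - Im v" .
    let ?T = "\<lambda>w. Complex (Re w + a * Im w) (Im w)"
    let ?S = "\<lambda>w. Complex (Re w) (Im w + Im v * Re w)"
    have eq: "?T (?S (?T w)) = v * w" for w
    proof (rule complex_eqI)
      have "Re (?T (?S (?T w))) = Re w * (1 + a * Im v) + Im w * (2 * a + a * a * Im v)"
        by (simp add: algebra_simps)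
      then show "Re (?T (?S (?T w))) = Re (v * w)"
        unfolding 1 2 by (simp add: mult.commute)
      have "Im (?T (?S (?T w))) = Im w * (1 + a * Im v) + Im v * Re w"
        by (simp add: algebra_simps)
      then show "Im (?T (?S (?T w))) = Im (v * w)"
        unfolding 1 by (simp add: mult.commute)
    qed
    have mT: "(\<lambda>w. g (?T w)) \<in> borel_measurable borel"
      unfolding Complex_eq by measurable
    have mS: "(\<lambda>w. g (?T (?S w))) \<in> borel_measurable borel"
      unfolding Complex_eq by measurable
    have "(\<integral>\<^sup>+w. g (v * w) \<partial>lborel) = (\<integral>\<^sup>+w. g (?T (?S (?T w))) \<partial>lborel)"
      by (simp only: eq)
    also have "\<dots> = (\<integral>\<^sup>+w. g (?T (?S w)) \<partial>lborel)"
      using nn_integral_shear_Re[OF mS, of a] by simp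
    also have "\<dots> = (\<integral>\<^sup>+w. g (?T w) \<partial>lborel)"
      using nn_integral_shear_Im[OF mT, of "Im v"] by simp
    also have "\<dots> = (\<integral>\<^sup>+w. g w \<partial>lborel)"
      using nn_integral_shear_Re[OF gm, of a] by simp
    finally show ?thesis .
  qed
  show ?thesis
  proof (cases "u = -1")
    case False
    then show ?thesis using main[of f u] u by simp
  next
    \<comment> \<open>The excluded rotation is the square of the rotation by \<i>, which is already
      covered.\<close>
    case True
    have "(\<integral>\<^sup>+w. f (\<i> * (\<i> * w)) \<partial>lborel) = (\<integral>\<^sup>+w. f (\<i> * w) \<partial>lborel)"
      by (rule main[of "\<lambda>w. f (\<i> * w)"]) (auto simp: complex_eq_iff)
    also have "\<dots> = (\<integral>\<^sup>+w. f w \<partial>lborel)"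
      by (rule main) (auto simp: complex_eq_iff)
    finally show ?thesis using True by (simp flip: mult.assoc)
  qed
qed

lemma lborel_distr_rotate:
  fixes u :: complex
  assumes u: "norm u = 1"
  shows "distr lborel borel ((*) u) = lborel"
proof (rule measure_eqI)
  fix A assume "A \<in> sets (distr lborel borel ((*) u))"
  then have A[measurable]: "A \<in> sets borel" by simp
  have "emeasure (distr lborel borel ((*) u)) A = (\<integral>\<^sup>+w. indicator A (u * w) \<partial>lborel)"
    by (subst nn_integral_indicator[symmetric], simp, subst nn_integral_distr) auto
  also have "\<dots> = emeasure lborel A"
    by (subst nn_integral_rotate[OF _ u]) auto
  finally show "emeasure (distr lborel borel ((*) u)) A = emeasure lborel A" .
qed simp

lemma integrable_rotate:
  fixes f :: "complex \<Rightarrow> complex"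
  assumes "integrable lborel f" "norm u = 1"
  shows "integrable lborel (\<lambda>w. f (u * w))"
proof -
  have [measurable]: "f \<in> borel_measurable borel" using assms(1) by auto
  show ?thesis
    using assms(1) by (subst (asm) lborel_distr_rotate[OF assms(2), symmetric])
      (simp add: integrable_distr_eq)
qed

lemma integral_rotate:
  fixes f :: "complex \<Rightarrow> complex"
  assumes [measurable]: "f \<in> borel_measurable borel" and "norm u = 1"
  shows "(\<integral>w. f (u * w) \<partial>lborel) = (\<integral>w. f w \<partial>lborel)"
  by (subst (2) lborel_distr_rotate[OF assms(2), symmetric]) (simp add: integral_distr)

section \<open>Circle means and the radial distribution of planar measure\<close>

lemma borel_measurable_cnj [measurable]: "cnj \<in> borel_measurable borel"
  by (intro borel_measurable_continuous_onI continuous_intros)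

definition circle_mean :: "(complex \<Rightarrow> complex) \<Rightarrow> complex \<Rightarrow> complex" where
  "circle_mean f w = (LBINT \<theta>:{0..2*pi}. f (cis \<theta> * w)) / (2 * pi)"

lemma borel_measurable_cis [measurable]: "cis \<in> borel_measurable borel"
  by (intro borel_measurable_continuous_onI continuous_intros)

text \<open>Every rotation preserves the integral, so averaging over the angle does too, by Fubini.
  Since the mean is again a function on the plane, this separates angle from radius without polar
  coordinates and their Jacobian.\<close>

lemma integral_circle_mean:
  assumes f: "integrable lborel f"
  shows "(\<integral>w. f w \<partial>lborel) = (\<integral>w. circle_mean f w \<partial>lborel)"
    and "integrable lborel (circle_mean f)"
proof -
  have [measurable]: "f \<in> borel_measurable borel" using f by auto
  let ?g = "\<lambda>(\<theta>, w). indicator {0..2*pi} \<theta> *\<^sub>R f (cis \<theta> * w)"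
  have int: "integrable (lborel \<Otimes>\<^sub>M lborel) ?g"
  proof (rule lborel_pair.Fubini_integrable)
    show "?g \<in> borel_measurable (lborel \<Otimes>\<^sub>M lborel)" by measurable
    have "(\<integral>w. norm (f (cis \<theta> * w)) \<partial>lborel) = (\<integral>w. norm (f w) \<partial>lborel)" for \<theta>
      using integral_rotate[of "\<lambda>w. of_real (norm (f w))" "cis \<theta>"] by simp
    then have eq: "(\<integral>w. norm (?g (\<theta>, w)) \<partial>lborel) = indicator {0..2*pi} \<theta> *\<^sub>R (\<integral>w. norm (f w) \<partial>lborel)" for \<theta>
      by simp
    have "integrable lborel (\<lambda>\<theta>. indicator {0..2*pi} \<theta> *\<^sub>R (\<integral>w. norm (f w) \<partial>lborel))"
      by (intro integrable_scaleR_left) (auto intro!: integrable_real_indicator)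
    then show "integrable lborel (\<lambda>\<theta>. \<integral>w. norm (?g (\<theta>, w)) \<partial>lborel)"
      by (simp only: eq)
    show "AE \<theta> in lborel. integrable lborel (\<lambda>w. ?g (\<theta>, w))"
      using integrable_rotate[OF f] by simp
  qed
  have sw: "(\<integral>w. (\<integral>\<theta>. ?g (\<theta>, w) \<partial>lborel) \<partial>lborel) = (\<integral>\<theta>. (\<integral>w. ?g (\<theta>, w) \<partial>lborel) \<partial>lborel)"
    using lborel_pair.Fubini_integral[of "\<lambda>\<theta> w. ?g (\<theta>, w)"] int by simp
  have cm: "circle_mean f = (\<lambda>w. (\<integral>\<theta>. ?g (\<theta>, w) \<partial>lborel) / (2 * pi))"
    by (simp add: circle_mean_def set_lebesgue_integral_def fun_eq_iff)
  have "(\<integral>w. circle_mean f w \<partial>lborel) = (\<integral>w. (\<integral>\<theta>. ?g (\<theta>, w) \<partial>lborel) \<partial>lborel) / (2 * pi)"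
    by (simp add: cm)
  also have "\<dots> = (\<integral>\<theta>. indicator {0..2*pi} \<theta> *\<^sub>R (\<integral>w. f w \<partial>lborel) \<partial>lborel) / (2 * pi)"
    unfolding sw by (simp add: integral_rotate)
  also have "\<dots> = (\<integral>w. f w \<partial>lborel)"
    by (simp add: integral_scaleR_left) (simp add: scaleR_conv_of_real)
  finally show "(\<integral>w. f w \<partial>lborel) = (\<integral>w. circle_mean f w \<partial>lborel)" by simp
  show "integrable lborel (circle_mean f)"
    unfolding cm using lborel_pair.integrable_snd[of "\<lambda>\<theta> w. ?g (\<theta>, w)"] int by auto
qed

text \<open>On the circle of radius \<open>r\<close> one has \<open>cnj w = r^2 / w\<close>, so the
  mean is \<open>r ^ (2 * n)\<close> times the Cauchy integral for the n-th Taylor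
  coefficient.\<close>

lemma circle_mean_Taylor:
  assumes hol: "f holomorphic_on ball 0 R" and r: "0 < norm w" "norm w < R"
  shows "circle_mean (\<lambda>w. cnj w ^ n * f w) w
    = of_real (norm w) ^ (2 * n) * ((deriv ^^ n) f 0 / fact n)"
proof -
  define r where "r = norm w"
  have r0: "r > 0" "cball 0 r \<subseteq> ball 0 R" using assms unfolding r_def by auto
  obtain \<phi> where w: "w = r * cis \<phi>"
    unfolding r_def by (metis rcis_cmod_Arg rcis_def)
  \<comment> \<open>The mean runs over the circle starting from \<open>w\<close> itself. Rotating
    \<open>f\<close> by the argument of \<open>w\<close> lets the standard parametrisation of
    \<open>circlepath\<close> be used; the resulting factor \<open>cis \<phi> ^ n\<close> is
    cancelled by the one from \<open>cnj w ^ n\<close>.\<close>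
  define g where "g = (\<lambda>\<zeta>. f (cis \<phi> * \<zeta>))"
  have holg: "g holomorphic_on ball 0 R"
    unfolding g_def using holomorphic_on_compose_gen[of "\<lambda>\<zeta>. cis \<phi> * \<zeta>" "ball 0 R" f "ball 0 R"] hol
    by (auto simp: o_def norm_mult image_subset_iff intro!: holomorphic_intros)
  have dg: "(deriv ^^ n) g 0 = cis \<phi> ^ n * (deriv ^^ n) f 0"
    unfolding g_def using higher_deriv_compose_linear[OF hol, of "ball 0 R" 0 "cis \<phi>" n] r
    by (auto simp: norm_mult)
  let ?G = "\<lambda>w. cnj w ^ n * f w"
  have cont: "continuous_on (cball 0 r) g"
    using holg r0 by (meson holomorphic_on_imp_continuous_on holomorphic_on_subset)
  have "((\<lambda>u. g u / (u - 0) ^ Suc n) has_contour_integral (2 * pi * \<i>) / fact n * (deriv ^^ n) g 0)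
     (circlepath 0 r)"
  proof (rule Cauchy_has_contour_integral_higher_derivative_circlepath)
    show "g holomorphic_on ball 0 r"
      using holg r0 by (meson ball_subset_cball holomorphic_on_subset order_trans)
  qed (use r0 cont in auto)
  then have "((\<lambda>t. g (0 + r * cis t) / (r * cis t) ^ Suc n * r * \<i> * cis t) has_integral
       (2 * pi * \<i>) / fact n * (deriv ^^ n) g 0) {0..2*pi}"
    unfolding circlepath_def by (subst (asm) has_contour_integral_part_circlepath_iff) auto
  then have "((\<lambda>t. cnj (cis \<phi>) ^ n * of_real r ^ (2*n) / \<i> * (g (0 + r * cis t) / (r * cis t) ^ Suc n * r * \<i> * cis t)) has_integral
       cnj (cis \<phi>) ^ n * of_real r ^ (2*n) / \<i> * ((2 * pi * \<i>) / fact n * (deriv ^^ n) g 0)) {0..2*pi}"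
    by (rule has_integral_mult_right)
  moreover have "cnj (cis \<phi>) ^ n * of_real r ^ (2*n) / \<i> * (g (0 + r * cis t) / (r * cis t) ^ Suc n * r * \<i> * cis t)
      = ?G (cis t * w)" for t
  proof -
    have "cnj (r * cis t) * (r * cis t) = of_real r ^ 2"
      by (simp add: cis_cnj cis_mult power2_eq_square)
    then have "cnj (r * cis t) ^ n * (r * cis t) ^ n = of_real r ^ (2 * n)"
      by (metis power_mult power_mult_distrib)
    moreover have "r * cis t \<noteq> 0" using r0 by simp
    ultimately show ?thesis
      unfolding w g_def by (simp add: field_simps)
  qed
  moreover have "cnj (cis \<phi>) ^ n * of_real r ^ (2*n) / \<i> * ((2 * pi * \<i>) / fact n * (deriv ^^ n) g 0)
      = of_real r ^ (2*n) * (2 * pi) * ((deriv ^^ n) f 0 / fact n)"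
  proof -
    have "cnj (cis \<phi>) ^ n * cis \<phi> ^ n = 1"
      by (simp add: power_mult_distrib[symmetric] cis_cnj cis_mult)
    then show ?thesis unfolding dg
      by (simp add: field_simps)
  qed
  ultimately have hi: "((\<lambda>t. ?G (cis t * w)) has_integral
       of_real r ^ (2*n) * (2 * pi) * ((deriv ^^ n) f 0 / fact n)) {0..2*pi}"
    by simp
  have cf: "continuous_on (cball 0 r) f"
    using hol r0 by (meson holomorphic_on_imp_continuous_on holomorphic_on_subset)
  have "continuous_on {0..2*pi} (\<lambda>t. ?G (cis t * w))"
    using r0 by (intro continuous_intros continuous_on_compose2[OF cf]) (auto simp: norm_mult r_def)
  then have "set_integrable lborel {0..2*pi} (\<lambda>t. ?G (cis t * w))"
    by (intro borel_integrable_atLeastAtMost')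
  then have "(LBINT \<theta>:{0..2*pi}. ?G (cis \<theta> * w)) = integral {0..2*pi} (\<lambda>t. ?G (cis t * w))"
    by (rule set_borel_integral_eq_integral(2))
  then show ?thesis
    using integral_unique[OF hi] by (simp add: circle_mean_def r_def)
qed

text \<open>The set where \<open>norm w powr \<alpha> \<le> a\<close> is a disc of area
  \<open>pi * a powr (2 / \<alpha>)\<close>, and the density is the derivative of this area.
  Half-lines form a generator that is stable under intersection, so comparing them is
  enough.\<close>

lemma distr_norm_powr_complex:
  fixes \<alpha> :: real
  assumes \<alpha>: "\<alpha> > 0"
  shows "distr (lborel :: complex measure) borel (\<lambda>w. norm w powr \<alpha>)
    = density lborel (\<lambda>v. ennreal (indicator {0<..} v * (2 * pi / \<alpha> * v powr (2 / \<alpha> - 1))))"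
    (is "?M = ?N")
proof (rule measure_eqI_generator_eq[where E = "range (\<lambda>a::real. {..a})" and \<Omega> = UNIV and A = "\<lambda>i. {..real i}"])
  show "Int_stable (range (\<lambda>a::real. {..a}))"
    by (auto simp: Int_stable_def)
  have b: "sigma_sets UNIV (range (\<lambda>a::real. {..a})) = sets borel"
    by (simp add: borel_eq_atMost[where 'a = real])
  show "sets ?M = sigma_sets UNIV (range (\<lambda>a::real. {..a}))"
    "sets ?N = sigma_sets UNIV (range (\<lambda>a::real. {..a}))"
    by (simp_all add: b)
  show "(\<Union>i. {..real i}) = UNIV"
    by (auto intro: real_arch_simple)
  have 0: "emeasure ?M {..a} = ennreal (if a < 0 then 0 else pi * a powr (2 / \<alpha>))" for a :: real
  proof (cases "a < 0")
    case True
    then have "(\<lambda>w::complex. norm w powr \<alpha>) -` {..a} = {}"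
      using powr_ge_zero order_trans not_le by (blast intro: order_trans)
    then show ?thesis using True by (subst emeasure_distr) auto
  next
    case False
    have "norm w powr \<alpha> \<le> a \<longleftrightarrow> norm w \<le> a powr (1 / \<alpha>)" for w :: complex
    proof
      assume "norm w powr \<alpha> \<le> a"
      then have "(norm w powr \<alpha>) powr (1 / \<alpha>) \<le> a powr (1 / \<alpha>)"
        using \<alpha> by (intro powr_mono2) auto
      then show "norm w \<le> a powr (1 / \<alpha>)"
        using \<alpha> by (simp add: powr_powr)
    next
      assume "norm w \<le> a powr (1 / \<alpha>)"
      then have "norm w powr \<alpha> \<le> (a powr (1 / \<alpha>)) powr \<alpha>"
        using \<alpha> by (intro powr_mono2) auto
      then show "norm w powr \<alpha> \<le> a"
        using \<alpha> False by (simp add: powr_powr)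
    qed
    then have "(\<lambda>w::complex. norm w powr \<alpha>) -` {..a} = cball 0 (a powr (1 / \<alpha>))"
      by auto
    then have "emeasure ?M {..a} = emeasure lborel (cball (0::complex) (a powr (1 / \<alpha>)))"
      by (subst emeasure_distr) auto
    also have "\<dots> = ennreal (pi * (a powr (1 / \<alpha>)) ^ 2)"
      by (subst emeasure_cball) (auto simp: unit_ball_vol_2)
    also have "(a powr (1 / \<alpha>)) ^ 2 = a powr (2 / \<alpha>)"
      by (simp add: power2_eq_square powr_add[symmetric])
    finally show ?thesis using False by simp
  qed
  show "emeasure ?M {..real i} \<noteq> \<infinity>" for i
    unfolding 0 by simp
  fix X :: "real set" assume "X \<in> range (\<lambda>a. {..a})"
  then obtain a where X: "X = {..a}" by auto
  have "emeasure ?N {..a} = (\<integral>\<^sup>+v. ennreal (indicator {0<..} v * (2 * pi / \<alpha> * v powr (2 / \<alpha> - 1))) * indicator {..a} v \<partial>lborel)"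
    by (subst emeasure_density) auto
  also have "\<dots> = ennreal (if a < 0 then 0 else pi * a powr (2 / \<alpha>))"
  proof (cases "a < 0")
    case True
    then have "ennreal (indicator {0<..} v * (2 * pi / \<alpha> * v powr (2 / \<alpha> - 1))) * indicator {..a} v = 0" for v
      by (auto split: split_indicator)
    then show ?thesis using True by (simp only: nn_integral_0_iff_AE) simp
  next
    case False
    have "((\<lambda>v. 2 * pi / \<alpha> * v powr (2 / \<alpha> - 1)) has_integral 2 * pi / \<alpha> * (a powr (2 / \<alpha> - 1 + 1) / (2 / \<alpha> - 1 + 1))) {0..a}"
      using False \<alpha> by (intro has_integral_mult_right has_integral_powr_from_0) auto
    then have "(\<integral>\<^sup>+v. ennreal (indicator {0..a} v * (2 * pi / \<alpha> * v powr (2 / \<alpha> - 1))) \<partial>lborel)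
       = ennreal (pi * a powr (2 / \<alpha>))"
      using nn_integral_has_integral_lebesgue[of "{0..a}" "\<lambda>v. 2 * pi / \<alpha> * v powr (2 / \<alpha> - 1)"] \<alpha>
      by (simp add: nn_integral_completion)
    moreover have "ennreal (indicator {0<..} v * (2 * pi / \<alpha> * v powr (2 / \<alpha> - 1))) * indicator {..a} v
        = ennreal (indicator {0..a} v * (2 * pi / \<alpha> * v powr (2 / \<alpha> - 1)))" for v
      by (cases "v = 0") (auto split: split_indicator)
    ultimately show ?thesis using False by simp
  qed
  finally show "emeasure ?M X = emeasure ?N X"
    unfolding X 0 by simp
qed auto

lemma integral_radial_powr:
  fixes \<phi> :: "real \<Rightarrow> complex"
  assumes \<alpha>: "\<alpha> > 0" and [measurable]: "\<phi> \<in> borel_measurable borel"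
  shows "(\<integral>w. \<phi> (norm (w::complex) powr \<alpha>) \<partial>lborel)
    = (LBINT v:{0<..}. of_real (2 * pi / \<alpha> * v powr (2 / \<alpha> - 1)) * \<phi> v)"
proof -
  have "(\<integral>w. \<phi> (norm (w::complex) powr \<alpha>) \<partial>lborel) = (\<integral>v. \<phi> v \<partial>distr (lborel :: complex measure) borel (\<lambda>w. norm w powr \<alpha>))"
    by (subst integral_distr) auto
  also have "\<dots> = (LBINT v:{0<..}. of_real (2 * pi / \<alpha> * v powr (2 / \<alpha> - 1)) * \<phi> v)"
    unfolding distr_norm_powr_complex[OF \<alpha>] set_lebesgue_integral_def using \<alpha>
    by (subst integral_density) (auto intro!: Bochner_Integration.integral_cong split: split_indicator simp: scaleR_conv_of_real)
  finally show ?thesis .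
qed

section \<open>Holomorphic functions on strips and half-planes\<close>

lemma integrable_inverse_square: "integrable lborel (\<lambda>x::real. C / (1 + x\<^sup>2))"
proof -
  have "integrable lborel (\<lambda>x::real. inverse (1 + x\<^sup>2))"
    using integrable_inverse_1_plus_square by (simp add: set_integrable_def einterval_def)
  then have "integrable lborel (\<lambda>x::real. C * inverse (1 + x\<^sup>2))"
    by (rule integrable_mult_right)
  then show ?thesis by (simp add: divide_inverse)
qed

lemma holomorphic_continuous_line:
  assumes "f holomorphic_on U" "\<And>s. Complex s c \<in> U"
  shows "continuous_on UNIV (\<lambda>s. f (Complex s c))"
  using assms unfolding Complex_eq
  by (intro continuous_on_compose2[OF holomorphic_on_imp_continuous_on[OF assms(1)]] continuous_intros) auto

lemma integrable_of_square_decay: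
  fixes f :: "real \<Rightarrow> 'a::{banach, second_countable_topology}"
  assumes [measurable]: "f \<in> borel_measurable borel" and "\<And>s. norm (f s) \<le> C / (1 + s\<^sup>2)"
  shows "integrable lborel f"
proof (rule Bochner_Integration.integrable_bound[OF integrable_inverse_square[of C]])
  have "norm (f s) \<le> norm (C / (1 + s\<^sup>2))" for s
    using order_trans[OF assms(2) abs_ge_self] by simp
  then show "AE s in lborel. norm (f s) \<le> norm (C / (1 + s\<^sup>2))" by blast
qed simp

lemma holomorphic_on_translate:
  assumes "f holomorphic_on V" "\<And>\<sigma>. \<sigma> \<in> U \<Longrightarrow> \<sigma> + c \<in> V"
  shows "(\<lambda>\<sigma>. f (\<sigma> + c)) holomorphic_on U"
proof -
  have "(f \<circ> (\<lambda>\<sigma>. \<sigma> + c)) holomorphic_on U"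
    using assms by (intro holomorphic_on_compose_gen[where t = V] holomorphic_intros) auto
  then show ?thesis by (simp add: o_def)
qed

lemma line_integral_limit:
  fixes f :: "real \<Rightarrow> complex"
  assumes "integrable lborel f"
  shows "(\<lambda>n. LBINT s. indicator {-real n..real n} s *\<^sub>R f s) \<longlonglongrightarrow> (LBINT s. f s)"
proof (rule integral_dominated_convergence[where w = "\<lambda>s. norm (f s)"])
  have [measurable]: "f \<in> borel_measurable borel" using assms by auto
  show "f \<in> borel_measurable lborel" by simp
  show "(\<lambda>s. indicator {-real n..real n} s *\<^sub>R f s) \<in> borel_measurable lborel" for n
    by measurable
  show "AE s in lborel. (\<lambda>n. indicator {-real n..real n} s *\<^sub>R f s) \<longlonglongrightarrow> f s"
  proof (rule AE_I2)
    fix s :: real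
    obtain N where "\<bar>s\<bar> \<le> real N" using real_arch_simple by blast
    have "indicator {-real n..real n} s *\<^sub>R f s = f s" if "N \<le> n" for n
    proof -
      have "real N \<le> real n" using that by simp
      then have "s \<in> {-real n..real n}" using \<open>\<bar>s\<bar> \<le> real N\<close> by auto
      then show ?thesis by simp
    qed
    then have "eventually (\<lambda>n. indicator {-real n..real n} s *\<^sub>R f s = f s) sequentially"
      unfolding eventually_sequentially by blast
    then show "(\<lambda>n. indicator {-real n..real n} s *\<^sub>R f s) \<longlonglongrightarrow> f s"
      by (rule tendsto_eventually)
  qed
  show "AE s in lborel. norm (indicator {-real n..real n} s *\<^sub>R f s) \<le> norm (f s)" for n
    by (auto split: split_indicator)
qed (use assms in auto)

text \<open>A convex domain provides a primitive \<open>F\<close>, so both truncated integrals are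
  differences of values of \<open>F\<close> and no rectangular contour is needed. Their difference
  consists of the increments of \<open>F\<close> along the two vertical sides, which vanish in the
  limit by the quadratic decay.\<close>

lemma line_integral_shift:
  fixes f :: "complex \<Rightarrow> complex"
  assumes hol: "f holomorphic_on U" and U: "convex U" "open U" and cd: "c \<le> d"
    and sub: "\<And>\<sigma>. c \<le> Im \<sigma> \<Longrightarrow> Im \<sigma> \<le> d \<Longrightarrow> \<sigma> \<in> U"
    and bd: "\<And>\<sigma>. c \<le> Im \<sigma> \<Longrightarrow> Im \<sigma> \<le> d \<Longrightarrow> norm (f \<sigma>) \<le> C / (1 + (Re \<sigma>)\<^sup>2)"
  shows "(LBINT s. f (Complex s c)) = (LBINT s. f (Complex s d))"
proof -
  obtain F where F: "\<And>x. x \<in> U \<Longrightarrow> (F has_field_derivative f x) (at x)"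
    using holomorphic_convex_primitive'[OF U hol] U at_within_open by metis
  have C: "C \<ge> 0"
    using order_trans[OF norm_ge_zero bd[of "Complex 0 c"]] cd by simp
  have cont: "continuous_on UNIV (\<lambda>s. f (Complex s e))" if "c \<le> e" "e \<le> d" for e
    using that sub by (intro holomorphic_continuous_line[OF hol]) auto
  have int: "integrable lborel (\<lambda>s. f (Complex s e))" if "c \<le> e" "e \<le> d" for e
    using that bd[of "Complex _ e"] cont[OF that]
    by (intro integrable_of_square_decay[where C = C]) (auto intro!: borel_measurable_continuous_onI)
  have ftc: "(LBINT s. indicator {-real n..real n} s *\<^sub>R f (Complex s e))
      = F (Complex (real n) e) - F (Complex (- real n) e)" if "c \<le> e" "e \<le> d" for n e
  proof (rule integral_FTC_atLeastAtMost)
    show "continuous_on {-real n..real n} (\<lambda>s. f (Complex s e))"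
      using cont[OF that] continuous_on_subset by blast
    fix s
    have "((\<lambda>s. Complex s e) has_vector_derivative 1) (at s within {-real n..real n})"
      unfolding Complex_eq by (auto intro!: derivative_eq_intros)
    moreover have "(F has_field_derivative f (Complex s e)) (at (Complex s e))"
      using F sub that by auto
    ultimately show "((\<lambda>s. F (Complex s e)) has_vector_derivative f (Complex s e)) (at s within {-real n..real n})"
      using field_vector_diff_chain_within[of "\<lambda>s. Complex s e" 1 s _ F]
      by (force simp: o_def intro: DERIV_subset)
  qed simp
  have seg: "norm (F (Complex x c) - F (Complex x d)) \<le> C / (1 + x\<^sup>2) * (d - c)" for x
  proof -
    have segm: "Re \<sigma> = x \<and> c \<le> Im \<sigma> \<and> Im \<sigma> \<le> d" if "\<sigma> \<in> closed_segment (Complex x d) (Complex x c)" for \<sigma>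
    proof -
      from that obtain u where u: "0 \<le> u" "u \<le> 1" "\<sigma> = (1 - u) *\<^sub>R Complex x d + u *\<^sub>R Complex x c"
        by (auto simp: closed_segment_def)
      have "Re \<sigma> = x" by (simp add: u(3) algebra_simps)
      moreover have "Im \<sigma> = d - u * (d - c)" by (simp add: u(3) algebra_simps)
      moreover have "0 \<le> u * (d - c)" "u * (d - c) \<le> d - c"
        using u cd mult_right_mono[of u 1 "d - c"] by auto
      ultimately show ?thesis by auto
    qed
    have "norm (F (Complex x c) - F (Complex x d)) \<le> C / (1 + x\<^sup>2) * norm (Complex x c - Complex x d)"
    proof (rule field_differentiable_bound[where S = "closed_segment (Complex x d) (Complex x c)" and f' = f])
      show "(F has_field_derivative f z) (at z within closed_segment (Complex x d) (Complex x c))"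
        if "z \<in> closed_segment (Complex x d) (Complex x c)" for z
        using F sub segm[OF that] by (auto intro: DERIV_subset)
      show "norm (f z) \<le> C / (1 + x\<^sup>2)"
        if "z \<in> closed_segment (Complex x d) (Complex x c)" for z
        using bd segm[OF that] by auto
    qed auto
    also have "norm (Complex x c - Complex x d) = d - c"
      using cd by (simp add: complex_diff cmod_def)
    finally show ?thesis .
  qed
  let ?D = "\<lambda>n. (LBINT s. indicator {-real n..real n} s *\<^sub>R f (Complex s c))
      - (LBINT s. indicator {-real n..real n} s *\<^sub>R f (Complex s d))"
  have "?D \<longlonglongrightarrow> (LBINT s. f (Complex s c)) - (LBINT s. f (Complex s d))"
    using cd by (intro tendsto_diff line_integral_limit int) auto
  moreover have "?D \<longlonglongrightarrow> 0"
  proof (rule Lim_null_comparison)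
    have "norm (?D n) \<le> 2 * (C / (1 + (real n)\<^sup>2) * (d - c))" for n
    proof -
      have "?D n = (F (Complex (real n) c) - F (Complex (real n) d))
          - (F (Complex (- real n) c) - F (Complex (- real n) d))"
        using cd by (simp add: ftc)
      then show ?thesis
        using norm_triangle_ineq4[of "F (Complex (real n) c) - F (Complex (real n) d)"
            "F (Complex (- real n) c) - F (Complex (- real n) d)"]
          seg[of "real n"] seg[of "- real n"] by simp
    qed
    then show "\<forall>\<^sub>F n in sequentially. norm (?D n) \<le> 2 * (C / (1 + (real n)\<^sup>2) * (d - c))"
      by simp
    show "(\<lambda>n. 2 * (C / (1 + (real n)\<^sup>2) * (d - c))) \<longlonglongrightarrow> 0"
      by real_asymp
  qed
  ultimately show ?thesis
    using LIMSEQ_unique by fastforce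
qed

section \<open>Square means over horizontal lines\<close>

lemma one_plus_square_le: "1 + s\<^sup>2 \<le> (1 + \<bar>s\<bar>)\<^sup>2" for s :: real
  by (simp add: power2_eq_square algebra_simps)

lemma decay_product:
  fixes s :: real
  assumes "a \<le> A / (1 + \<bar>s\<bar>)" "b \<le> B / (1 + \<bar>s\<bar>)" "0 \<le> a" "0 \<le> b"
  shows "a * b \<le> A * B / (1 + s\<^sup>2)"
proof -
  have p: "1 + \<bar>s\<bar> > 0" by simp
  have A: "A \<ge> 0" "B \<ge> 0"
    using order_trans[OF assms(3,1)] order_trans[OF assms(4,2)] p
    by (simp_all add: zero_le_divide_iff)
  have "a * b \<le> (A / (1 + \<bar>s\<bar>)) * (B / (1 + \<bar>s\<bar>))"
    using assms by (intro mult_mono) auto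
  also have "\<dots> = A * B / (1 + \<bar>s\<bar>)\<^sup>2"
    by (simp add: power2_eq_square)
  also have "\<dots> \<le> A * B / (1 + s\<^sup>2)"
    using A one_plus_square_le[of s] by (intro divide_left_mono) (auto simp: add_pos_nonneg)
  finally show ?thesis .
qed

lemma halfplane_line_bound:
  assumes C: "\<And>\<sigma>. Im \<sigma> \<ge> 0 \<Longrightarrow> norm (f \<sigma>) \<le> C / (1 + norm \<sigma>)" and "v \<ge> 0"
  shows "norm (f (Complex s v)) \<le> C / (1 + \<bar>s\<bar>)"
proof -
  have "C \<ge> 0" using order_trans[OF norm_ge_zero C[of 0]] by simp
  have "norm (f (Complex s v)) \<le> C / (1 + norm (Complex s v))"
    using assms by simp
  also have "\<dots> \<le> C / (1 + \<bar>s\<bar>)"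
    using \<open>C \<ge> 0\<close> abs_Re_le_cmod[of "Complex s v"] by (intro divide_left_mono) (auto simp: add_pos_nonneg)
  finally show ?thesis .
qed

text \<open>Doubling: a shift of the line of integration and the Cauchy-Schwarz inequality give
  \<open>N(y)\<^sup>2 \<le> N(2y) N(0)\<close> for \<open>N(y)\<close> the integral of \<open>|f|\<^sup>2\<close> over the line at height \<open>y\<close>; as \<open>N\<close> is
  bounded, iterating forces \<open>N(y) \<le> N(0)\<close>.\<close>

lemma doubling_bound:
  fixes N :: "real \<Rightarrow> real"
  assumes sq: "\<And>y. y \<ge> 0 \<Longrightarrow> (N y)\<^sup>2 \<le> N (2 * y) * N 0"
    and bd: "\<And>y. y \<ge> 0 \<Longrightarrow> N y \<le> B" and nn: "\<And>y. y \<ge> 0 \<Longrightarrow> 0 \<le> N y" and y: "y \<ge> 0"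
  shows "N y \<le> N 0"
proof (rule ccontr)
  assume "\<not> N y \<le> N 0"
  then have less: "N 0 < N y" by simp
  have pos: "N 0 > 0"
  proof (rule ccontr)
    assume "\<not> N 0 > 0"
    then have "N 0 = 0" using nn[of 0] by simp
    with sq[OF y] less show False by simp
  qed
  define r where "r = N y / N 0"
  have r: "r > 1" using less pos by (simp add: r_def)
  have it: "r ^ (2 ^ k) \<le> N (2 ^ k * y) / N 0" for k
  proof (induction k)
    case 0 then show ?case by (simp add: r_def)
  next
    case (Suc k)
    have "r ^ (2 ^ Suc k) = (r ^ (2 ^ k))\<^sup>2" by (simp add: mult.commute flip: power_mult)
    also have "\<dots> \<le> (N (2 ^ k * y) / N 0)\<^sup>2"
      using Suc r by (intro power_mono) auto
    also have "\<dots> \<le> N (2 * (2 ^ k * y)) / N 0"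
      using sq[of "2 ^ k * y"] y pos by (simp add: field_simps power2_eq_square)
    finally show ?case by (simp add: mult.assoc)
  qed
  have "eventually (\<lambda>k. r ^ k > B / N 0) sequentially"
    using filterlim_realpow_sequentially_gt1[of r] r
    by (intro filterlim_at_top_dense[THEN iffD1, rule_format]) (auto intro: filterlim_at_infinity_imp_filterlim_at_top)
  then obtain K where K: "\<And>k. k \<ge> K \<Longrightarrow> r ^ k > B / N 0"
    unfolding eventually_sequentially by auto
  have "B / N 0 < r ^ (2 ^ K)"
    by (rule K) (simp add: less_imp_le)
  also have "\<dots> \<le> N (2 ^ K * y) / N 0" by (rule it)
  also have "\<dots> \<le> B / N 0" using bd[of "2 ^ K * y"] y pos by (simp add: divide_right_mono)
  finally show False by simp
qed

lemma integrable_mult_cnj: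
  fixes f g :: "'a \<Rightarrow> complex"
  assumes [measurable]: "f \<in> borel_measurable M" "g \<in> borel_measurable M"
    and f: "integrable M (\<lambda>x. (norm (f x))\<^sup>2)" and g: "integrable M (\<lambda>x. (norm (g x))\<^sup>2)"
  shows "integrable M (\<lambda>x. f x * cnj (g x))"
proof (rule Bochner_Integration.integrable_bound)
  show "integrable M (\<lambda>x. (norm (f x))\<^sup>2 + (norm (g x))\<^sup>2)"
    using f g by (rule Bochner_Integration.integrable_add)
  show "AE x in M. norm (f x * cnj (g x)) \<le> norm ((norm (f x))\<^sup>2 + (norm (g x))\<^sup>2)"
  proof (rule AE_I2)
    fix x
    have "0 \<le> (norm (f x) - norm (g x))\<^sup>2" by simp
    then have "2 * (norm (f x) * norm (g x)) \<le> (norm (f x))\<^sup>2 + (norm (g x))\<^sup>2"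
      by (simp add: power2_diff)
    moreover have "0 \<le> norm (f x) * norm (g x)" by simp
    ultimately have "norm (f x) * norm (g x) \<le> (norm (f x))\<^sup>2 + (norm (g x))\<^sup>2" by linarith
    then show "norm (f x * cnj (g x)) \<le> norm ((norm (f x))\<^sup>2 + (norm (g x))\<^sup>2)"
      by (simp add: norm_mult)
  qed
qed measurable

lemma integral_Cauchy_Schwarz:
  fixes f g :: "'a \<Rightarrow> complex"
  assumes [measurable]: "f \<in> borel_measurable M" "g \<in> borel_measurable M"
    and f: "integrable M (\<lambda>x. (norm (f x))\<^sup>2)" and g: "integrable M (\<lambda>x. (norm (g x))\<^sup>2)"
  shows "(norm (\<integral>x. f x * cnj (g x) \<partial>M))\<^sup>2 \<le> (\<integral>x. (norm (f x))\<^sup>2 \<partial>M) * (\<integral>x. (norm (g x))\<^sup>2 \<partial>M)"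
proof -
  have int: "integrable M (\<lambda>x. norm (f x) * norm (g x))"
    using integrable_norm[OF integrable_mult_cnj[OF assms]] by (simp add: norm_mult)
  have "norm (\<integral>x. f x * cnj (g x) \<partial>M) \<le> (\<integral>x. norm (f x) * norm (g x) \<partial>M)"
    using integral_norm_bound[of M "\<lambda>x. f x * cnj (g x)"] by (simp add: norm_mult)
  then have "(norm (\<integral>x. f x * cnj (g x) \<partial>M))\<^sup>2 \<le> (\<integral>x. norm (f x) * norm (g x) \<partial>M)\<^sup>2"
    by (intro power_mono) auto
  also have "\<dots> \<le> (\<integral>x. (norm (f x))\<^sup>2 \<partial>M) * (\<integral>x. (norm (g x))\<^sup>2 \<partial>M)"
  proof -
    have "(\<integral>\<^sup>+x. ennreal (norm (f x)) * ennreal (norm (g x)) \<partial>M)\<^sup>2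
        \<le> (\<integral>\<^sup>+x. ennreal (norm (f x))^2 \<partial>M) * (\<integral>\<^sup>+x. ennreal (norm (g x))^2 \<partial>M)"
      by (rule Cauchy_Schwarz_nn_integral) auto
    then have "ennreal ((\<integral>x. norm (f x) * norm (g x) \<partial>M)\<^sup>2)
       \<le> ennreal ((\<integral>x. (norm (f x))\<^sup>2 \<partial>M) * (\<integral>x. (norm (g x))\<^sup>2 \<partial>M))"
      using int f g
      by (simp add: ennreal_mult[symmetric] ennreal_power nn_integral_eq_integral integral_nonneg_AE)
    then show ?thesis
      by (subst (asm) ennreal_le_iff) (auto intro!: mult_nonneg_nonneg integral_nonneg_AE)
  qed
  finally show ?thesis .
qed

text \<open>The inequality that \<open>doubling_bound\<close> asks for comes from a contour shift,
  so no Poisson representation is needed. The decay of \<open>f\<close> makes the square means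
  finite and bounded independently of the height.\<close>

lemma halfplane_L2_decreasing:
  assumes hol: "f holomorphic_on {\<sigma>. Im \<sigma> > - e}" and e: "e > 0"
    and C: "\<And>\<sigma>. Im \<sigma> \<ge> 0 \<Longrightarrow> norm (f \<sigma>) \<le> C / (1 + norm \<sigma>)" and y: "y \<ge> 0"
  shows "integrable lborel (\<lambda>s. (norm (f (Complex s y)))\<^sup>2)"
    and "(LBINT s. (norm (f (Complex s y)))\<^sup>2) \<le> (LBINT s. (norm (f (Complex s 0)))\<^sup>2)"
proof -
  define N where "N = (\<lambda>y. LBINT s. (norm (f (Complex s y)))\<^sup>2)"
  have lb: "norm (f (Complex s v)) \<le> C / (1 + \<bar>s\<bar>)" if "v \<ge> 0" for s v
    using C that by (rule halfplane_line_bound)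
  have cont: "continuous_on UNIV (\<lambda>s. f (Complex s v))" if "v \<ge> 0" for v
    using that e by (intro holomorphic_continuous_line[OF hol]) auto
  have bm: "(\<lambda>s. f (Complex s v)) \<in> borel_measurable borel" if "v \<ge> 0" for v
    using cont[OF that] by (rule borel_measurable_continuous_onI)
  have sqb: "(norm (f (Complex s v)))\<^sup>2 \<le> C * C / (1 + s\<^sup>2)" if "v \<ge> 0" for s v
    using decay_product[OF lb[OF that] lb[OF that]] by (simp add: power2_eq_square)
  have int: "integrable lborel (\<lambda>s. (norm (f (Complex s v)))\<^sup>2)" if "v \<ge> 0" for v
    using sqb[OF that] bm[OF that] by (intro integrable_of_square_decay[where C = "C * C"]) auto
  show "integrable lborel (\<lambda>s. (norm (f (Complex s y)))\<^sup>2)" using int[OF y] .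
  have "N y \<le> N 0"
  proof (rule doubling_bound[where B = "LBINT s. C * C / (1 + s\<^sup>2)"])
    fix y :: real assume y: "y \<ge> 0"
    show "N y \<le> (LBINT s. C * C / (1 + s\<^sup>2))"
      unfolding N_def using y by (intro integral_mono int integrable_inverse_square sqb)
    show "0 \<le> N y" unfolding N_def by (intro integral_nonneg_AE) auto
    \<comment> \<open>Reflecting \<open>f\<close> in the real axis makes the product holomorphic. On
      the real line it equals \<open>norm (f (s + \<i> y))\<close> squared; at height
      \<open>y\<close> it is \<open>f (s + 2 \<i> y)\<close> times the conjugate of
      \<open>f s\<close>.\<close>
    define \<Phi> where "\<Phi> = (\<lambda>\<sigma>. f (\<sigma> + \<i> * y) * cnj (f (cnj (\<sigma> - \<i> * y))))"
    let ?U = "{\<sigma>. Im \<sigma> > - e} \<inter> {\<sigma>. Im \<sigma> < y + e}"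
    have holc: "(cnj \<circ> f \<circ> cnj) holomorphic_on {\<sigma>. Im \<sigma> < e}"
      by (rule holomorphic_on_compose_cnj_cnj)
        (auto intro!: holomorphic_on_subset[OF hol] open_halfspace_Im_lt)
    have hol\<Phi>: "\<Phi> holomorphic_on ?U"
    proof -
      have "(\<lambda>\<sigma>. f (\<sigma> + \<i> * y)) holomorphic_on ?U"
        using y by (intro holomorphic_on_translate[OF hol]) auto
      moreover have "(\<lambda>\<sigma>. (cnj \<circ> f \<circ> cnj) (\<sigma> - \<i> * y)) holomorphic_on ?U"
        using holomorphic_on_translate[OF holc, of ?U "- \<i> * y"] y by simp
      ultimately show ?thesis
        unfolding \<Phi>_def by (auto simp: o_def image_subset_iff intro!: holomorphic_intros)
    qed
    have \<Phi>: "\<Phi> (Complex s v) = f (Complex s (v + y)) * cnj (f (Complex s (y - v)))" for s v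
    proof -
      have "Complex s v + \<i> * y = Complex s (v + y)" "cnj (Complex s v - \<i> * y) = Complex s (y - v)"
        by (auto simp: complex_eq_iff)
      then show ?thesis by (simp only: \<Phi>_def)
    qed
    have shift: "(LBINT s. \<Phi> (Complex s 0)) = (LBINT s. \<Phi> (Complex s y))"
    proof (rule line_integral_shift[where U = ?U and C = "C * C"])
      show "convex ?U" by (intro convex_Int convex_halfspace_Im_gt convex_halfspace_Im_lt)
      show "open ?U" by (intro open_Int open_halfspace_Im_gt open_halfspace_Im_lt)
      fix \<sigma> assume s: "0 \<le> Im \<sigma>" "Im \<sigma> \<le> y"
      show "\<sigma> \<in> ?U" using s e by auto
      have "norm (\<Phi> (Complex (Re \<sigma>) (Im \<sigma>))) \<le> C * C / (1 + (Re \<sigma>)\<^sup>2)"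
        unfolding \<Phi> norm_mult complex_mod_cnj using s y by (intro decay_product lb) auto
      then show "norm (\<Phi> \<sigma>) \<le> C * C / (1 + (Re \<sigma>)\<^sup>2)" by simp
    qed (use y hol\<Phi> in auto)
    have "of_real (N y) = (LBINT s. complex_of_real ((norm (f (Complex s y)))\<^sup>2))"
      unfolding N_def by (rule integral_complex_of_real[symmetric])
    also have "\<dots> = (LBINT s. \<Phi> (Complex s 0))"
      unfolding \<Phi> complex_norm_square by simp
    also have "\<dots> = (LBINT s. f (Complex s (2 * y)) * cnj (f (Complex s 0)))"
      unfolding shift unfolding \<Phi> by simp
    finally have "(N y)\<^sup>2 = (norm (LBINT s. f (Complex s (2 * y)) * cnj (f (Complex s 0))))\<^sup>2"
      by (metis norm_of_real power2_abs)
    also have "\<dots> \<le> N (2 * y) * N 0"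
      unfolding N_def using y by (intro integral_Cauchy_Schwarz int) (auto intro!: bm)
    finally show "(N y)\<^sup>2 \<le> N (2 * y) * N 0" .
  qed (use y in auto)
  then show "(LBINT s. (norm (f (Complex s y)))\<^sup>2) \<le> (LBINT s. (norm (f (Complex s 0)))\<^sup>2)"
    by (simp add: N_def)
qed

section \<open>Cauchy's formula on the upper half-plane\<close>

lemma integral_Poisson:
  assumes \<eta>: "\<eta> > 0"
  shows "integrable lborel (\<lambda>s::real. 1 / ((s - x)\<^sup>2 + \<eta>\<^sup>2))"
    and "(LBINT s. 1 / ((s - x)\<^sup>2 + \<eta>\<^sup>2)) = pi / \<eta>"
proof -
  have int: "integrable lborel (\<lambda>s::real. inverse (1 + s\<^sup>2))"
    and pi: "(LBINT s::real. inverse (1 + s\<^sup>2)) = pi"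
    using integrable_inverse_1_plus_square LBINT_inverse_1_plus_square
    by (simp_all add: set_integrable_def einterval_def interval_lebesgue_integral_def set_lebesgue_integral_def)
  have eq: "inverse (1 + (- x / \<eta> + 1 / \<eta> * s)\<^sup>2) = \<eta>\<^sup>2 * (1 / ((s - x)\<^sup>2 + \<eta>\<^sup>2))" for s
  proof -
    have "- x / \<eta> + 1 / \<eta> * s = (s - x) / \<eta>" by (simp add: diff_divide_distrib)
    then have "1 + (- x / \<eta> + 1 / \<eta> * s)\<^sup>2 = ((s - x)\<^sup>2 + \<eta>\<^sup>2) / \<eta>\<^sup>2"
      using \<eta> by (simp add: power_divide add_divide_distrib)
    then show ?thesis by simp
  qed
  have "integrable lborel (\<lambda>s. inverse (1 + (- x / \<eta> + 1 / \<eta> * s)\<^sup>2))"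
    using \<eta> by (intro lborel_integrable_real_affine int) auto
  then have i2: "integrable lborel (\<lambda>s. \<eta>\<^sup>2 * (1 / ((s - x)\<^sup>2 + \<eta>\<^sup>2)))"
    by (simp only: eq)
  then show "integrable lborel (\<lambda>s::real. 1 / ((s - x)\<^sup>2 + \<eta>\<^sup>2))"
    using integrable_mult_right[of "1 / \<eta>\<^sup>2", OF i2] \<eta> by simp
  have "(LBINT s::real. inverse (1 + s\<^sup>2)) = \<bar>1 / \<eta>\<bar> *\<^sub>R (LBINT s. inverse (1 + (- x / \<eta> + 1 / \<eta> * s)\<^sup>2))"
    using \<eta> by (intro lborel_integral_real_affine) auto
  then have "pi = 1 / \<eta> * (\<eta>\<^sup>2 * (LBINT s. 1 / ((s - x)\<^sup>2 + \<eta>\<^sup>2)))"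
    unfolding pi eq integral_mult_right_zero using \<eta> by simp
  then show "(LBINT s. 1 / ((s - x)\<^sup>2 + \<eta>\<^sup>2)) = pi / \<eta>"
    using \<eta> by (simp add: field_simps power2_eq_square)
qed

text \<open>Subtracting \<open>f z (z - cnj z) / (\<sigma> - cnj z)\<close> removes the pole of \<open>f \<sigma> / (\<sigma> - z)\<close> without
  spoiling its decay; the remainder integrates to zero, by a shift of the line to infinity.\<close>

lemma halfplane_Cauchy:
  assumes hol: "f holomorphic_on {\<sigma>. Im \<sigma> > - e}" and e: "e > 0"
    and C: "\<And>\<sigma>. Im \<sigma> \<ge> 0 \<Longrightarrow> norm (f \<sigma>) \<le> C / (1 + norm \<sigma>)" and z: "Im z > 0"
  shows "(LBINT s. f (of_real s) / (of_real s - z)) = 2 * pi * \<i> * f z"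
proof -
  \<comment> \<open>The domain must stop before \<open>cnj z\<close>, where the subtracted term has
    its pole.\<close>
  define e' where "e' = min e (Im z)"
  let ?U = "{\<sigma>. Im \<sigma> > - e'}"
  have e': "e' > 0" using e z by (simp add: e'_def)
  have C0: "C \<ge> 0" using order_trans[OF norm_ge_zero C[of 0]] by simp
  have U: "open ?U" "convex ?U"
    by (auto intro: open_halfspace_Im_gt convex_halfspace_Im_gt)
  define h where "h = (\<lambda>\<sigma>. f \<sigma> - f z * (z - cnj z) / (\<sigma> - cnj z))"
  have hz: "h z = 0" using z by (auto simp: h_def complex_eq_iff)
  have nz: "\<sigma> - cnj z \<noteq> 0" if "\<sigma> \<in> ?U" for \<sigma>
    using that z by (auto simp: e'_def complex_eq_iff)
  have holh: "h holomorphic_on ?U"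
    unfolding h_def using nz
    by (auto intro!: holomorphic_intros holomorphic_on_subset[OF hol] simp: e'_def)
  define g where "g = (\<lambda>\<sigma>. if \<sigma> = z then deriv h z else (h \<sigma> - h z) / (\<sigma> - z))"
  have holg: "g holomorphic_on ?U"
    unfolding g_def by (rule pole_lemma_open[OF holh U(1)])
  \<comment> \<open>On the closed upper half-plane the distance to \<open>cnj z\<close> is at least
    \<open>Im z\<close> and at least \<open>norm \<sigma> - norm z\<close>. A weighted combination
    gives growth like \<open>1 + norm \<sigma>\<close>, so that \<open>h\<close> inherits the decay
    of \<open>f\<close>.\<close>
  have dist: "(Im z / (1 + norm z + Im z)) * (1 + norm \<sigma>) \<le> norm (\<sigma> - cnj z)" if "Im \<sigma> \<ge> 0" for \<sigma>
  proof -
    have a: "Im z \<le> norm (\<sigma> - cnj z)"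
      using abs_Im_le_cmod[of "\<sigma> - cnj z"] that by simp
    have "norm \<sigma> \<le> norm (\<sigma> - cnj z) + norm z"
      using norm_triangle_ineq[of "\<sigma> - cnj z" "cnj z"] by simp
    then have "Im z * (1 + norm \<sigma>) \<le> Im z * (1 + norm z) + Im z * norm (\<sigma> - cnj z)"
      using z by (simp flip: distrib_left)
    also have "\<dots> \<le> norm (\<sigma> - cnj z) * (1 + norm z) + Im z * norm (\<sigma> - cnj z)"
      using a by (intro add_right_mono mult_right_mono) auto
    also have "\<dots> = norm (\<sigma> - cnj z) * (1 + norm z + Im z)"
      by (simp add: algebra_simps)
    finally show ?thesis
      using z by (simp add: field_simps add_pos_nonneg)
  qed
  obtain C1 where C1: "\<And>\<sigma>. Im \<sigma> \<ge> 0 \<Longrightarrow> norm (h \<sigma>) \<le> C1 / (1 + norm \<sigma>)"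
  proof
    fix \<sigma> assume s: "Im \<sigma> \<ge> 0"
    let ?k = "Im z / (1 + norm z + Im z)"
    have k: "?k > 0" using z by (simp add: add_pos_nonneg)
    have p: "1 + norm \<sigma> > 0" by (simp add: add_pos_nonneg)
    have "norm (f z * (z - cnj z) / (\<sigma> - cnj z)) = norm (f z * (z - cnj z)) / norm (\<sigma> - cnj z)"
      by (simp add: norm_divide)
    also have "\<dots> \<le> norm (f z * (z - cnj z)) / (?k * (1 + norm \<sigma>))"
    proof (rule divide_left_mono[OF dist[OF s]])
      have "norm (\<sigma> - cnj z) > 0" "?k * (1 + norm \<sigma>) > 0"
        using order_less_le_trans[OF mult_pos_pos[OF k p] dist[OF s]] mult_pos_pos[OF k p] by blast+
      then show "0 < norm (\<sigma> - cnj z) * (?k * (1 + norm \<sigma>))"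
        by (rule mult_pos_pos)
    qed simp
    finally have "norm (h \<sigma>) \<le> C / (1 + norm \<sigma>) + norm (f z * (z - cnj z)) / (?k * (1 + norm \<sigma>))"
      unfolding h_def using C[OF s] norm_triangle_ineq4[of "f \<sigma>"] by (smt (verit))
    also have "\<dots> = (C + norm (f z * (z - cnj z)) / ?k) / (1 + norm \<sigma>)"
      by (simp add: add_divide_distrib)
    finally show "norm (h \<sigma>) \<le> (C + norm (f z * (z - cnj z)) / ?k) / (1 + norm \<sigma>)" .
  qed
  have C10: "C1 \<ge> 0" using order_trans[OF norm_ge_zero C1[of 0]] by simp
  \<comment> \<open>Outside this radius \<open>norm (\<sigma> - z)\<close> is at least a quarter of
    \<open>1 + norm \<sigma>\<close>, so \<open>g\<close> gains a second order of decay. Inside,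
    compactness bounds \<open>g\<close> across the removed singularity.\<close>
  define R where "R = 2 * norm z + 1"
  let ?S = "cball 0 R \<inter> {\<sigma>. Im \<sigma> \<ge> 0}"
  have "compact (g ` ?S)"
  proof (rule compact_continuous_image)
    show "continuous_on ?S g"
      using e' by (intro holomorphic_on_imp_continuous_on holomorphic_on_subset[OF holg]) auto
    show "compact ?S"
      by (intro compact_Int_closed compact_cball closed_halfspace_Im_ge)
  qed
  then obtain M where M: "\<And>\<sigma>. \<sigma> \<in> ?S \<Longrightarrow> norm (g \<sigma>) \<le> M"
    using compact_imp_bounded bounded_iff by (metis (no_types, lifting) imageI)
  have M0: "M \<ge> 0" using order_trans[OF norm_ge_zero M[of 0]] by (simp add: R_def)
  define D where "D = M * (1 + R)\<^sup>2 + 4 * C1"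
  have D: "norm (g \<sigma>) \<le> D / (1 + norm \<sigma>)\<^sup>2" if s: "Im \<sigma> \<ge> 0" for \<sigma>
  proof -
    have p: "1 + norm \<sigma> > 0" by (simp add: add_pos_nonneg)
    show ?thesis
    proof (cases "norm \<sigma> \<le> R")
      case True
      have "norm (g \<sigma>) * (1 + norm \<sigma>)\<^sup>2 \<le> M * (1 + R)\<^sup>2"
        using True s M0 by (intro mult_mono M power_mono) auto
      also have "\<dots> \<le> D" using C10 by (simp add: D_def)
      finally show ?thesis using p by (simp add: field_simps)
    next
      case False
      have "norm \<sigma> \<le> norm (\<sigma> - z) + norm z"
        using norm_triangle_ineq[of "\<sigma> - z" z] by simp
      then have b: "(1 + norm \<sigma>) / 4 \<le> norm (\<sigma> - z)"
      proof -
        have "2 * norm z + 1 < norm \<sigma>" using False by (simp add: R_def)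
        then have "1 + norm \<sigma> \<le> 4 * norm (\<sigma> - z)"
          using \<open>norm \<sigma> \<le> norm (\<sigma> - z) + norm z\<close> norm_ge_zero[of z] by linarith
        then show ?thesis by simp
      qed
      have "\<sigma> \<noteq> z" using False by (auto simp: R_def)
      then have "norm (g \<sigma>) = norm (h \<sigma>) / norm (\<sigma> - z)"
        by (simp add: g_def hz norm_divide)
      also have "\<dots> \<le> (C1 / (1 + norm \<sigma>)) / ((1 + norm \<sigma>) / 4)"
        using b p C1[OF s] C10 by (intro frac_le) auto
      also have "\<dots> = 4 * C1 / (1 + norm \<sigma>)\<^sup>2"
        by (simp add: power2_eq_square)
      also have "\<dots> \<le> D / (1 + norm \<sigma>)\<^sup>2"
        using M0 by (intro divide_right_mono) (auto simp: D_def)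
      finally show ?thesis .
    qed
  qed
  have D0: "D \<ge> 0" using M0 C10 by (simp add: D_def)
  have D1: "norm (g (Complex s v)) \<le> D / (1 + s\<^sup>2)" if "v \<ge> 0" for s v
  proof -
    have "1 + s\<^sup>2 \<le> (1 + norm (Complex s v))\<^sup>2"
    proof (rule order_trans[OF one_plus_square_le])
      show "(1 + \<bar>s\<bar>)\<^sup>2 \<le> (1 + norm (Complex s v))\<^sup>2"
        using abs_Re_le_cmod[of "Complex s v"] by (intro power_mono) auto
    qed
    then have "D / (1 + norm (Complex s v))\<^sup>2 \<le> D / (1 + s\<^sup>2)"
      using D0 by (intro frac_le) (auto intro: add_pos_nonneg)
    then show ?thesis using D[of "Complex s v"] that by simp
  qed
  have cont: "continuous_on UNIV (\<lambda>s. g (Complex s v))" if "v \<ge> 0" for v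
    using that e' by (intro holomorphic_continuous_line[OF holg]) auto
  have gint: "integrable lborel (\<lambda>s. g (Complex s 0))"
    using D1[of 0] cont[of 0]
    by (intro integrable_of_square_decay[where C = D]) (auto intro!: borel_measurable_continuous_onI)
  have "(LBINT s. g (Complex s 0)) = (LBINT s. g (Complex s (real n)))" for n
  proof (rule line_integral_shift[OF holg U(2,1)])
    fix \<sigma> assume s: "0 \<le> Im \<sigma>" "Im \<sigma> \<le> real n"
    show "\<sigma> \<in> ?U" using s e' by auto
    show "norm (g \<sigma>) \<le> D / (1 + (Re \<sigma>)\<^sup>2)"
      using D1[of "Im \<sigma>" "Re \<sigma>"] s by simp
  qed auto
  moreover have "(\<lambda>n. LBINT s. g (Complex s (real n))) \<longlonglongrightarrow> (\<integral>s. (0::complex) \<partial>(lborel :: real measure))"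
  proof (rule integral_dominated_convergence[where w = "\<lambda>s. D / (1 + s\<^sup>2)"])
    show "AE s in lborel. norm (g (Complex s (real n))) \<le> D / (1 + s\<^sup>2)" for n
      using D1 by simp
    show "AE s in lborel. (\<lambda>n. g (Complex s (real n))) \<longlonglongrightarrow> 0"
    proof (rule AE_I2, rule Lim_null_comparison)
      fix s
      have "norm (g (Complex s (real n))) \<le> D / (1 + real n)\<^sup>2" for n
      proof -
        have "(1 + real n)\<^sup>2 \<le> (1 + norm (Complex s (real n)))\<^sup>2"
          using abs_Im_le_cmod[of "Complex s (real n)"] by (intro power_mono) auto
        then have "D / (1 + norm (Complex s (real n)))\<^sup>2 \<le> D / (1 + real n)\<^sup>2"
          using D0 by (intro frac_le) (auto intro: add_pos_nonneg)
        then show ?thesis using D[of "Complex s (real n)"] by simp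
      qed
      then show "\<forall>\<^sub>F n in sequentially. norm (g (Complex s (real n))) \<le> D / (1 + real n)\<^sup>2"
        by simp
      show "(\<lambda>n. D / (1 + real n)\<^sup>2) \<longlonglongrightarrow> 0" by real_asymp
    qed
    show "(\<lambda>s. g (Complex s (real n))) \<in> borel_measurable lborel" for n
      using cont[of "real n"] by (simp add: borel_measurable_continuous_onI)
  qed (auto intro: integrable_inverse_square)
  ultimately have g0: "(LBINT s. g (Complex s 0)) = 0"
    by (simp add: LIMSEQ_const_iff)
  \<comment> \<open>On the real line the subtracted term becomes a multiple of the Poisson kernel,
    because \<open>(s - cnj z) * (s - z)\<close> is the square of the distance from \<open>s\<close>
    to \<open>z\<close>. Its integral \<open>pi / Im z\<close> against
    \<open>f z * 2 \<i> Im z\<close> yields the value of the formula.\<close>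
  have geq: "g (Complex s 0) = f (of_real s) / (of_real s - z)
      - (f z * (2 * \<i> * Im z)) * of_real (1 / ((s - Re z)\<^sup>2 + (Im z)\<^sup>2))" for s
  proof -
    have ne: "of_real s - z \<noteq> 0" "of_real s - cnj z \<noteq> 0" "z \<noteq> cnj z" using z by (auto simp: complex_eq_iff)
    have zz: "z - cnj z = 2 * \<i> * Im z" by (simp add: complex_eq_iff)
    have "(of_real s - cnj z) * (of_real s - z) = of_real ((s - Re z)\<^sup>2 + (Im z)\<^sup>2)"
      by (simp add: complex_eq_iff power2_eq_square algebra_simps)
    then have "(1::complex) / ((of_real s - cnj z) * (of_real s - z)) = of_real (1 / ((s - Re z)\<^sup>2 + (Im z)\<^sup>2))"
      by (metis of_real_1 of_real_divide)
    moreover have "g (Complex s 0) = f (of_real s) / (of_real s - z)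
        - f z * (z - cnj z) * (1 / ((of_real s - cnj z) * (of_real s - z)))"
      using ne by (simp add: g_def hz h_def diff_divide_distrib flip: complex_of_real_def)
    ultimately show ?thesis unfolding zz by simp
  qed
  let ?P = "\<lambda>s. (f z * (2 * \<i> * Im z)) * of_real (1 / ((s - Re z)\<^sup>2 + (Im z)\<^sup>2))"
  have Pint: "integrable lborel ?P"
    by (intro integrable_mult_right integrable_of_real integral_Poisson z)
  have "(LBINT s. f (of_real s) / (of_real s - z)) = (LBINT s. g (Complex s 0) + ?P s)"
    unfolding geq by simp
  also have "\<dots> = (LBINT s. ?P s)"
    using gint Pint by (simp add: g0 del: of_real_divide)
  also have "\<dots> = (f z * (2 * \<i> * Im z)) * of_real (pi / Im z)"
    using integral_Poisson(2)[OF z, of "Re z"] by (simp del: of_real_divide)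
  also have "\<dots> = 2 * pi * \<i> * f z"
    using z by simp
  finally show ?thesis .
qed

section \<open>The weighted Bergman formula\<close>

lemma norm_add_of_real_ge:
  assumes B: "Re B > 0" and v: "v \<ge> 0"
  shows "(norm B + v) / 2 \<le> norm (B + of_real v)"
proof -
  have "(Re B)\<^sup>2 \<le> (Re B + v)\<^sup>2"
    using assms by (intro power_mono) auto
  then have "norm B \<le> norm (B + of_real v)"
    by (simp add: cmod_def)
  moreover have "v \<le> norm (B + of_real v)"
    using complex_Re_le_cmod[of "B + of_real v"] B by simp
  ultimately show ?thesis by simp
qed

text \<open>The substitution \<open>u = v / (r + v)\<close> makes the integrand elementary:
  \<open>u powr b / (b * r)\<close> is an antiderivative, and it rises from 0 to
  \<open>1 / (b * r)\<close>.\<close>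

lemma Bergman_integral_real:
  assumes r: "r > 0" and b: "b > (0::real)"
  shows "set_integrable lborel {0<..} (\<lambda>v. v powr (b - 1) * (r + v) powr (- b - 1))"
    and "(LBINT v:{0<..}. v powr (b - 1) * (r + v) powr (- b - 1)) = 1 / (b * r)"
proof -
  let ?F = "\<lambda>v. v powr b * (r + v) powr (- b) / (b * r)"
  have ei: "einterval 0 \<infinity> = {0<..}" by (auto simp: einterval_def zero_ereal_def)
  have F: "DERIV ?F v :> v powr (b - 1) * (r + v) powr (- b - 1)" if "0 < ereal v" for v
  proof -
    have v: "v > 0" using that by simp
    have p: "r + v \<noteq> 0" using v r by simp
    have e1: "v powr b = v * v powr (b - 1)" "(r + v) powr (- b) = (r + v) * (r + v) powr (- b - 1)"
      using v r by (simp_all add: powr_mult_base)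
    have "DERIV (\<lambda>v. v powr b * (r + v) powr (- b)) v :> b * v powr (b - 1) * (r + v) powr (- b) - v powr b * (b * (r + v) powr (- b - 1))"
      using v r by (auto intro!: derivative_eq_intros simp: algebra_simps)
    then have "DERIV ?F v :> (b * v powr (b - 1) * (r + v) powr (- b) - v powr b * (b * (r + v) powr (- b - 1))) / (b * r)"
      by (rule DERIV_cdivide)
    also have "(b * v powr (b - 1) * (r + v) powr (- b) - v powr b * (b * (r + v) powr (- b - 1))) / (b * r)
        = v powr (b - 1) * (r + v) powr (- b - 1)"
      unfolding e1 using r b by (simp add: field_simps)
    finally show ?thesis .
  qed
  have c: "isCont (\<lambda>v. v powr (b - 1) * (r + v) powr (- b - 1)) v" if "0 < ereal v" for v
    using that r by (auto intro!: continuous_intros)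
  have l0: "((?F \<circ> real_of_ereal) \<longlongrightarrow> 0) (at_right 0)"
  proof -
    have "((\<lambda>v. v powr b) \<longlongrightarrow> 0) (at_right 0)"
      using b by real_asymp
    moreover have "((\<lambda>v. (r + v) powr (- b)) \<longlongrightarrow> (r + 0) powr (- b)) (at_right 0)"
      using r by (intro tendsto_intros) auto
    ultimately have "(?F \<longlongrightarrow> 0 * (r + 0) powr (- b) / (b * r)) (at_right 0)"
      using r b by (intro tendsto_divide tendsto_mult tendsto_const) auto
    then show ?thesis by (simp add: zero_ereal_def ereal_tendsto_simps)
  qed
  have l1: "((?F \<circ> real_of_ereal) \<longlongrightarrow> 1 / (b * r)) (at_left \<infinity>)"
  proof -
    have "(?F \<longlongrightarrow> inverse b * inverse r) at_top"
      using r b by real_asymp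
    then show ?thesis
      unfolding ereal_tendsto_simps by (simp add: divide_inverse)
  qed
  have nn: "AE v in lborel. 0 < ereal v \<longrightarrow> ereal v < \<infinity> \<longrightarrow> 0 \<le> v powr (b - 1) * (r + v) powr (- b - 1)"
    by simp
  have "0 < (\<infinity>::ereal)" by simp
  note FTC = interval_integral_FTC_nonneg[OF this F c nn l0 l1, simplified ei]
  show "set_integrable lborel {0<..} (\<lambda>v. v powr (b - 1) * (r + v) powr (- b - 1))"
    using FTC(1) by simp
  show "(LBINT v:{0<..}. v powr (b - 1) * (r + v) powr (- b - 1)) = 1 / (b * r)"
    using FTC(2) by (simp add: interval_lebesgue_integral_def ei)
qed

lemma Bergman_integral_bound:
  assumes B: "Re B > 0" and b: "b > 0" and v: "v > 0"
  shows "norm (of_real (v powr (b - 1)) * (B + of_real v) powr of_real (- b - 1))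
    \<le> 2 powr (b + 1) * (v powr (b - 1) * (norm B + v) powr (- b - 1))"
proof -
  have nB: "norm B > 0" using B by auto
  have "norm ((B + of_real v) powr of_real (- b - 1)) = norm (B + of_real v) powr (- b - 1)"
    by (subst norm_powr_real_powr') auto
  also have "\<dots> \<le> ((norm B + v) / 2) powr (- b - 1)"
    using norm_add_of_real_ge[OF B, of v] v b nB by (intro powr_mono2') (auto intro: add_pos_pos)
  also have "\<dots> = 2 powr (b + 1) * (norm B + v) powr (- b - 1)"
    using v nB by (simp add: powr_divide powr_diff powr_minus powr_add field_simps)
  finally show ?thesis
    using mult_left_mono[of _ _ "v powr (b - 1)"] by (fastforce simp: norm_mult mult_ac)
qed

text \<open>The antiderivative is that of the real case with \<open>B\<close> for \<open>r\<close>.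
  Positivity of the integrand is lost, so integrability is obtained first, by comparison with the
  real integral at \<open>r = norm B\<close>.\<close>

lemma Bergman_integral:
  fixes B :: complex
  assumes B: "Re B > 0" and b: "b > 0"
  shows "set_integrable lborel {0<..} (\<lambda>v. of_real (v powr (b - 1)) * (B + of_real v) powr of_real (- b - 1))"
    and "(LBINT v:{0<..}. of_real (v powr (b - 1)) * (B + of_real v) powr of_real (- b - 1)) = 1 / (of_real b * B)"
proof -
  let ?f = "\<lambda>v. of_real (v powr (b - 1)) * (B + of_real v) powr of_real (- b - 1)"
  have ei: "einterval 0 \<infinity> = {0<..}" by (auto simp: einterval_def zero_ereal_def)
  have nB: "norm B > 0" "B \<noteq> 0" using B by auto
  have np: "B + of_real v \<notin> \<real>\<^sub>\<le>\<^sub>0" if "v \<ge> 0" for v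
    using that B by (auto simp: complex_nonpos_Reals_iff)
  have bm: "set_borel_measurable lborel {0<..} ?f"
    unfolding set_borel_measurable_def by measurable
  show int: "set_integrable lborel {0<..} ?f"
    unfolding set_integrable_def
  proof (rule Bochner_Integration.integrable_bound)
    show "integrable lborel (\<lambda>v. indicator {0<..} v *\<^sub>R (2 powr (b + 1) * (v powr (b - 1) * (norm B + v) powr (- b - 1))))"
      using set_integrable_mult_right[of "2 powr (b + 1)", OF Bergman_integral_real(1)[OF nB(1) b]]
      by (simp add: set_integrable_def)
    show "AE v in lborel. norm (indicator {0<..} v *\<^sub>R ?f v)
        \<le> norm (indicator {0<..} v *\<^sub>R (2 powr (b + 1) * (v powr (b - 1) * (norm B + v) powr (- b - 1))))"
      using Bergman_integral_bound[OF B b] by (intro AE_I2) (auto split: split_indicator simp: abs_mult norm_mult)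
    show "(\<lambda>v. indicator {0<..} v *\<^sub>R ?f v) \<in> borel_measurable lborel"
      using bm by (simp add: set_borel_measurable_def)
  qed
  let ?F = "\<lambda>v. of_real (v powr b) * (B + of_real v) powr of_real (- b) / (of_real b * B)"
  have F: "(?F has_vector_derivative ?f v) (at v)" if "0 < ereal v" for v
  proof -
    have v: "v > 0" using that by simp
    have p: "B + of_real v \<noteq> 0" using np[of v] v by force
    have e1: "of_real (v powr b) = of_real v * (of_real (v powr (b - 1)) :: complex)"
      using v by (simp add: powr_mult_base flip: of_real_mult)
    have e2: "(B + of_real v) powr of_real (- b) = (B + of_real v) * (B + of_real v) powr of_real (- b - 1)"
      using p by (simp add: powr_diff)
    have "((\<lambda>x. of_real (x powr b) :: complex) has_vector_derivative of_real (b * v powr (b - 1))) (at v)"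
      using v by (intro has_vector_derivative_of_real) (auto intro!: derivative_eq_intros simp flip: has_real_derivative_iff_has_vector_derivative)
    moreover have "((\<lambda>x. (B + of_real x) powr of_real (- b)) has_vector_derivative
        of_real (- b) * (B + of_real v) powr (of_real (- b) - 1)) (at v)"
      using np[of v] v by (intro has_vector_derivative_real_field[where f = "\<lambda>x. (B + x) powr of_real (- b)"])
        (auto intro!: derivative_eq_intros)
    ultimately have "((\<lambda>x. of_real (x powr b) * (B + of_real x) powr of_real (- b)) has_vector_derivative
       (of_real (v powr b) * (of_real (- b) * (B + of_real v) powr (of_real (- b) - 1))
         + of_real (b * v powr (b - 1)) * (B + of_real v) powr of_real (- b))) (at v)"
      by (rule has_vector_derivative_mult)
    then have "(?F has_vector_derivative
       (of_real (v powr b) * (of_real (- b) * (B + of_real v) powr (of_real (- b) - 1))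
         + of_real (b * v powr (b - 1)) * (B + of_real v) powr of_real (- b)) / (of_real b * B)) (at v)"
      by (rule has_vector_derivative_divide)
    moreover have "(of_real (v powr b) * (of_real (- b) * (B + of_real v) powr (of_real (- b) - 1))
         + of_real (b * v powr (b - 1)) * (B + of_real v) powr of_real (- b)) / (of_real b * B) = ?f v"
      unfolding e1 e2 using nB b by (simp add: field_simps)
    ultimately show ?thesis by simp
  qed
  have c: "isCont ?f v" if "0 < ereal v" for v
    using that np[of v] by (auto intro!: continuous_intros)
  have l0: "((?F \<circ> real_of_ereal) \<longlongrightarrow> 0) (at_right 0)"
  proof -
    have "((\<lambda>v. v powr b) \<longlongrightarrow> 0) (at_right 0)"
      using b by real_asymp
    then have "((\<lambda>v. complex_of_real (v powr b)) \<longlongrightarrow> of_real 0) (at_right 0)"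
      by (rule tendsto_of_real)
    moreover have "((\<lambda>v. (B + of_real v) powr of_real (- b)) \<longlongrightarrow> (B + of_real 0) powr of_real (- b)) (at_right 0)"
      using np[of 0] by (intro tendsto_intros tendsto_powr_complex) auto
    ultimately have "(?F \<longlongrightarrow> of_real 0 * (B + of_real 0) powr of_real (- b) / (of_real b * B)) (at_right 0)"
      using b nB by (intro tendsto_divide tendsto_mult tendsto_const) auto
    then show ?thesis by (simp add: zero_ereal_def ereal_tendsto_simps)
  qed
  have l1: "((?F \<circ> real_of_ereal) \<longlongrightarrow> 1 / (of_real b * B)) (at_left \<infinity>)"
    unfolding ereal_tendsto_simps
  proof -
    have inv: "((\<lambda>v. of_real (1 / v) :: complex) \<longlongrightarrow> 0) at_top"
    proof -
      have "((\<lambda>v. 1 / v) \<longlongrightarrow> (0::real)) at_top" by real_asymp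
      from tendsto_of_real[OF this] show ?thesis unfolding of_real_0 .
    qed
    \<comment> \<open>Factoring the positive number \<open>v\<close> out of \<open>B + v\<close>
      respects principal powers; the factor \<open>v powr (- b)\<close> then cancels against
      \<open>v powr b\<close>.\<close>
    have "((\<lambda>v. (1 + B * of_real (1 / v)) powr of_real (- b) / (of_real b * B)) \<longlongrightarrow> (1 + B * 0) powr of_real (- b) / (of_real b * B)) at_top"
      using nB b by (intro tendsto_intros inv tendsto_powr_complex) auto
    moreover have "eventually (\<lambda>v. (1 + B * of_real (1 / v)) powr of_real (- b) / (of_real b * B) = ?F v) at_top"
      using eventually_gt_at_top[of 0]
    proof eventually_elim
      case (elim v)
      have eq: "B + of_real v = of_real v * (1 + B * of_real (1 / v))"
        using elim by (simp add: field_simps)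
      have "(B + of_real v) powr of_real (- b) = of_real v powr of_real (- b) * (1 + B * of_real (1 / v)) powr of_real (- b)"
        unfolding eq using elim by (intro powr_times_real_left) auto
      also have "of_real v powr of_real (- b) = complex_of_real (v powr (- b))"
        using elim powr_of_real[of v "- b"] by simp
      finally show ?case using elim by (simp add: powr_minus field_simps)
    qed
    ultimately have "(?F \<longlongrightarrow> (1 + B * 0) powr of_real (- b) / (of_real b * B)) at_top"
      by (rule Lim_transform_eventually)
    then show "(?F \<longlongrightarrow> 1 / (of_real b * B)) at_top" by simp
  qed
  have "0 < (\<infinity>::ereal)" by simp
  note FTC = interval_integral_FTC_integrable[OF this F c _ l0 l1, simplified ei, OF _ _ int]
  show "(LBINT v:{0<..}. ?f v) = 1 / (of_real b * B)"
    using FTC by (simp add: interval_lebesgue_integral_def ei)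
qed

text \<open>For fixed \<open>v\<close> the line of integration can be moved from height \<open>v\<close> to height \<open>0\<close>; the
  integral over \<open>v\<close> then becomes elementary and what remains is Cauchy's formula.\<close>

lemma halfplane_Bergman:
  fixes b :: real
  assumes hol: "f holomorphic_on {\<sigma>. Im \<sigma> > - e}" and e: "e > 0"
    and C: "\<And>\<sigma>. Im \<sigma> \<ge> 0 \<Longrightarrow> norm (f \<sigma>) \<le> C / (1 + norm \<sigma>)"
    and z: "Im z > 0" and b: "b > 0"
  defines "A \<equiv> \<lambda>s v. - \<i> * (z - of_real s) / 2 + of_real (v / 2)"
  shows "integrable lborel (\<lambda>s. LBINT v:{0<..}. of_real (v powr (b - 1)) * A s v powr of_real (- b - 1) * f (Complex s v))"
    and "(LBINT s. LBINT v:{0<..}. of_real (v powr (b - 1)) * A s v powr of_real (- b - 1) * f (Complex s v))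
    = of_real (4 * pi / b) * f z"
proof -
  define B where "B = (\<lambda>s::real. - \<i> * (z - of_real s) / 2)"
  have ReB: "Re (B s) = Im z / 2" for s by (simp add: B_def)
  have ReB0: "Re (B s) > 0" for s using z by (simp add: ReB)
  have B0: "B s \<noteq> 0" for s using ReB0[of s] by auto
  have C0: "C \<ge> 0" using order_trans[OF norm_ge_zero C[of 0]] by simp
  obtain k where k: "k > 0" "\<And>s. norm (B s) \<ge> k * (1 + \<bar>s\<bar>)"
  proof
    let ?k = "Im z / (2 * (1 + norm z + Im z))"
    have p: "1 + norm z + Im z > 0" using z by (simp add: add_pos_nonneg)
    show "?k > 0" using z p by simp
    fix s
    have nB: "norm (B s) = norm (z - of_real s) / 2" by (simp add: B_def norm_mult norm_divide)
    have a: "Im z \<le> norm (z - of_real s)" using abs_Im_le_cmod[of "z - of_real s"] by simp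
    have "\<bar>s\<bar> \<le> norm z + norm (z - of_real s)"
      using norm_triangle_ineq4[of z "z - of_real s"] by simp
    then have "Im z * (1 + \<bar>s\<bar>) \<le> Im z * (1 + norm z) + Im z * norm (z - of_real s)"
      using z by (simp flip: distrib_left)
    also have "\<dots> \<le> norm (z - of_real s) * (1 + norm z) + Im z * norm (z - of_real s)"
      using a by (intro add_right_mono mult_right_mono) auto
    also have "\<dots> = norm (z - of_real s) * (1 + norm z + Im z)"
      by (simp add: algebra_simps)
    finally show "?k * (1 + \<bar>s\<bar>) \<le> norm (B s)"
      unfolding nB using p by (simp add: field_simps)
  qed
  have lb: "norm (f (Complex s v)) \<le> C / (1 + \<bar>s\<bar>)" if "v \<ge> 0" for s v
    using C that by (rule halfplane_line_bound)
  define g where "g = (\<lambda>v s. of_real (v powr (b - 1)) * (B s + of_real (v / 2)) powr of_real (- b - 1) * f (Complex s v))"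
  define g0 where "g0 = (\<lambda>v s. of_real (v powr (b - 1)) * (B s + of_real v) powr of_real (- b - 1) * f (Complex s 0))"
  \<comment> \<open>A common criterion for the integrands before and after the shift. Integrating
    the majorant over \<open>v\<close> leaves \<open>1 / (b * norm (B s))\<close>, and together with
    the decay of \<open>f\<close> this is of order \<open>1 / (1 + s^2)\<close>.\<close>
  have fint: "integrable (lborel \<Otimes>\<^sub>M lborel) (\<lambda>(s, v). indicator {0<..} v *\<^sub>R G v s)"
    if Gm: "(\<lambda>(s, v). indicator {0<..} v *\<^sub>R G v s) \<in> borel_measurable (lborel \<Otimes>\<^sub>M lborel)"
      and Gb: "\<And>s v. v > 0 \<Longrightarrow> norm (G v s) \<le> D * (v powr (b - 1) * (norm (B s) + v) powr (- b - 1)) * (C / (1 + \<bar>s\<bar>))"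
    for G :: "real \<Rightarrow> real \<Rightarrow> complex" and D :: real
  proof (rule lborel_pair.Fubini_integrable[OF Gm])
    have nB: "norm (B s) > 0" for s using B0 by simp
    note R = Bergman_integral_real[OF nB b]
    let ?h = "\<lambda>s v. indicator {0<..} v *\<^sub>R (D * (v powr (b - 1) * (norm (B s) + v) powr (- b - 1)) * (C / (1 + \<bar>s\<bar>)))"
    have hint: "integrable lborel (?h s)" for s
      using integrable_mult_right[OF R(1)[of s, unfolded set_integrable_def], of "D * (C / (1 + \<bar>s\<bar>))"]
      by (simp add: mult_ac)
    have le: "norm (indicator {0<..} v *\<^sub>R G v s) \<le> ?h s v" for s v
      using Gb[of v s] by (auto split: split_indicator)
    have Gs: "(\<lambda>v. indicator {0<..} v *\<^sub>R G v s) \<in> borel_measurable lborel" for s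
      using measurable_Pair2[OF Gm, of s] by simp
    have Gi: "integrable lborel (\<lambda>v. indicator {0<..} v *\<^sub>R G v s)" for s
      by (rule Bochner_Integration.integrable_bound[OF hint[of s] Gs])
         (use le order_trans[OF _ abs_ge_self] in fastforce)
    show "AE s in lborel. integrable lborel (\<lambda>v. case (s, v) of (s, v) \<Rightarrow> indicator {0<..} v *\<^sub>R G v s)"
      using Gi by simp
    have hval: "(LBINT v. ?h s v) = D * (C / (1 + \<bar>s\<bar>)) * (1 / (b * norm (B s)))" for s
    proof -
      have "(LBINT v. ?h s v) = (LBINT v. D * (C / (1 + \<bar>s\<bar>)) * (indicator {0<..} v *\<^sub>R (v powr (b - 1) * (norm (B s) + v) powr (- b - 1))))"
        by (intro Bochner_Integration.integral_cong) (auto simp: mult_ac)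
      also have "\<dots> = D * (C / (1 + \<bar>s\<bar>)) * (1 / (b * norm (B s)))"
        using R(2)[of s] unfolding integral_mult_right_zero by (simp add: set_lebesgue_integral_def)
      finally show ?thesis .
    qed
    show "integrable lborel (\<lambda>s. LBINT v. norm (case (s, v) of (s, v) \<Rightarrow> indicator {0<..} v *\<^sub>R G v s))"
    proof (rule integrable_of_square_decay)
      have "(\<lambda>s. LBINT v. norm (case (s, v) of (s, v) \<Rightarrow> indicator {0<..} v *\<^sub>R G v s)) \<in> borel_measurable lborel"
        by (rule lborel.borel_measurable_lebesgue_integral) (use Gm in measurable)
      then show "(\<lambda>s. LBINT v. norm (case (s, v) of (s, v) \<Rightarrow> indicator {0<..} v *\<^sub>R G v s)) \<in> borel_measurable borel"
        by simp
      fix s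
      \<comment> \<open>No sign of \<open>D\<close> is assumed; it is read off from the majorant at
        \<open>v = 1\<close>, which dominates a norm.\<close>
      have D0: "D * C \<ge> 0"
      proof -
        have "0 \<le> ?h s 1" using le[of 1 s] norm_ge_zero order_trans by blast
        then have "0 \<le> D * C * ((norm (B s) + 1) powr (- b - 1) / (1 + \<bar>s\<bar>))" by (simp add: mult_ac)
        moreover have "(norm (B s) + 1) powr (- b - 1) / (1 + \<bar>s\<bar>) > 0"
          by (intro divide_pos_pos) (auto simp: add_nonneg_eq_0_iff intro: add_pos_nonneg)
        ultimately show ?thesis by (meson mult_neg_pos not_le)
      qed
      have "(LBINT v. norm (indicator {0<..} v *\<^sub>R G v s)) \<le> (LBINT v. ?h s v)"
        using le Gi hint by (intro integral_mono integrable_norm) auto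
      also have "\<dots> = (D * C / b) * (1 / ((1 + \<bar>s\<bar>) * norm (B s)))"
        unfolding hval by simp
      also have "\<dots> \<le> (D * C / b) * (1 / ((1 + \<bar>s\<bar>) * (k * (1 + \<bar>s\<bar>))))"
        using D0 b k by (intro mult_left_mono divide_left_mono mult_pos_pos) (auto intro: add_pos_nonneg simp: B0)
      also have "\<dots> = (D * C / (b * k)) * (1 / (1 + \<bar>s\<bar>)\<^sup>2)"
        by (simp add: power2_eq_square)
      also have "\<dots> \<le> (D * C / (b * k)) * (1 / (1 + s\<^sup>2))"
        using D0 b k one_plus_square_le[of s]
        by (intro mult_left_mono divide_left_mono) (auto intro!: mult_pos_pos add_pos_nonneg)
      finally show "norm (LBINT v. norm (case (s, v) of (s, v) \<Rightarrow> indicator {0<..} v *\<^sub>R G v s)) \<le> (D * C / (b * k)) / (1 + s\<^sup>2)"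
        by (simp add: integral_nonneg_AE)
    qed
  qed
  have contf: "continuous_on {\<sigma>. Im \<sigma> > - e} f" using hol by (rule holomorphic_on_imp_continuous_on)
  have mB[measurable]: "B \<in> borel_measurable borel"
    unfolding B_def by (intro borel_measurable_continuous_onI continuous_intros) auto
  \<comment> \<open>The value \<open>c = 1\<close> serves the integrand on the line at height
    \<open>v\<close>, the value \<open>c = 0\<close> the shifted one on the real line.\<close>
  have mf: "(\<lambda>(s, v). indicator {0<..} v *\<^sub>R f (Complex s (c * v))) \<in> borel_measurable (lborel \<Otimes>\<^sub>M lborel)"
    if "c \<ge> 0" for c
  proof -
    have "(\<lambda>x::real \<times> real. indicator (UNIV \<times> {0<..}) x *\<^sub>R f (Complex (fst x) (c * snd x))) \<in> borel_measurable borel"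
    proof (rule borel_measurable_continuous_on_indicator)
      show "continuous_on (UNIV \<times> {0<..}) (\<lambda>x::real \<times> real. f (Complex (fst x) (c * snd x)))"
        unfolding Complex_eq using e that
        by (intro continuous_on_compose2[OF contf] continuous_intros) (auto intro: less_le_trans[of _ 0])
      show "UNIV \<times> {0<..} \<in> sets (borel :: (real \<times> real) measure)"
        by (intro borel_open open_Times) auto
    qed
    then show ?thesis
      by (simp add: lborel_prod case_prod_unfold indicator_times)
  qed
  have gint: "integrable (lborel \<Otimes>\<^sub>M lborel) (\<lambda>(s, v). indicator {0<..} v *\<^sub>R g v s)"
  proof (rule fint[where D = "2 powr (b + 1) * 2 powr (b + 1)"])
    define h where "h = (\<lambda>x::real \<times> real. indicator {0<..} (snd x) *\<^sub>R f (Complex (fst x) (1 * snd x)))"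
    have [measurable]: "h \<in> borel_measurable (lborel \<Otimes>\<^sub>M lborel)"
      using mf[of 1] by (simp add: h_def case_prod_unfold)
    have "(\<lambda>(s, v). of_real (v powr (b - 1)) * (B s + of_real (v / 2)) powr of_real (- b - 1) * h (s, v))
       \<in> borel_measurable (lborel \<Otimes>\<^sub>M lborel)"
      by measurable
    then show "(\<lambda>(s, v). indicator {0<..} v *\<^sub>R g v s) \<in> borel_measurable (lborel \<Otimes>\<^sub>M lborel)"
      by (simp add: g_def h_def case_prod_unfold)
    fix s v :: real assume v: "v > 0"
    have "norm ((B s + of_real (v / 2)) powr of_real (- b - 1)) = norm (B s + of_real (v / 2)) powr (- b - 1)"
      by (subst norm_powr_real_powr') auto
    \<comment> \<open>One halving comes from \<open>norm_add_of_real_ge\<close>, the other from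
      \<open>v / 2\<close> standing in place of \<open>v\<close>; each costs a factor
      \<open>2 powr (b + 1)\<close>.\<close>
    also have "\<dots> \<le> ((norm (B s) + v) / 2 / 2) powr (- b - 1)"
    proof (rule powr_mono2')
      have "(norm (B s) + v) / 2 / 2 \<le> (norm (B s) + v / 2) / 2" by simp
      also have "\<dots> \<le> norm (B s + of_real (v / 2))"
        using norm_add_of_real_ge[OF ReB0, of "v / 2"] v by simp
      finally show "(norm (B s) + v) / 2 / 2 \<le> norm (B s + of_real (v / 2))" .
    qed (use v b in \<open>auto intro: add_nonneg_pos\<close>)
    also have "\<dots> = 2 powr (b + 1) * 2 powr (b + 1) * (norm (B s) + v) powr (- b - 1)"
    proof -
      have half: "(x / 2) powr (- b - 1) = 2 powr (b + 1) * x powr (- b - 1)" if "x > 0" for x :: real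
        using that by (simp add: powr_divide powr_diff powr_minus powr_add field_simps)
      have "norm (B s) + v > 0" using v by (intro add_nonneg_pos) auto
      then show ?thesis by (subst half, simp, subst half) auto
    qed
    finally have n: "norm ((B s + of_real (v / 2)) powr of_real (- b - 1)) \<le> 2 powr (b + 1) * 2 powr (b + 1) * (norm (B s) + v) powr (- b - 1)" .
    have "norm (g v s) \<le> v powr (b - 1) * (2 powr (b + 1) * 2 powr (b + 1) * (norm (B s) + v) powr (- b - 1)) * (C / (1 + \<bar>s\<bar>))"
      unfolding g_def norm_mult using v by (intro mult_mono n lb) (auto intro!: mult_nonneg_nonneg)
    then show "norm (g v s) \<le> 2 powr (b + 1) * 2 powr (b + 1) * (v powr (b - 1) * (norm (B s) + v) powr (- b - 1)) * (C / (1 + \<bar>s\<bar>))"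
      by (simp add: mult_ac)
  qed
  have g0int: "integrable (lborel \<Otimes>\<^sub>M lborel) (\<lambda>(s, v). indicator {0<..} v *\<^sub>R g0 v s)"
  proof (rule fint[where D = "2 powr (b + 1)"])
    define h where "h = (\<lambda>x::real \<times> real. indicator {0<..} (snd x) *\<^sub>R f (Complex (fst x) (0 * snd x)))"
    have [measurable]: "h \<in> borel_measurable (lborel \<Otimes>\<^sub>M lborel)"
      using mf[of 0] by (simp add: h_def case_prod_unfold)
    have "(\<lambda>(s, v). of_real (v powr (b - 1)) * (B s + of_real v) powr of_real (- b - 1) * h (s, v))
       \<in> borel_measurable (lborel \<Otimes>\<^sub>M lborel)"
      by measurable
    then show "(\<lambda>(s, v). indicator {0<..} v *\<^sub>R g0 v s) \<in> borel_measurable (lborel \<Otimes>\<^sub>M lborel)"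
      by (simp add: g0_def h_def case_prod_unfold)
    fix s v :: real assume v: "v > 0"
    show "norm (g0 v s) \<le> 2 powr (b + 1) * (v powr (b - 1) * (norm (B s) + v) powr (- b - 1)) * (C / (1 + \<bar>s\<bar>))"
      unfolding g0_def norm_mult[of _ "f _"]
      using v by (intro mult_mono Bergman_integral_bound ReB0 b lb) auto
  qed
  have shift: "(LBINT s. g v s) = (LBINT s. g0 v s)" if v: "v > 0" for v
  proof -
    \<comment> \<open>This is the holomorphic continuation in \<sigma> of the integrand. At
      \<open>\<sigma> = s + \<i> v\<close> the base of the power is \<open>B s + v / 2\<close>, and
      at \<open>\<sigma> = s\<close> it is \<open>B s + v\<close>. Thus the shift frees
      \<open>f\<close> of its dependence on \<open>v\<close>.\<close>
    define \<Phi> where "\<Phi> = (\<lambda>\<sigma>. of_real (v powr (b - 1)) * (- \<i> * (z - \<sigma>) / 2 + of_real v) powr of_real (- b - 1) * f \<sigma>)"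
    let ?U = "{\<sigma>. Im \<sigma> > - e} \<inter> {\<sigma>. Im \<sigma> < Im z + 2 * v}"
    have Re: "Re (- \<i> * (z - \<sigma>) / 2 + of_real v) > 0" if "Im \<sigma> < Im z + 2 * v" for \<sigma>
      using that by simp
    have np: "- \<i> * (z - \<sigma>) / 2 + of_real v \<notin> \<real>\<^sub>\<le>\<^sub>0" if "Im \<sigma> < Im z + 2 * v" for \<sigma>
      using Re[OF that] by (auto simp: complex_nonpos_Reals_iff)
    have hol\<Phi>: "\<Phi> holomorphic_on ?U"
      unfolding \<Phi>_def using np
      by (intro holomorphic_intros holomorphic_on_subset[OF hol]) auto
    have at0: "\<Phi> (Complex s 0) = g0 v s" for s
      by (simp add: \<Phi>_def g0_def B_def complex_of_real_def)
    have atv: "\<Phi> (Complex s v) = g v s" for s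
    proof -
      have "- \<i> * (z - Complex s v) / 2 + of_real v = B s + of_real (v / 2)"
        by (simp add: B_def complex_eq_iff field_simps)
      then show ?thesis by (simp only: \<Phi>_def g_def)
    qed
    have "(LBINT s. \<Phi> (Complex s 0)) = (LBINT s. \<Phi> (Complex s v))"
    proof (rule line_integral_shift[OF hol\<Phi>, where C = "v powr (b - 1) * ((v / 2) powr (- b) / (k / 2)) * C"])
      show "convex ?U" by (intro convex_Int convex_halfspace_Im_gt convex_halfspace_Im_lt)
      show "open ?U" by (intro open_Int open_halfspace_Im_gt open_halfspace_Im_lt)
      fix \<sigma> assume s: "0 \<le> Im \<sigma>" "Im \<sigma> \<le> v"
      show "\<sigma> \<in> ?U" using s e z v by auto
      let ?s = "Re \<sigma>"
      have eq: "- \<i> * (z - \<sigma>) / 2 + of_real v = B ?s + of_real (v - Im \<sigma> / 2)"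
        by (simp add: B_def complex_eq_iff field_simps)
      have lo: "(norm (B ?s) + (v - Im \<sigma> / 2)) / 2 \<le> norm (B ?s + of_real (v - Im \<sigma> / 2))"
        using s by (intro norm_add_of_real_ge ReB0) auto
      have l1: "k / 2 * (1 + \<bar>?s\<bar>) \<le> norm (B ?s + of_real (v - Im \<sigma> / 2))"
        using lo k(2)[of ?s] s by simp
      have l2: "v / 2 \<le> norm (B ?s + of_real (v - Im \<sigma> / 2))"
      proof -
        have "v / 2 \<le> Re (B ?s + of_real (v - Im \<sigma> / 2))" using ReB0[of ?s] s by simp
        also have "\<dots> \<le> norm (B ?s + of_real (v - Im \<sigma> / 2))" by (rule complex_Re_le_cmod)
        finally show ?thesis .
      qed
      let ?N = "norm (B ?s + of_real (v - Im \<sigma> / 2))"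
      have kp: "k / 2 * (1 + \<bar>?s\<bar>) > 0" using k by (intro mult_pos_pos) auto
      have Np: "?N > 0" using l2 v by linarith
      have "norm ((B ?s + of_real (v - Im \<sigma> / 2)) powr of_real (- b - 1)) = ?N powr (- b - 1)"
        by (subst norm_powr_real_powr') auto
      also have "\<dots> = ?N powr (- b) * (1 / ?N)"
        using Np by (simp add: powr_diff)
      \<comment> \<open>One power of the modulus supplies the decay in \<open>s\<close>; the
        remaining power \<open>- b\<close> is bounded by means of \<open>v / 2\<close>. With the
        decay of \<open>f\<close> the product becomes quadratically small.\<close>
      also have "\<dots> \<le> (v / 2) powr (- b) * (1 / (k / 2 * (1 + \<bar>?s\<bar>)))"
        using l1 l2 v b kp Np by (intro mult_mono powr_mono2' divide_left_mono) auto
      finally have n: "norm ((B ?s + of_real (v - Im \<sigma> / 2)) powr of_real (- b - 1)) \<le> ((v / 2) powr (- b) / (k / 2)) / (1 + \<bar>?s\<bar>)"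
        by simp
      have "norm (\<Phi> \<sigma>) = v powr (b - 1) * (norm ((B ?s + of_real (v - Im \<sigma> / 2)) powr of_real (- b - 1)) * norm (f \<sigma>))"
        unfolding \<Phi>_def eq by (simp add: norm_mult)
      also have "\<dots> \<le> v powr (b - 1) * (((v / 2) powr (- b) / (k / 2)) * C / (1 + ?s\<^sup>2))"
        using lb[of "Im \<sigma>" ?s] s by (intro mult_left_mono decay_product n) auto
      finally show "norm (\<Phi> \<sigma>) \<le> v powr (b - 1) * ((v / 2) powr (- b) / (k / 2)) * C / (1 + ?s\<^sup>2)"
        by simp
    qed (use v in auto)
    then show ?thesis by (simp add: at0 atv)
  qed
  have eqA: "(LBINT v:{0<..}. of_real (v powr (b - 1)) * A s v powr of_real (- b - 1) * f (Complex s v))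
      = (LBINT v. indicator {0<..} v *\<^sub>R g v s)" for s
    by (simp add: set_lebesgue_integral_def g_def A_def B_def)
  show "integrable lborel (\<lambda>s. LBINT v:{0<..}. of_real (v powr (b - 1)) * A s v powr of_real (- b - 1) * f (Complex s v))"
    unfolding eqA using lborel_pair.integrable_fst[OF gint] by simp
  have "(LBINT s. LBINT v:{0<..}. of_real (v powr (b - 1)) * A s v powr of_real (- b - 1) * f (Complex s v))
      = (LBINT s. LBINT v. indicator {0<..} v *\<^sub>R g v s)"
    by (simp add: set_lebesgue_integral_def g_def A_def B_def)
  also have "\<dots> = (LBINT v. LBINT s. indicator {0<..} v *\<^sub>R g v s)"
    using lborel_pair.Fubini_integral[of "\<lambda>s v. indicator {0<..} v *\<^sub>R g v s"] gint by simp
  also have "\<dots> = (LBINT v. LBINT s. indicator {0<..} v *\<^sub>R g0 v s)"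
  proof (rule Bochner_Integration.integral_cong[OF refl])
    show "(LBINT s. indicator {0<..} v *\<^sub>R g v s) = (LBINT s. indicator {0<..} v *\<^sub>R g0 v s)" for v
      using shift[of v] by (cases "v > 0") simp_all
  qed
  also have "\<dots> = (LBINT s. LBINT v. indicator {0<..} v *\<^sub>R g0 v s)"
    using lborel_pair.Fubini_integral[of "\<lambda>s v. indicator {0<..} v *\<^sub>R g0 v s"] g0int by simp
  also have "\<dots> = (LBINT s. (1 / (of_real b * B s)) * f (of_real s))"
  proof (rule Bochner_Integration.integral_cong[OF refl])
    fix s
    have "(LBINT v. indicator {0<..} v *\<^sub>R g0 v s)
        = (LBINT v. indicator {0<..} v *\<^sub>R (of_real (v powr (b - 1)) * (B s + of_real v) powr of_real (- b - 1)) * f (Complex s 0))"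
      by (simp add: g0_def)
    also have "\<dots> = (1 / (of_real b * B s)) * f (of_real s)"
      using Bergman_integral(2)[OF ReB0 b, of s]
      by (subst integral_mult_left_zero) (simp add: set_lebesgue_integral_def complex_of_real_def)
    finally show "(LBINT v. indicator {0<..} v *\<^sub>R g0 v s) = (1 / (of_real b * B s)) * f (of_real s)" .
  qed
  also have "\<dots> = (LBINT s. (- 2 * \<i> / of_real b) * (f (of_real s) / (of_real s - z)))"
  proof (intro Bochner_Integration.integral_cong refl)
    fix s :: real
    \<comment> \<open>Since \<open>B s = \<i> * (s - z) / 2\<close>, the factor
      \<open>1 / B s\<close> is a Cauchy kernel. The number \<open>4 * pi / b\<close> arises as
      \<open>- 2 * \<i> / b\<close> times \<open>2 * pi * \<i>\<close>.\<close>
    have "of_real s - z \<noteq> 0" using z by (auto simp: complex_eq_iff)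
    then have "1 / B s = - 2 * \<i> / (of_real s - z)"
      using B0[of s] by (simp add: B_def field_simps)
    then show "(1 / (of_real b * B s)) * f (of_real s) = (- 2 * \<i> / of_real b) * (f (of_real s) / (of_real s - z))"
      by (metis (no_types, lifting) divide_divide_eq_left mult.commute times_divide_eq_left times_divide_eq_right)
  qed
  also have "\<dots> = (- 2 * \<i> / of_real b) * (2 * pi * \<i> * f z)"
    unfolding integral_mult_right_zero using halfplane_Cauchy[OF hol e C z] by simp
  also have "\<dots> = of_real (4 * pi / b) * f z"
    by (simp add: complex_eq_iff field_simps)
  finally show "(LBINT s. LBINT v:{0<..}. of_real (v powr (b - 1)) * A s v powr of_real (- b - 1) * f (Complex s v))
    = of_real (4 * pi / b) * f z" .
qed

section \<open>Holomorphic functions of two variables\<close>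

lemma holomorphic2_on_imp_continuous_on:
  "holomorphic2_on F U \<Longrightarrow> continuous_on U F"
  unfolding holomorphic2_on_def
  by (meson continuous_at_imp_continuous_on has_derivative_continuous)

lemma holomorphic2_on_slices:
  assumes F: "holomorphic2_on F U" and ab: "(a, b) \<in> U"
  shows "(\<lambda>w. F (w, b)) field_differentiable (at a)" "(\<lambda>\<sigma>. F (a, \<sigma>)) field_differentiable (at b)"
proof -
  obtain D where D: "(F has_derivative D) (at (a, b))" "\<And>c u v. D (c * u, c * v) = c * D (u, v)"
    using assms unfolding holomorphic2_on_def by blast
  have "((\<lambda>w. F (w, b)) has_derivative (\<lambda>h. D (h, 0))) (at a)"
    using has_derivative_compose[OF has_derivative_Pair[OF has_derivative_ident has_derivative_const] D(1)] .
  moreover have "(\<lambda>h. D (h, 0)) = (*) (D (1, 0))"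
  proof
    show "D (h, 0) = D (1, 0) * h" for h
      using D(2)[of h 1 0] by (metis mult.commute mult.right_neutral mult_zero_right)
  qed
  ultimately show "(\<lambda>w. F (w, b)) field_differentiable (at a)"
    unfolding field_differentiable_def has_field_derivative_def
    by (intro exI[of _ "D (1, 0)"]) simp
  have "((\<lambda>\<sigma>. F (a, \<sigma>)) has_derivative (\<lambda>h. D (0, h))) (at b)"
    using has_derivative_compose[OF has_derivative_Pair[OF has_derivative_const has_derivative_ident] D(1)] .
  moreover have "(\<lambda>h. D (0, h)) = (*) (D (0, 1))"
  proof
    show "D (0, h) = D (0, 1) * h" for h
      using D(2)[of h 0 1] by (metis mult.commute mult.right_neutral mult_zero_right)
  qed
  ultimately show "(\<lambda>\<sigma>. F (a, \<sigma>)) field_differentiable (at b)"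
    unfolding field_differentiable_def has_field_derivative_def
    by (intro exI[of _ "D (0, 1)"]) simp
qed

lemma holomorphic2_on_slice1:
  assumes "holomorphic2_on F U" "\<And>w. w \<in> S \<Longrightarrow> (w, b) \<in> U"
  shows "(\<lambda>w. F (w, b)) holomorphic_on S"
  using holomorphic2_on_slices(1)[OF assms(1)] assms(2)
  by (auto simp: holomorphic_on_def intro: field_differentiable_at_within)

lemma holomorphic2_on_slice2:
  assumes "holomorphic2_on F U" "\<And>\<sigma>. \<sigma> \<in> S \<Longrightarrow> (a, \<sigma>) \<in> U"
  shows "(\<lambda>\<sigma>. F (a, \<sigma>)) holomorphic_on S"
  using holomorphic2_on_slices(2)[OF assms(1)] assms(2)
  by (auto simp: holomorphic_on_def intro: field_differentiable_at_within)

text \<open>Cauchy's inequality on a circle in the second variable bounds the change of the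
  derivative between \<open>x\<close> and \<open>a\<close> by the change of \<open>F\<close> itself,
  which uniform continuity makes small. In the remaining variable the derivative is
  holomorphic.\<close>

lemma isCont_deriv_snd:
  fixes F :: "complex \<times> complex \<Rightarrow> complex"
  assumes U: "open U" and cont: "continuous_on U F" and ab: "(a, b) \<in> U"
    and h2: "\<And>a b. (a, b) \<in> U \<Longrightarrow> (\<lambda>\<sigma>. F (a, \<sigma>)) field_differentiable (at b)"
  shows "continuous (at (a, b)) (\<lambda>(x, y). deriv (\<lambda>\<sigma>. F (x, \<sigma>)) y)"
proof -
  obtain A B where "open A" "open B" "(a, b) \<in> A \<times> B" "A \<times> B \<subseteq> U"
    using open_prod_elim[OF U ab] by blast
  then have AB: "open A" "open B" "a \<in> A" "b \<in> B" "A \<times> B \<subseteq> U"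
    by auto
  obtain r1 where r1: "r1 > 0" "cball a r1 \<subseteq> A" using open_contains_cball AB by blast
  obtain r2 where r2: "r2 > 0" "cball b r2 \<subseteq> B" using open_contains_cball AB by blast
  define r where "r = min r1 r2 / 2"
  have r: "r > 0" "cball a (2 * r) \<times> cball b (2 * r) \<subseteq> U"
    using r1 r2 AB(5) by (auto simp: r_def subset_iff)
  have sub: "(x, y) \<in> U" if "dist a x \<le> 2 * r" "dist b y \<le> 2 * r" for x y
    using that r by auto
  let ?d = "\<lambda>x y. deriv (\<lambda>\<sigma>. F (x, \<sigma>)) y"
  have hol: "(\<lambda>\<sigma>. F (x, \<sigma>)) holomorphic_on S" if "\<And>y. y \<in> S \<Longrightarrow> (x, y) \<in> U" for x S
    using h2[OF that] by (auto simp: holomorphic_on_def intro: field_differentiable_at_within)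
  have uc: "uniformly_continuous_on (cball a (2 * r) \<times> cball b (2 * r)) F"
    by (rule compact_uniformly_continuous) (auto intro: continuous_on_subset[OF cont r(2)] compact_Times)
  have ca: "continuous (at b) (?d a)"
  proof -
    have "deriv (\<lambda>\<sigma>. F (a, \<sigma>)) holomorphic_on ball b r"
      using r by (intro holomorphic_deriv hol sub) auto
    then have "continuous_on (ball b r) (?d a)"
      by (rule holomorphic_on_imp_continuous_on)
    then show ?thesis
      using r(1) by (simp add: continuous_on_eq_continuous_at)
  qed
  show ?thesis
    unfolding continuous_at_eps_delta
  proof (intro allI impI)
    fix e :: real assume e: "e > 0"
    obtain d1 where d1: "d1 > 0" "\<And>x x'. x \<in> cball a (2 * r) \<times> cball b (2 * r) \<Longrightarrow> x' \<in> cball a (2 * r) \<times> cball b (2 * r)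
        \<Longrightarrow> dist x' x < d1 \<Longrightarrow> dist (F x') (F x) < e * r / 2"
    proof -
      have "e * r / 2 > 0" using e r(1) by simp
      with uc show ?thesis
        unfolding uniformly_continuous_on_def using that by blast
    qed
    obtain d2 where d2: "d2 > 0" "\<And>y. dist y b < d2 \<Longrightarrow> dist (?d a y) (?d a b) < e / 2"
    proof -
      have "e / 2 > 0" using e by simp
      with ca show ?thesis
        unfolding continuous_at_eps_delta using that by blast
    qed
    show "\<exists>d>0. \<forall>x'. dist x' (a, b) < d \<longrightarrow> dist (case x' of (x, y) \<Rightarrow> ?d x y) (case (a, b) of (x, y) \<Rightarrow> ?d x y) < e"
    proof (intro exI conjI allI impI)
      show "min r (min d1 d2) > 0" using r d1 d2 by simp
      fix x' assume x': "dist x' (a, b) < min r (min d1 d2)"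
      obtain x y where xy: "x' = (x, y)" by (cases x')
      have dx: "dist x a < min r (min d1 d2)" "dist y b < min r (min d1 d2)"
        using dist_fst_le[of x' "(a, b)"] dist_snd_le[of x' "(a, b)"] x' xy by auto
      let ?g = "\<lambda>\<sigma>. F (x, \<sigma>) - F (a, \<sigma>)"
      have inb: "dist b \<sigma> \<le> 2 * r" if "\<sigma> \<in> cball y r" for \<sigma>
        using that dx dist_triangle[of b \<sigma> y] by (simp add: dist_commute)
      have ga: "?g holomorphic_on cball y r"
        using inb dx r(1) by (intro holomorphic_intros hol sub) (auto simp: dist_commute)
      have "norm ((deriv ^^ 1) ?g y) \<le> fact 1 * (e * r / 2) / r ^ 1"
      proof (rule Cauchy_inequality)
        show "?g holomorphic_on ball y r" using ga by (rule holomorphic_on_subset) auto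
        show "continuous_on (cball y r) ?g" using ga by (rule holomorphic_on_imp_continuous_on)
        fix \<sigma> assume "norm (y - \<sigma>) = r"
        then have s: "dist b \<sigma> \<le> 2 * r" using inb[of \<sigma>] by (simp add: dist_norm)
        have "dist (F (x, \<sigma>)) (F (a, \<sigma>)) < e * r / 2"
        proof (rule d1(2))
          show "dist (x, \<sigma>) (a, \<sigma>) < d1" using dx by (simp add: dist_prod_def)
        qed (use s dx r(1) in \<open>auto simp: dist_commute\<close>)
        then show "norm (?g \<sigma>) \<le> e * r / 2" by (simp add: dist_norm)
      qed (use r in auto)
      moreover have "deriv ?g y = ?d x y - ?d a y"
        using h2[of x y] h2[of a y] sub dx r(1) by (intro deriv_diff) (auto simp: dist_commute)
      ultimately have "dist (?d x y) (?d a y) \<le> e / 2"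
        using r(1) by (simp add: dist_norm)
      moreover have "dist (?d a y) (?d a b) < e / 2" using d2 dx by auto
      ultimately show "dist (case x' of (x, y) \<Rightarrow> ?d x y) (case (a, b) of (x, y) \<Rightarrow> ?d x y) < e"
        using dist_triangle[of "?d x y" "?d a b" "?d a y"] by (simp add: xy)
    qed
  qed
qed

text \<open>Osgood's lemma. One partial derivative at the point and continuity of the other one
  suffice for a total derivative, and the derivative is complex linear since both partial
  derivatives are complex numbers. It reduces holomorphy in two variables to slices plus
  continuity.\<close>

lemma holomorphic2_on_Osgood:
  assumes U: "open U" and cont: "continuous_on U F"
    and h1: "\<And>a b. (a, b) \<in> U \<Longrightarrow> (\<lambda>w. F (w, b)) field_differentiable (at a)"
    and h2: "\<And>a b. (a, b) \<in> U \<Longrightarrow> (\<lambda>\<sigma>. F (a, \<sigma>)) field_differentiable (at b)"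
  shows "holomorphic2_on F U"
  unfolding holomorphic2_on_def
proof
  fix Z assume Z: "Z \<in> U"
  obtain a b where Zab: "Z = (a, b)" by (cases Z)
  obtain A B where "open A" "open B" "Z \<in> A \<times> B" "A \<times> B \<subseteq> U"
    using open_prod_elim[OF U Z] by blast
  then have AB: "open A" "open B" "a \<in> A" "b \<in> B" "A \<times> B \<subseteq> U"
    by (auto simp: Zab)
  obtain r1 where r1: "r1 > 0" "cball a r1 \<subseteq> A" using open_contains_cball AB by blast
  obtain r2 where r2: "r2 > 0" "cball b r2 \<subseteq> B" using open_contains_cball AB by blast
  define r where "r = min r1 r2 / 2"
  have r: "r > 0" "cball a (2 * r) \<times> cball b (2 * r) \<subseteq> U"
    using r1 r2 AB(5) by (auto simp: r_def subset_iff)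
  have sub: "(x, y) \<in> U" if "dist a x \<le> 2 * r" "dist b y \<le> 2 * r" for x y
    using that r by auto
  let ?d = "\<lambda>x y. deriv (\<lambda>\<sigma>. F (x, \<sigma>)) y"
  have der: "((\<lambda>\<sigma>. F (x, \<sigma>)) has_field_derivative ?d x y) (at y)" if "(x, y) \<in> U" for x y
    using h2[OF that] by (simp add: field_differentiable_derivI)
  have contd: "continuous (at (a, b)) (\<lambda>(x, y). ?d x y)"
    using isCont_deriv_snd[OF U cont _ h2] Z Zab by blast
  have "((\<lambda>(x, y). F (x, y)) has_derivative
      (\<lambda>(tx, ty). deriv (\<lambda>w. F (w, b)) a * tx + blinfun_mult_right (?d a b) ty)) (at (a, b) within ball a r \<times> ball b r)"
  proof (rule has_derivative_partialsI)
    show "((\<lambda>x. F (x, b)) has_derivative (*) (deriv (\<lambda>w. F (w, b)) a)) (at a within ball a r)"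
      using h1[of a b] Z Zab
      by (simp add: DERIV_deriv_iff_field_differentiable[symmetric] has_field_derivative_def has_derivative_at_withinI)
    show "((\<lambda>y. F (x, y)) has_derivative blinfun_apply (blinfun_mult_right (?d x y))) (at y within ball b r)"
      if "x \<in> ball a r" "y \<in> ball b r" for x y
      using der[OF sub[of x y]] that r(1) by (auto simp: has_field_derivative_def has_derivative_at_withinI)
    have "continuous (at (a, b)) (\<lambda>z. blinfun_mult_right ((\<lambda>(x, y). ?d x y) z))"
      using contd by (rule bounded_linear.continuous[OF bounded_linear_blinfun_mult_right])
    then show "continuous (at (a, b) within ball a r \<times> ball b r) (\<lambda>(x, y). blinfun_mult_right (?d x y))"
      by (simp add: case_prod_unfold continuous_at_imp_continuous_at_within)
  qed (use r in auto)
  moreover have "at (a, b) within ball a r \<times> ball b r = at (a, b)"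
    using r(1) by (intro at_within_open open_Times) auto
  ultimately have "(F has_derivative (\<lambda>(tx, ty). deriv (\<lambda>w. F (w, b)) a * tx + ?d a b * ty)) (at (a, b))"
    by simp
  then show "\<exists>D. (F has_derivative D) (at Z) \<and> (\<forall>c u v. D (c * u, c * v) = c * D (u, v))"
    unfolding Zab by (intro exI conjI) (auto simp: algebra_simps)
qed

section \<open>Mean values over discs and polydiscs\<close>

lemma ball_in_borel [measurable]: "ball (x :: 'a::metric_space) r \<in> sets borel"
  by simp

text \<open>The function \<open>f^2\<close> is holomorphic as well, so its average over the disc is
  \<open>f(z)^2\<close> exactly, and the inequality is only that of the norm of an integral.
  Subharmonicity is not invoked.\<close>

lemma mean_value_disc:
  assumes hol: "f holomorphic_on ball z R" and r: "0 < r" "r < R"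
  shows "ennreal (pi * r\<^sup>2) * ennreal ((norm (f z))\<^sup>2)
    \<le> (\<integral>\<^sup>+w. indicator (ball 0 r) w * ennreal ((norm (f (z + w)))\<^sup>2) \<partial>lborel)"
proof -
  define g where "g = (\<lambda>w. (f (w + z))\<^sup>2)"
  have holg: "g holomorphic_on ball 0 R"
    unfolding g_def by (intro holomorphic_intros holomorphic_on_translate[OF hol]) (auto simp: dist_norm norm_minus_commute)
  have contg: "continuous_on (ball 0 r) g"
    using holomorphic_on_imp_continuous_on[OF holg] r by (auto intro: continuous_on_subset)
  define G where "G = (\<lambda>w. indicator (ball 0 r) w *\<^sub>R g w)"
  have Gm[measurable]: "G \<in> borel_measurable borel"
    unfolding G_def by (rule borel_measurable_continuous_on_indicator[OF _ contg]) auto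
  have "compact (g ` cball 0 r)"
    using holomorphic_on_imp_continuous_on[OF holg] r
    by (intro compact_continuous_image) (auto intro: continuous_on_subset)
  then obtain M where M: "\<And>w. norm w \<le> r \<Longrightarrow> norm (g w) \<le> M"
    using compact_imp_bounded bounded_iff by (metis (no_types, lifting) imageI mem_cball_0)
  have Gint: "integrable lborel G"
  proof (rule Bochner_Integration.integrable_bound)
    show "integrable lborel (\<lambda>w::complex. indicator (ball 0 r) w *\<^sub>R M)"
      by (intro integrable_scaleR_left) (auto intro!: integrable_real_indicator emeasure_lborel_ball_finite)
    show "AE w in lborel. norm (G w) \<le> norm (indicator (ball 0 r) w *\<^sub>R M)"
      using M by (intro AE_I2) (auto simp: G_def split: split_indicator intro: order_trans[OF _ abs_ge_self])
  qed simp
  have cm: "circle_mean G w = indicator (ball 0 r) w *\<^sub>R g 0" if "w \<noteq> 0" for w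
  proof (cases "norm w < r")
    case True
    have "circle_mean G w = circle_mean (\<lambda>w. cnj w ^ 0 * g w) w"
      using True by (simp add: circle_mean_def G_def norm_mult)
    also have "\<dots> = g 0"
      using circle_mean_Taylor[OF holg, of w 0] that True r by simp
    finally show ?thesis using True by simp
  next
    case False
    then show ?thesis by (simp add: circle_mean_def G_def norm_mult)
  qed
  have "(\<integral>w. G w \<partial>lborel) = (\<integral>w. circle_mean G w \<partial>lborel)"
    by (rule integral_circle_mean(1)[OF Gint])
  also have "\<dots> = (\<integral>w. indicator (ball 0 r) (w::complex) *\<^sub>R g 0 \<partial>lborel)"
  \<comment> \<open>The circle through the centre degenerates to a point, which is a null
    set.\<close>
  proof (rule integral_cong_AE)
    show "AE w in lborel. circle_mean G w = indicator (ball 0 r) w *\<^sub>R g 0"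
      using AE_lborel_singleton[of 0] by eventually_elim (rule cm)
    show "(\<lambda>w. indicator (ball 0 r) w *\<^sub>R g 0) \<in> borel_measurable lborel"
      by (intro borel_measurable_scaleR borel_measurable_indicator borel_measurable_const) auto
  qed (use integral_circle_mean(2)[OF Gint] in auto)
  also have "\<dots> = of_real (pi * r\<^sup>2) * g 0"
    using r content_ball[of r "0::complex"]
    by (simp add: integral_scaleR_left emeasure_lborel_ball_finite unit_ball_vol_2 scaleR_conv_of_real)
  finally have eq: "(\<integral>w. G w \<partial>lborel) = of_real (pi * r\<^sup>2) * (f z)\<^sup>2"
    by (simp add: g_def)
  have "ennreal (pi * r\<^sup>2) * ennreal ((norm (f z))\<^sup>2) = ennreal (norm (\<integral>w. G w \<partial>lborel))"
    unfolding eq by (simp add: ennreal_mult[symmetric] norm_mult norm_power)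
  also have "\<dots> \<le> (\<integral>\<^sup>+w. ennreal (norm (G w)) \<partial>lborel)"
    by (rule integral_norm_bound_ennreal[OF Gint])
  also have "\<dots> = (\<integral>\<^sup>+w. indicator (ball 0 r) w * ennreal ((norm (f (z + w)))\<^sup>2) \<partial>lborel)"
    by (intro nn_integral_cong) (auto simp: G_def g_def norm_power add.commute split: split_indicator)
  finally show ?thesis .
qed

lemma mean_value_polydisc:
  assumes F: "holomorphic2_on F U" and r: "0 < r" "r < R"
    and sub: "ball a R \<times> ball b R \<subseteq> U" and Fm: "F \<in> borel_measurable borel"
  shows "ennreal (pi * r\<^sup>2) * (ennreal (pi * r\<^sup>2) * ennreal ((norm (F (a, b)))\<^sup>2))
    \<le> (\<integral>\<^sup>+w. indicator (ball 0 r) w * (\<integral>\<^sup>+\<zeta>. indicator (ball 0 r) \<zeta> * ennreal ((norm (F (a + w, b + \<zeta>)))\<^sup>2) \<partial>lborel) \<partial>lborel)"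
proof -
  have R: "R > 0" using r by simp
  define q where "q = (\<lambda>w. F (a + w, b))"
  have [measurable]: "q \<in> borel_measurable borel"
    unfolding q_def by (intro measurable_compose[OF _ Fm] borel_measurable_continuous_onI continuous_intros)
  have 1: "(\<lambda>w. F (w, b)) holomorphic_on ball a R"
    using sub R by (intro holomorphic2_on_slice1[OF F]) auto
  have "ennreal (pi * r\<^sup>2) * (ennreal (pi * r\<^sup>2) * ennreal ((norm (F (a, b)))\<^sup>2))
      \<le> ennreal (pi * r\<^sup>2) * (\<integral>\<^sup>+w. indicator (ball 0 r) w * ennreal ((norm (F (a + w, b)))\<^sup>2) \<partial>lborel)"
    by (intro mult_left_mono mean_value_disc[OF 1 r]) auto
  also have "\<dots> = (\<integral>\<^sup>+w. indicator (ball 0 r) w * (ennreal (pi * r\<^sup>2) * ennreal ((norm (F (a + w, b)))\<^sup>2)) \<partial>lborel)"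
    unfolding q_def[THEN fun_cong, symmetric] by (subst nn_integral_cmult[symmetric]) (auto simp: mult_ac)
  also have "\<dots> \<le> (\<integral>\<^sup>+w. indicator (ball 0 r) w * (\<integral>\<^sup>+\<zeta>. indicator (ball 0 r) \<zeta> * ennreal ((norm (F (a + w, b + \<zeta>)))\<^sup>2) \<partial>lborel) \<partial>lborel)"
  proof (rule nn_integral_mono)
    fix w
    show "indicator (ball 0 r) w * (ennreal (pi * r\<^sup>2) * ennreal ((norm (F (a + w, b)))\<^sup>2))
        \<le> indicator (ball 0 r) w * (\<integral>\<^sup>+\<zeta>. indicator (ball 0 r) \<zeta> * ennreal ((norm (F (a + w, b + \<zeta>)))\<^sup>2) \<partial>lborel)"
    proof (cases "w \<in> ball 0 r")
      case True
      then have "(\<lambda>\<sigma>. F (a + w, \<sigma>)) holomorphic_on ball b R"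
        using sub r by (intro holomorphic2_on_slice2[OF F]) (auto simp: dist_norm)
      from mean_value_disc[OF this r] True show ?thesis by simp
    qed simp
  qed
  finally show ?thesis .
qed

section \<open>Functions with bounded square integrals on the translates of the boundary\<close>

abbreviation sq_int :: "('a::euclidean_space \<Rightarrow> complex) \<Rightarrow> ennreal" where
  "sq_int f \<equiv> (\<integral>\<^sup>+x. ennreal ((norm (f x))\<^sup>2) \<partial>lborel)"

lemma open_Omega:
  assumes "continuous_on UNIV p"
  shows "open (Omega p)"
proof -
  have "Omega p = {Z. p (fst Z) < Im (snd Z)}"
    by (auto simp: Omega_def)
  also have "open \<dots>"
    by (intro open_Collect_less continuous_intros continuous_on_compose2[OF assms]) auto
  finally show ?thesis .
qed

lemma continuous_on_lift_pt:
  assumes "continuous_on UNIV p"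
  shows "continuous_on UNIV (\<lambda>(y, x). lift_pt p y x)"
  unfolding lift_pt_def case_prod_unfold Complex_eq
  by (intro continuous_intros continuous_on_compose2[OF assms]) auto

lemma measurable_lift_pt:
  assumes "continuous_on UNIV p"
  shows "lift_pt p y \<in> borel_measurable borel"
proof -
  have "continuous_on UNIV (lift_pt p y)"
    unfolding lift_pt_def Complex_eq
    by (intro continuous_intros continuous_on_compose2[OF assms]) auto
  then show ?thesis by (rule borel_measurable_continuous_onI)
qed

lemma lift_pt_in_Omega: "y > 0 \<Longrightarrow> lift_pt p y x \<in> Omega p"
  by (simp add: lift_pt_def Omega_def)

text \<open>The values of \<open>F\<close> outside the domain are arbitrary and need not be measurable.\<close>

definition restr :: "(complex \<Rightarrow> real) \<Rightarrow> (complex \<times> complex \<Rightarrow> complex) \<Rightarrow> complex \<times> complex \<Rightarrow> complex" where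
  "restr p F Z = indicator (Omega p) Z *\<^sub>R F Z"

lemma restr_eq: "Z \<in> Omega p \<Longrightarrow> restr p F Z = F Z"
  by (simp add: restr_def)

lemma holomorphic2_on_cong:
  assumes "open U" "holomorphic2_on F U" "\<And>Z. Z \<in> U \<Longrightarrow> F Z = G Z"
  shows "holomorphic2_on G U"
  unfolding holomorphic2_on_def
proof
  fix Z assume Z: "Z \<in> U"
  with assms(2) obtain D where D: "(F has_derivative D) (at Z)" and lin: "\<forall>c a b. D (c * a, c * b) = c * D (a, b)"
    unfolding holomorphic2_on_def by blast
  have "(G has_derivative D) (at Z)"
    by (rule has_derivative_transform_within_open[OF D assms(1) Z assms(3)])
  with lin show "\<exists>D. (G has_derivative D) (at Z) \<and> (\<forall>c a b. D (c * a, c * b) = c * D (a, b))"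
    by blast
qed

lemma restr_holomorphic2:
  assumes p: "continuous_on UNIV p" and F: "holomorphic2_on F (Omega p)"
  shows "holomorphic2_on (restr p F) (Omega p)" "restr p F \<in> borel_measurable borel"
proof -
  show "holomorphic2_on (restr p F) (Omega p)"
    by (rule holomorphic2_on_cong[OF open_Omega[OF p] F]) (simp add: restr_eq)
  show "restr p F \<in> borel_measurable borel"
    unfolding restr_def
    by (intro borel_measurable_continuous_on_indicator holomorphic2_on_imp_continuous_on[OF F])
       (use open_Omega[OF p] in auto)
qed

lemma measurable_slice:
  assumes p: "continuous_on UNIV p" and F: "holomorphic2_on F (Omega p)" and y: "y > 0"
  shows "(\<lambda>x. F (lift_pt p y x)) \<in> borel_measurable borel"
proof -
  have "(\<lambda>x. restr p F (lift_pt p y x)) \<in> borel_measurable borel"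
    using measurable_compose[OF measurable_lift_pt[OF p] restr_holomorphic2(2)[OF p F]] .
  then show ?thesis using lift_pt_in_Omega[OF y] by (simp add: restr_eq)
qed

text \<open>The squared value is at most an average over a polydisc. With the height above the
  boundary as a variable in place of the imaginary part, this average is controlled by slice
  integrals over a height interval of length \<open>e\<close>. The resulting bound is independent of
  \<sigma>, including its real part and its height.\<close>

lemma bounded_of_sq_int:
  assumes p: "continuous_on UNIV p" and F: "holomorphic2_on F (Omega p)"
    and K: "\<And>y. y > 0 \<Longrightarrow> sq_int (\<lambda>x. F (lift_pt p y x)) \<le> ennreal K" and e: "e > 0"
  obtains C where "C \<ge> 0" "\<And>z \<sigma>. norm z \<le> R \<Longrightarrow> Im \<sigma> \<ge> p z + e \<Longrightarrow> norm (F (z, \<sigma>)) \<le> C"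
proof -
  define G where "G = restr p F"
  have G: "holomorphic2_on G (Omega p)" and Gm: "G \<in> borel_measurable borel"
    using restr_holomorphic2[OF p F] by (simp_all add: G_def)
  have Gm'[measurable]: "G \<in> borel_measurable (borel \<Otimes>\<^sub>M borel)"
    using Gm by (simp add: borel_prod)
  have pm[measurable]: "p \<in> borel_measurable borel"
    using p by (rule borel_measurable_continuous_onI)
  have "uniformly_continuous_on (cball 0 (R + 1)) p"
    by (rule compact_uniformly_continuous) (auto intro: continuous_on_subset[OF p])
  then obtain d where d: "d > 0" "\<And>x x'. x \<in> cball 0 (R + 1) \<Longrightarrow> x' \<in> cball 0 (R + 1) \<Longrightarrow> dist x' x < d \<Longrightarrow> dist (p x') (p x) < e / 4"
    using e unfolding uniformly_continuous_on_def by (metis zero_less_divide_iff zero_less_numeral)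
  \<comment> \<open>In a polydisc of this size both \<open>p\<close> and the imaginary part vary by
    less than \<open>e / 4\<close>, so the polydisc stays inside the domain and all heights differ
    by less than \<open>e / 2\<close> from that of the centre.\<close>
  define r where "r = min (min d 1) (e / 4) / 2"
  have r: "r > 0" "2 * r \<le> d" "2 * r \<le> 1" "2 * r \<le> e / 4" using d e by (auto simp: r_def)
  define M where "M = (pi * r\<^sup>2) * (pi * r\<^sup>2)"
  have M: "M > 0" using r by (simp add: M_def)
  have main: "ennreal M * ennreal ((norm (F (z, \<sigma>)))\<^sup>2) \<le> ennreal (e * K)"
    if z: "norm z \<le> R" and \<sigma>: "Im \<sigma> \<ge> p z + e" for z \<sigma>
  proof -
    define y0 where "y0 = Im \<sigma> - p z"
    have y0: "y0 \<ge> e" using \<sigma> by (simp add: y0_def)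
    have pd: "\<bar>p (z + w) - p z\<bar> < e / 4" if "norm w < 2 * r" for w
    proof -
      have "dist (p (z + w)) (p z) < e / 4"
      proof (rule d(2))
        show "z \<in> cball 0 (R + 1)" using z by simp
        have "norm (z + w) \<le> R + 1" using that z r norm_triangle_ineq[of z w] by linarith
        then show "z + w \<in> cball 0 (R + 1)" by simp
        show "dist (z + w) z < d" using that r by (simp add: dist_norm)
      qed
      then show ?thesis by (simp add: dist_real_def)
    qed
    have sub: "ball z (2 * r) \<times> ball \<sigma> (2 * r) \<subseteq> Omega p"
    proof
      fix x assume "x \<in> ball z (2 * r) \<times> ball \<sigma> (2 * r)"
      then obtain w \<zeta> where x: "x = (w, \<zeta>)" "dist z w < 2 * r" "dist \<sigma> \<zeta> < 2 * r" by auto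
      have "\<bar>p w - p z\<bar> < e / 4" using pd[of "w - z"] x by (simp add: dist_norm norm_minus_commute)
      moreover have "\<bar>Im \<sigma> - Im \<zeta>\<bar> < e / 4"
        using abs_Im_le_cmod[of "\<sigma> - \<zeta>"] x(3) r by (simp add: dist_norm)
      ultimately have "p w < Im \<zeta>" using \<sigma> e by linarith
      then show "x \<in> Omega p" using x(1) by (simp add: Omega_def)
    qed
    let ?J = "{y0 - e / 2<..<y0 + e / 2}"
    have inner: "(\<integral>\<^sup>+\<zeta>. indicator (ball 0 r) \<zeta> * ennreal ((norm (G (z + w, \<sigma> + \<zeta>)))\<^sup>2) \<partial>lborel)
        \<le> (\<integral>\<^sup>+y. indicator ?J y * (\<integral>\<^sup>+s. ennreal ((norm (G (lift_pt p y (z + w, Re \<sigma> + s))))\<^sup>2) \<partial>lborel) \<partial>lborel)"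
      if w: "norm w < r" for w
    proof -
      have m: "(\<lambda>\<zeta>. indicator (ball 0 r) \<zeta> * ennreal ((norm (G (z + w, \<sigma> + \<zeta>)))\<^sup>2)) \<in> borel_measurable borel"
        by measurable
      have "(\<integral>\<^sup>+\<zeta>. indicator (ball 0 r) \<zeta> * ennreal ((norm (G (z + w, \<sigma> + \<zeta>)))\<^sup>2) \<partial>lborel)
        = (\<integral>\<^sup>+y. \<integral>\<^sup>+s. indicator (ball 0 r) (Complex s y) * ennreal ((norm (G (z + w, \<sigma> + Complex s y)))\<^sup>2) \<partial>lborel \<partial>lborel)"
        by (rule nn_integral_complex(1)[OF m])
      also have "\<dots> \<le> (\<integral>\<^sup>+y. \<integral>\<^sup>+s. indicator {-r<..<r} y * ennreal ((norm (G (z + w, \<sigma> + Complex s y)))\<^sup>2) \<partial>lborel \<partial>lborel)"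
      proof (intro nn_integral_mono mult_right_mono)
        fix s y :: real
        show "indicator (ball 0 r) (Complex s y) \<le> (indicator {-r<..<r} y :: ennreal)"
          using abs_Im_le_cmod[of "Complex s y"] by (auto split: split_indicator)
      qed simp
      also have "\<dots> = (\<integral>\<^sup>+y. indicator {-r<..<r} y * (\<integral>\<^sup>+s. ennreal ((norm (G (z + w, \<sigma> + Complex s y)))\<^sup>2) \<partial>lborel) \<partial>lborel)"
        unfolding Complex_eq by (intro nn_integral_cong nn_integral_cmult) measurable
      \<comment> \<open>A translation depending on \<open>w\<close> makes the new \<open>y\<close>
        the height above the boundary: the imaginary part becomes
        \<open>p (z + w) + y\<close>.\<close>
      also have "\<dots> = (\<integral>\<^sup>+y. indicator {-r<..<r} (p (z + w) - Im \<sigma> + y) * (\<integral>\<^sup>+s. ennreal ((norm (G (z + w, \<sigma> + Complex s (p (z + w) - Im \<sigma> + y))))\<^sup>2) \<partial>lborel) \<partial>lborel)"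
      proof -
        have "(\<lambda>y. indicator {-r<..<r} y * (\<integral>\<^sup>+s. ennreal ((norm (G (z + w, \<sigma> + Complex s y)))\<^sup>2) \<partial>lborel)) \<in> borel_measurable borel"
          unfolding Complex_eq by measurable
        from nn_integral_real_affine[OF this, of 1 "p (z + w) - Im \<sigma>"] show ?thesis by simp
      qed
      also have "\<dots> \<le> (\<integral>\<^sup>+y. indicator ?J y * (\<integral>\<^sup>+s. ennreal ((norm (G (lift_pt p y (z + w, Re \<sigma> + s))))\<^sup>2) \<partial>lborel) \<partial>lborel)"
      proof (rule nn_integral_mono, rule mult_mono)
        fix y
        show "indicator {-r<..<r} (p (z + w) - Im \<sigma> + y) \<le> (indicator ?J y :: ennreal)"
        proof (cases "p (z + w) - Im \<sigma> + y \<in> {-r<..<r}")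
          case True
          then have "- r < p (z + w) - Im \<sigma> + y" "p (z + w) - Im \<sigma> + y < r" by auto
          moreover have "\<bar>p (z + w) - p z\<bar> < e / 4" using w r by (intro pd) auto
          ultimately have "y \<in> ?J"
            unfolding y0_def greaterThanLessThan_iff using r by linarith
          then show ?thesis by (simp split: split_indicator)
        qed simp
        have "\<sigma> + Complex s (p (z + w) - Im \<sigma> + y) = Complex (Re \<sigma> + s) (p (z + w) + y)" for s
          by (simp add: complex_eq_iff)
        then show "(\<integral>\<^sup>+s. ennreal ((norm (G (z + w, \<sigma> + Complex s (p (z + w) - Im \<sigma> + y))))\<^sup>2) \<partial>lborel)
            \<le> (\<integral>\<^sup>+s. ennreal ((norm (G (lift_pt p y (z + w, Re \<sigma> + s))))\<^sup>2) \<partial>lborel)"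
          by (simp add: lift_pt_def)
      qed auto
      finally show ?thesis .
    qed
    define H where "H = (\<lambda>y x. ennreal ((norm (G (lift_pt p y x)))\<^sup>2))"
    have Hm: "(\<lambda>(y, x). H y x) \<in> borel_measurable borel"
    proof -
      have "(\<lambda>(y, x). lift_pt p y x) \<in> borel_measurable borel"
        using continuous_on_lift_pt[OF p] by (rule borel_measurable_continuous_onI)
      from measurable_compose[OF this Gm]
      have [measurable]: "(\<lambda>v. G (lift_pt p (fst v) (snd v))) \<in> borel_measurable borel"
        by (simp add: case_prod_unfold)
      show ?thesis unfolding H_def case_prod_unfold by measurable
    qed
    have Hm3: "(\<lambda>(y, w, s). H y (w, s)) \<in> borel_measurable (borel \<Otimes>\<^sub>M (borel \<Otimes>\<^sub>M borel))"
      using Hm by (simp add: borel_prod case_prod_unfold)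
    have Hmy: "H y \<in> borel_measurable borel" for y
      unfolding H_def using measurable_compose[OF measurable_lift_pt[OF p] Gm] by measurable
    have Hms[measurable]: "(\<lambda>v. H (fst v) (z + fst (snd v), Re \<sigma> + snd (snd v))) \<in> borel_measurable (borel \<Otimes>\<^sub>M (borel \<Otimes>\<^sub>M borel))"
    proof -
      have "(\<lambda>v. (fst v, z + fst (snd v), Re \<sigma> + snd (snd v))) \<in> (borel \<Otimes>\<^sub>M (borel \<Otimes>\<^sub>M borel)) \<rightarrow>\<^sub>M (borel \<Otimes>\<^sub>M (borel \<Otimes>\<^sub>M borel))"
        by measurable
      from measurable_compose[OF this Hm3] show ?thesis by simp
    qed
    have shift: "(\<integral>\<^sup>+w. \<integral>\<^sup>+s. H y (z + w, Re \<sigma> + s) \<partial>lborel \<partial>lborel) = (\<integral>\<^sup>+x. H y x \<partial>lborel)" for y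
    proof -
      have [measurable]: "H y \<in> borel_measurable (lborel \<Otimes>\<^sub>M lborel)"
        using Hmy[of y] by (simp add: lborel_prod)
      have "(\<integral>\<^sup>+w. \<integral>\<^sup>+s. H y (z + w, Re \<sigma> + s) \<partial>lborel \<partial>lborel) = (\<integral>\<^sup>+x. H y ((z, Re \<sigma>) + x) \<partial>(lborel \<Otimes>\<^sub>M lborel))"
      proof (subst lborel.nn_integral_fst[symmetric])
        show "(\<lambda>x. H y ((z, Re \<sigma>) + x)) \<in> borel_measurable (lborel \<Otimes>\<^sub>M lborel)"
          unfolding lborel_prod measurable_lborel2
          by (intro measurable_compose[OF _ Hmy] borel_measurable_continuous_onI continuous_intros)
      qed simp
      also have "\<dots> = (\<integral>\<^sup>+x. H y x \<partial>distr lborel borel ((+) (z, Re \<sigma>)))"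
        unfolding lborel_prod using Hmy by (subst nn_integral_distr) auto
      also have "\<dots> = (\<integral>\<^sup>+x. H y x \<partial>lborel)"
        by (simp add: lborel_distr_plus)
      finally show ?thesis .
    qed
    have "ennreal M * ennreal ((norm (F (z, \<sigma>)))\<^sup>2) = ennreal (pi * r\<^sup>2) * (ennreal (pi * r\<^sup>2) * ennreal ((norm (G (z, \<sigma>)))\<^sup>2))"
    proof -
      have "(z, \<sigma>) \<in> Omega p" using \<sigma> e by (simp add: Omega_def)
      then show ?thesis unfolding M_def G_def by (simp add: restr_eq ennreal_mult mult.assoc)
    qed
    also have "\<dots> \<le> (\<integral>\<^sup>+w. indicator (ball 0 r) w * (\<integral>\<^sup>+\<zeta>. indicator (ball 0 r) \<zeta> * ennreal ((norm (G (z + w, \<sigma> + \<zeta>)))\<^sup>2) \<partial>lborel) \<partial>lborel)"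
      using r(1) by (intro mean_value_polydisc[OF G _ _ sub Gm]) auto
    \<comment> \<open>Without the indicator in \<open>w\<close> the integral extends over the whole
      of a translated boundary, where the base point \<open>(z, Re \<sigma>)\<close> disappears by
      translation invariance.\<close>
    also have "\<dots> \<le> (\<integral>\<^sup>+w. (\<integral>\<^sup>+y. indicator ?J y * (\<integral>\<^sup>+s. H y (z + w, Re \<sigma> + s) \<partial>lborel) \<partial>lborel) \<partial>lborel)"
      using inner by (intro nn_integral_mono) (auto simp: H_def split: split_indicator)
    also have "\<dots> = (\<integral>\<^sup>+y. (\<integral>\<^sup>+w. indicator ?J y * (\<integral>\<^sup>+s. H y (z + w, Re \<sigma> + s) \<partial>lborel) \<partial>lborel) \<partial>lborel)"
    proof (rule lborel_pair.Fubini')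
      have "(\<lambda>v. (fst (fst v), snd (fst v), snd v)) \<in> ((lborel \<Otimes>\<^sub>M lborel) \<Otimes>\<^sub>M lborel) \<rightarrow>\<^sub>M (borel \<Otimes>\<^sub>M (borel \<Otimes>\<^sub>M borel))"
        by measurable
      from measurable_compose[OF this Hms]
      have [measurable]: "(\<lambda>(v, s). H (fst v) (z + snd v, Re \<sigma> + s)) \<in> borel_measurable ((lborel \<Otimes>\<^sub>M lborel) \<Otimes>\<^sub>M lborel)"
        by (simp add: case_prod_unfold)
      have "(\<lambda>v. indicator ?J (fst v) * (\<integral>\<^sup>+s. H (fst v) (z + snd v, Re \<sigma> + s) \<partial>lborel)) \<in> borel_measurable (lborel \<Otimes>\<^sub>M lborel)"
        by measurable
      then show "(\<lambda>(y, w). indicator ?J y * (\<integral>\<^sup>+s. H y (z + w, Re \<sigma> + s) \<partial>lborel)) \<in> borel_measurable (lborel \<Otimes>\<^sub>M lborel)"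
        by (simp add: case_prod_unfold)
    qed
    also have "\<dots> = (\<integral>\<^sup>+y. indicator ?J y * (\<integral>\<^sup>+x. H y x \<partial>lborel) \<partial>lborel)"
    proof (intro nn_integral_cong)
      fix y
      have [measurable]: "(\<lambda>v. H y (z + fst v, Re \<sigma> + snd v)) \<in> borel_measurable (borel \<Otimes>\<^sub>M borel)"
        using measurable_compose[OF _ Hms, of "\<lambda>v. (y, v)" "borel \<Otimes>\<^sub>M borel"] by simp
      have "(\<lambda>w. \<integral>\<^sup>+s. H y (z + w, Re \<sigma> + s) \<partial>lborel) \<in> borel_measurable lborel"
        by measurable
      then show "(\<integral>\<^sup>+w. indicator ?J y * (\<integral>\<^sup>+s. H y (z + w, Re \<sigma> + s) \<partial>lborel) \<partial>lborel) = indicator ?J y * (\<integral>\<^sup>+x. H y x \<partial>lborel)"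
        by (simp add: nn_integral_cmult shift)
    qed
    also have "\<dots> \<le> (\<integral>\<^sup>+y. indicator ?J y * ennreal K \<partial>lborel)"
    proof (intro nn_integral_mono)
      fix y
      show "indicator ?J y * (\<integral>\<^sup>+x. H y x \<partial>lborel) \<le> indicator ?J y * ennreal K"
        using K[of y] y0 e lift_pt_in_Omega[of y p] by (auto simp: H_def G_def restr_eq split: split_indicator)
    qed
    also have "\<dots> = ennreal (e * K)"
      using e by (simp add: nn_integral_multc ennreal_mult')
    finally show ?thesis .
  qed
  show ?thesis
  proof
    show "0 \<le> sqrt (\<bar>e * K\<bar> / M)" using M by simp
    fix z \<sigma> assume "norm z \<le> R" "Im \<sigma> \<ge> p z + e"
    from main[OF this] have "M * (norm (F (z, \<sigma>)))\<^sup>2 \<le> \<bar>e * K\<bar>"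
      using M by (auto simp: ennreal_mult''[symmetric] ennreal_le_iff2)
    then have "(norm (F (z, \<sigma>)))\<^sup>2 \<le> \<bar>e * K\<bar> / M" using M by (simp add: field_simps)
    then show "norm (F (z, \<sigma>)) \<le> sqrt (\<bar>e * K\<bar> / M)" by (rule real_le_rsqrt)
  qed
qed

section \<open>Mollifiers and the monotonicity of slice norms\<close>

lemma measurable_snd_lift_pt:
  assumes "continuous_on UNIV p"
  shows "(\<lambda>x. snd (lift_pt p y x)) \<in> borel_measurable borel"
  unfolding lift_pt_def snd_conv Complex_eq
  by (intro borel_measurable_continuous_onI continuous_intros continuous_on_compose2[OF assms]) auto

text \<open>The zero \<open>- \<i> / d\<close> lies in the lower half-plane. The squared modulus is
  \<open>1 + 2 * d * Im \<sigma>\<close> plus the square of \<open>d * norm \<sigma>\<close>, and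
  each bound drops nonnegative terms. Division by this factor thus gives one order of decay, does
  not increase the modulus, and tends to the identity as \<open>d\<close> tends to 0.\<close>

lemma norm_mollifier_ge:
  assumes d: "d > 0" and im: "Im \<sigma> \<ge> 0"
  shows "1 \<le> norm (1 - \<i> * of_real d * \<sigma>)" "d * norm \<sigma> \<le> norm (1 - \<i> * of_real d * \<sigma>)"
    "min 1 d / 2 * (1 + norm \<sigma>) \<le> norm (1 - \<i> * of_real d * \<sigma>)"
proof -
  have sq: "(norm (1 - \<i> * of_real d * \<sigma>))\<^sup>2 = 1 + 2 * d * Im \<sigma> + (d * norm \<sigma>)\<^sup>2"
    unfolding cmod_power2 power_mult_distrib by (simp add: power2_eq_square algebra_simps)
  have n: "2 * d * Im \<sigma> \<ge> 0" using d im by simp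
  show 1: "1 \<le> norm (1 - \<i> * of_real d * \<sigma>)"
  proof (rule power2_le_imp_le)
    show "1\<^sup>2 \<le> (norm (1 - \<i> * of_real d * \<sigma>))\<^sup>2" unfolding sq using n by simp
  qed simp
  show 2: "d * norm \<sigma> \<le> norm (1 - \<i> * of_real d * \<sigma>)"
  proof (rule power2_le_imp_le)
    show "(d * norm \<sigma>)\<^sup>2 \<le> (norm (1 - \<i> * of_real d * \<sigma>))\<^sup>2" unfolding sq using n by simp
  qed simp
  have "min 1 d * norm \<sigma> \<le> d * norm \<sigma>" by (intro mult_right_mono) auto
  moreover have "min 1 d \<le> 1" by simp
  ultimately show "min 1 d / 2 * (1 + norm \<sigma>) \<le> norm (1 - \<i> * of_real d * \<sigma>)"
    using 1 2 by (simp add: distrib_left del: min_less_iff_conj)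
qed

lemma mollifier_bound:
  assumes p: "continuous_on UNIV p" "\<And>z. p z \<ge> 0" and F: "holomorphic2_on F (Omega p)"
    and K: "\<And>y. y > 0 \<Longrightarrow> sq_int (\<lambda>x. F (lift_pt p y x)) \<le> ennreal K" and e: "e > 0" and d: "d > 0"
  obtains C where "C \<ge> 0" "\<And>z \<sigma>. norm z \<le> R \<Longrightarrow> Im \<sigma> \<ge> p z + e \<Longrightarrow>
    norm (F (z, \<sigma>) / (1 - \<i> * of_real d * \<sigma>)) \<le> C / (1 + norm \<sigma>)"
proof -
  obtain C where C: "C \<ge> 0" "\<And>z \<sigma>. norm z \<le> R \<Longrightarrow> Im \<sigma> \<ge> p z + e \<Longrightarrow> norm (F (z, \<sigma>)) \<le> C"
    using bounded_of_sq_int[OF p(1) F K e] by blast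
  show ?thesis
  proof
    show "0 \<le> C / (min 1 d / 2)" using C d by simp
    fix z \<sigma> assume z: "norm z \<le> R" "Im \<sigma> \<ge> p z + e"
    have "Im \<sigma> \<ge> 0" using z e p(2)[of z] by linarith
    note m = norm_mollifier_ge(3)[OF d this]
    have "min 1 d / 2 * (1 + norm \<sigma>) > 0" using d by (intro mult_pos_pos) (auto intro: add_pos_nonneg)
    then have "norm (F (z, \<sigma>)) / norm (1 - \<i> * of_real d * \<sigma>) \<le> C / (min 1 d / 2 * (1 + norm \<sigma>))"
      using C m z by (intro frac_le) auto
    then show "norm (F (z, \<sigma>) / (1 - \<i> * of_real d * \<sigma>)) \<le> C / (min 1 d / 2) / (1 + norm \<sigma>)"
      by (simp add: norm_divide)
  qed
qed

lemma mollifier_holomorphic: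
  assumes F: "(\<lambda>\<sigma>. F (z, \<sigma>)) holomorphic_on {\<sigma>. Im \<sigma> > p z}" and p: "p z \<ge> 0" and d: "d > 0"
  shows "(\<lambda>\<sigma>. F (z, \<sigma>) / (1 - \<i> * of_real d * \<sigma>)) holomorphic_on {\<sigma>. Im \<sigma> > p z}"
proof -
  have "1 - \<i> * of_real d * \<sigma> \<noteq> 0" if "Im \<sigma> > p z" for \<sigma>
    using norm_mollifier_ge(1)[OF d, of \<sigma>] that p by auto
  then show ?thesis by (intro holomorphic_intros F) auto
qed

lemma sq_int_prod:
  fixes F :: "complex \<times> real \<Rightarrow> complex"
  assumes "F \<in> borel_measurable borel"
  shows "sq_int F = (\<integral>\<^sup>+z. sq_int (\<lambda>t. F (z, t)) \<partial>lborel)"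
proof -
  have [measurable]: "F \<in> borel_measurable (lborel \<Otimes>\<^sub>M lborel)"
    using assms by (simp add: lborel_prod)
  have "(\<integral>\<^sup>+z. sq_int (\<lambda>t. F (z, t)) \<partial>lborel) = (\<integral>\<^sup>+x. ennreal ((norm (F x))\<^sup>2) \<partial>(lborel \<Otimes>\<^sub>M lborel))"
    by (rule lborel.nn_integral_fst) measurable
  then show ?thesis by (simp add: lborel_prod)
qed

text \<open>Over each fixed \<open>z\<close> this is \<open>halfplane_L2_decreasing\<close> with the
  origin moved to height \<open>p z + e\<close>. The margin \<open>e\<close> supplies holomorphy
  below the new real line, the mollifier supplies the decay.\<close>

lemma sq_int_mollified_mono:
  assumes p: "continuous_on UNIV p" "\<And>z. p z \<ge> 0" and F: "holomorphic2_on F (Omega p)"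
    and K: "\<And>y. y > 0 \<Longrightarrow> sq_int (\<lambda>x. F (lift_pt p y x)) \<le> ennreal K" and e: "e > 0" and d: "d > 0" and y: "y \<ge> 0"
  defines "G \<equiv> \<lambda>Z. F Z / (1 - \<i> * of_real d * snd Z)"
  shows "sq_int (\<lambda>x. G (lift_pt p (e + y) x)) \<le> sq_int (\<lambda>x. G (lift_pt p e x))"
proof -
  have Gm: "(\<lambda>x. G (lift_pt p y x)) \<in> borel_measurable borel" if y: "y > 0" for y
  proof -
    have [measurable]: "(\<lambda>x. F (lift_pt p y x)) \<in> borel_measurable borel"
      by (rule measurable_slice[OF p(1) F y])
    have [measurable]: "(\<lambda>x. snd (lift_pt p y x)) \<in> borel_measurable borel"
      by (rule measurable_snd_lift_pt[OF p(1)])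
    show ?thesis unfolding G_def by measurable
  qed
  have "sq_int (\<lambda>t. G (lift_pt p (e + y) (z, t))) \<le> sq_int (\<lambda>t. G (lift_pt p e (z, t)))" for z
  proof -
    obtain C where C: "C \<ge> 0" "\<And>w \<sigma>. norm w \<le> norm z \<Longrightarrow> Im \<sigma> \<ge> p w + e \<Longrightarrow>
        norm (F (w, \<sigma>) / (1 - \<i> * of_real d * \<sigma>)) \<le> C / (1 + norm \<sigma>)"
      using mollifier_bound[OF p F K e d] by blast
    define g where "g = (\<lambda>\<sigma>. G (z, \<sigma> + \<i> * of_real (p z + e)))"
    have G: "(\<lambda>\<sigma>. G (z, \<sigma>)) holomorphic_on {\<sigma>. Im \<sigma> > p z}"
      unfolding G_def snd_conv
      by (intro mollifier_holomorphic holomorphic2_on_slice2[OF F] p d) (auto simp: Omega_def)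
    have hol: "g holomorphic_on {\<sigma>. Im \<sigma> > - e}"
      unfolding g_def by (rule holomorphic_on_translate[OF G]) auto
    have bd: "norm (g \<sigma>) \<le> C / (1 + norm \<sigma>)" if "Im \<sigma> \<ge> 0" for \<sigma>
    proof -
      have "norm (g \<sigma>) \<le> C / (1 + norm (\<sigma> + \<i> * of_real (p z + e)))"
        unfolding g_def G_def snd_conv using that by (intro C) auto
      also have "\<dots> \<le> C / (1 + norm \<sigma>)"
      proof (intro frac_le C)
        have "(Im \<sigma>)\<^sup>2 \<le> (Im \<sigma> + (p z + e))\<^sup>2"
          using that e p(2)[of z] by (intro power_mono) auto
        then show "1 + norm \<sigma> \<le> 1 + norm (\<sigma> + \<i> * of_real (p z + e))"
          by (simp add: cmod_def)
      qed (auto intro: add_pos_nonneg)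
      finally show ?thesis .
    qed
    have eq: "g (Complex t v) = G (lift_pt p (e + v) (z, t))" for t v
    proof -
      have "Complex t v + \<i> * of_real (p z + e) = Complex t (p z + (e + v))" by (simp add: complex_eq_iff)
      then show ?thesis by (simp only: g_def lift_pt_def fst_conv snd_conv)
    qed
    note dec = halfplane_L2_decreasing[OF hol e bd]
    have nn: "sq_int (\<lambda>t. g (Complex t v)) = ennreal (LBINT t. (norm (g (Complex t v)))\<^sup>2)" if "v \<ge> 0" for v
      using dec(1)[OF _ that] by (intro nn_integral_eq_integral) auto
    have "sq_int (\<lambda>t. g (Complex t y)) \<le> sq_int (\<lambda>t. g (Complex t 0))"
      unfolding nn[OF y] nn[OF order_refl] using dec(2)[OF _ y] by (intro ennreal_leI) auto
    then show ?thesis by (simp add: eq)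
  qed
  then show ?thesis
    using e y by (simp add: sq_int_prod[OF Gm] nn_integral_mono)
qed

text \<open>Fatou's lemma removes the mollifier on the left; on the right it may be dropped because
  it only decreases the modulus.\<close>

lemma sq_int_mono:
  assumes p: "continuous_on UNIV p" "\<And>z. p z \<ge> 0" and F: "holomorphic2_on F (Omega p)"
    and K: "\<And>y. y > 0 \<Longrightarrow> sq_int (\<lambda>x. F (lift_pt p y x)) \<le> ennreal K" and e: "e > 0" and y: "y \<ge> 0"
  shows "sq_int (\<lambda>x. F (lift_pt p (e + y) x)) \<le> sq_int (\<lambda>x. F (lift_pt p e x))"
proof -
  define G where "G = (\<lambda>n Z. F Z / (1 - \<i> * of_real (1 / real (Suc n)) * snd Z))"
  have Fm: "(\<lambda>x. F (lift_pt p y x)) \<in> borel_measurable borel" if y: "y > 0" for y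
    by (rule measurable_slice[OF p(1) F y])
  have Gm: "(\<lambda>x. G n (lift_pt p y x)) \<in> borel_measurable borel" if y: "y > 0" for y n
  proof -
    note [measurable] = Fm[OF y]
    have [measurable]: "(\<lambda>x. snd (lift_pt p y x)) \<in> borel_measurable borel"
      by (rule measurable_snd_lift_pt[OF p(1)])
    show ?thesis unfolding G_def by measurable
  qed
  have lim: "(\<lambda>n. G n Z) \<longlonglongrightarrow> F Z" for Z
  proof -
    have "(\<lambda>n. 1 / real (Suc n)) \<longlonglongrightarrow> 0" by real_asymp
    then have "(\<lambda>n. complex_of_real (1 / real (Suc n))) \<longlonglongrightarrow> of_real 0"
      by (rule tendsto_of_real)
    then have "(\<lambda>n. F Z / (1 - \<i> * of_real (1 / real (Suc n)) * snd Z)) \<longlonglongrightarrow> F Z / (1 - \<i> * of_real 0 * snd Z)"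
      by (intro tendsto_divide tendsto_diff tendsto_mult tendsto_const) auto
    then show ?thesis by (simp add: G_def)
  qed
  have le: "norm (G n Z) \<le> norm (F Z)" if "Im (snd Z) \<ge> 0" for n Z
  proof -
    have "1 \<le> norm (1 - \<i> * of_real (1 / real (Suc n)) * snd Z)"
      by (rule norm_mollifier_ge(1)) (use that in auto)
    then have "norm (F Z) / norm (1 - \<i> * of_real (1 / real (Suc n)) * snd Z) \<le> norm (F Z) / 1"
      by (intro frac_le) auto
    then show ?thesis by (simp add: G_def norm_divide)
  qed
  have "sq_int (\<lambda>x. F (lift_pt p (e + y) x)) = (\<integral>\<^sup>+x. liminf (\<lambda>n. ennreal ((norm (G n (lift_pt p (e + y) x)))\<^sup>2)) \<partial>lborel)"
  proof (intro nn_integral_cong)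
    fix x
    have "(\<lambda>n. ennreal ((norm (G n (lift_pt p (e + y) x)))\<^sup>2)) \<longlonglongrightarrow> ennreal ((norm (F (lift_pt p (e + y) x)))\<^sup>2)"
      by (intro tendsto_ennrealI tendsto_intros lim)
    then show "ennreal ((norm (F (lift_pt p (e + y) x)))\<^sup>2) = liminf (\<lambda>n. ennreal ((norm (G n (lift_pt p (e + y) x)))\<^sup>2))"
      by (rule lim_imp_Liminf[symmetric, OF sequentially_bot])
  qed
  also have "\<dots> \<le> liminf (\<lambda>n. sq_int (\<lambda>x. G n (lift_pt p (e + y) x)))"
    using Gm[of "e + y"] e y by (intro nn_integral_liminf) auto
  also have "\<dots> \<le> liminf (\<lambda>n. sq_int (\<lambda>x. F (lift_pt p e x)))"
  proof (intro Liminf_mono always_eventually allI)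
    fix n
    have "sq_int (\<lambda>x. G n (lift_pt p (e + y) x)) \<le> sq_int (\<lambda>x. G n (lift_pt p e x))"
      unfolding G_def by (rule sq_int_mollified_mono[OF p F K e _ y]) auto
    also have "\<dots> \<le> sq_int (\<lambda>x. F (lift_pt p e x))"
    proof (intro nn_integral_mono ennreal_leI power_mono le)
      show "0 \<le> Im (snd (lift_pt p e x))" for x using e p(2)[of "fst x"] by (simp add: lift_pt_def)
    qed auto
    finally show "sq_int (\<lambda>x. G n (lift_pt p (e + y) x)) \<le> sq_int (\<lambda>x. F (lift_pt p e x))" .
  qed
  also have "\<dots> = sq_int (\<lambda>x. F (lift_pt p e x))" by (rule Liminf_const) simp
  finally show ?thesis .
qed

lemma sq_int_add_le:
  assumes [measurable]: "f \<in> borel_measurable borel" "g \<in> borel_measurable borel"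
  shows "sq_int (\<lambda>x. f x + g x) \<le> 2 * sq_int f + 2 * sq_int g"
proof -
  have "sq_int (\<lambda>x. f x + g x) \<le> (\<integral>\<^sup>+x. 2 * ennreal ((norm (f x))\<^sup>2) + 2 * ennreal ((norm (g x))\<^sup>2) \<partial>lborel)"
  proof (rule nn_integral_mono)
    fix x
    have "(norm (f x + g x))\<^sup>2 \<le> (norm (f x) + norm (g x))\<^sup>2"
      by (intro power_mono norm_triangle_ineq) auto
    also have "\<dots> \<le> 2 * (norm (f x))\<^sup>2 + 2 * (norm (g x))\<^sup>2"
      using sum_squares_bound[of "norm (f x)" "norm (g x)"] by (simp add: power2_sum)
    finally have "ennreal ((norm (f x + g x))\<^sup>2) \<le> ennreal (2 * (norm (f x))\<^sup>2 + 2 * (norm (g x))\<^sup>2)"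
      by (rule ennreal_leI)
    then show "ennreal ((norm (f x + g x))\<^sup>2) \<le> 2 * ennreal ((norm (f x))\<^sup>2) + 2 * ennreal ((norm (g x))\<^sup>2)"
      by (simp add: ennreal_mult')
  qed
  also have "\<dots> = 2 * sq_int f + 2 * sq_int g"
    by (simp add: nn_integral_add nn_integral_cmult)
  finally show ?thesis .
qed

lemma hardy_extension_bound:
  assumes p: "continuous_on UNIV p" and f: "hardy_extension p f F"
  obtains K where "K \<ge> 0" "\<And>y. y > 0 \<Longrightarrow> sq_int (\<lambda>x. F (lift_pt p y x)) \<le> ennreal K"
proof -
  let ?S = "SUP y\<in>{0<..}. sq_int (\<lambda>x. F (lift_pt p y x))"
  have "?S < \<infinity>" using f by (simp add: hardy_extension_def)
  then obtain K where K: "?S = ennreal K" "K \<ge> 0" by (cases ?S) auto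
  have "sq_int (\<lambda>x. F (lift_pt p y x)) \<le> ennreal K" if "y > 0" for y
    using that by (subst K(1)[symmetric]) (intro SUP_upper, simp)
  with K(2) show ?thesis using that by blast
qed

text \<open>By monotonicity a slice is dominated by all lower ones, and these approach the boundary
  function. The factor 2 comes from the crude triangle inequality and is harmless: what matters is a
  bound by the boundary norm, uniform in the height, on which closedness of the space rests.\<close>

lemma hardy_extension_sq_int_le:
  assumes p: "continuous_on UNIV p" "\<And>z. p z \<ge> 0" and f: "hardy_extension p f F"
    and fm: "f \<in> borel_measurable borel" and y: "y > 0"
  shows "sq_int (\<lambda>x. F (lift_pt p y x)) \<le> 2 * sq_int f"
proof -
  obtain K where K: "\<And>y. y > 0 \<Longrightarrow> sq_int (\<lambda>x. F (lift_pt p y x)) \<le> ennreal K"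
    using hardy_extension_bound[OF p(1) f] by blast
  have F: "holomorphic2_on F (Omega p)" using f by (simp add: hardy_extension_def)
  have lim: "((\<lambda>e. sq_int (\<lambda>x. F (lift_pt p e x) - f x)) \<longlongrightarrow> 0) (at_right 0)"
    using f by (simp add: hardy_extension_def)
  have "((\<lambda>e. 2 * sq_int (\<lambda>x. F (lift_pt p e x) - f x) + 2 * sq_int f) \<longlongrightarrow> 2 * 0 + 2 * sq_int f) (at_right 0)"
    by (intro tendsto_add tendsto_const ennreal_tendsto_cmult lim) simp
  moreover have "\<forall>\<^sub>F e in at_right 0. sq_int (\<lambda>x. F (lift_pt p y x)) \<le> 2 * sq_int (\<lambda>x. F (lift_pt p e x) - f x) + 2 * sq_int f"
    using eventually_at_right_less[of 0] eventually_at_right_real[OF y]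
  proof eventually_elim
    case (elim e)
    have "sq_int (\<lambda>x. F (lift_pt p (e + (y - e)) x)) \<le> sq_int (\<lambda>x. F (lift_pt p e x))"
      using elim by (intro sq_int_mono[OF p F K]) auto
    also have "\<dots> = sq_int (\<lambda>x. (F (lift_pt p e x) - f x) + f x)" by simp
    also have "\<dots> \<le> 2 * sq_int (\<lambda>x. F (lift_pt p e x) - f x) + 2 * sq_int f"
      using elim fm measurable_slice[OF p(1) F, of e] by (intro sq_int_add_le borel_measurable_diff) auto
    finally show ?case by simp
  qed
  ultimately have "sq_int (\<lambda>x. F (lift_pt p y x)) \<le> 2 * 0 + 2 * sq_int f"
    by (intro tendsto_lowerbound) auto
  then show ?thesis by simp
qed

section \<open>Orthogonal projection onto a closed subspace of L2\<close>

lemma sq_int_eq_integral: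
  assumes "integrable lborel (\<lambda>x. (norm (f x))\<^sup>2)"
  shows "sq_int f = ennreal (\<integral>x. (norm (f x))\<^sup>2 \<partial>lborel)"
  using assms by (intro nn_integral_eq_integral) auto

lemma L2_D:
  assumes "f \<in> L2"
  shows "f \<in> borel_measurable borel" "integrable lborel (\<lambda>x. (norm (f x))\<^sup>2)"
  using assms by (auto simp: L2_def)

lemma L2_iff: "f \<in> L2 \<longleftrightarrow> f \<in> borel_measurable borel \<and> sq_int f < \<infinity>"
proof
  assume f: "f \<in> L2"
  show "f \<in> borel_measurable borel \<and> sq_int f < \<infinity>"
    using L2_D[OF f] sq_int_eq_integral[OF L2_D(2)[OF f]] by auto
next
  assume f: "f \<in> borel_measurable borel \<and> sq_int f < \<infinity>"
  then have [measurable]: "f \<in> borel_measurable borel" by simp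
  have "integrable lborel (\<lambda>x. (norm (f x))\<^sup>2)"
    using f by (intro integrableI_bounded) auto
  then show "f \<in> L2" by (simp add: L2_def)
qed

lemma L2_add: "f \<in> L2 \<Longrightarrow> g \<in> L2 \<Longrightarrow> (\<lambda>x. f x + g x) \<in> L2"
proof -
  assume "f \<in> L2" "g \<in> L2"
  then have m: "f \<in> borel_measurable borel" "g \<in> borel_measurable borel"
    and fin: "sq_int f < \<infinity>" "sq_int g < \<infinity>" by (auto simp: L2_iff)
  have "sq_int (\<lambda>x. f x + g x) \<le> 2 * sq_int f + 2 * sq_int g"
    using m by (rule sq_int_add_le)
  also have "\<dots> < \<infinity>" using fin by (simp add: ennreal_mult_less_top)
  finally show ?thesis using m by (simp add: L2_iff)
qed

lemma sq_int_scale: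
  assumes [measurable]: "f \<in> borel_measurable borel"
  shows "sq_int (\<lambda>x. c * f x) = ennreal ((norm c)\<^sup>2) * sq_int f"
  by (simp add: norm_mult power_mult_distrib ennreal_mult nn_integral_cmult)

lemma L2_scale: "f \<in> L2 \<Longrightarrow> (\<lambda>x. c * f x) \<in> L2"
  by (auto simp: L2_iff sq_int_scale ennreal_mult_less_top)

lemma L2_diff: "f \<in> L2 \<Longrightarrow> g \<in> L2 \<Longrightarrow> (\<lambda>x. f x - g x) \<in> L2"
  using L2_add[of f "\<lambda>x. - 1 * g x"] L2_scale[of g "- 1"] by simp

lemma L2_integrable_inner: "f \<in> L2 \<Longrightarrow> g \<in> L2 \<Longrightarrow> integrable lborel (\<lambda>x. f x * cnj (g x))"
  by (intro integrable_mult_cnj) (auto simp: L2_def)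

text \<open>The increments are absolutely summable almost everywhere because
  \<open>|d| \<le> 2\<^sup>-\<^sup>n + 2\<^sup>n |d|\<^sup>2\<close>; Fatou's lemma then identifies the pointwise limit.\<close>

lemma L2_complete:
  assumes g: "\<And>n. g n \<in> L2"
    and C: "\<And>m n. n \<le> m \<Longrightarrow> sq_int (\<lambda>x. g n x - g m x) \<le> ennreal (C * (1 / 4) ^ n)"
  obtains G where "G \<in> L2" "\<And>n. sq_int (\<lambda>x. g n x - G x) \<le> ennreal (C * (1 / 4) ^ n)"
proof -
  have gm[measurable]: "g n \<in> borel_measurable borel" for n
    using g by (auto simp: L2_iff)
  define T where "T = (\<lambda>x. \<Sum>n. ennreal (2 ^ n * (norm (g n x - g (Suc n) x))\<^sup>2))"
  have "(\<integral>\<^sup>+x. T x \<partial>lborel) = (\<Sum>n. \<integral>\<^sup>+x. ennreal (2 ^ n * (norm (g n x - g (Suc n) x))\<^sup>2) \<partial>lborel)"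
    unfolding T_def by (intro nn_integral_suminf) measurable
  also have "\<dots> \<le> (\<Sum>n. ennreal (\<bar>C\<bar> * (1 / 2) ^ n))"
  proof (rule suminf_le)
    fix n
    have "(\<integral>\<^sup>+x. ennreal (2 ^ n * (norm (g n x - g (Suc n) x))\<^sup>2) \<partial>lborel) = ennreal (2 ^ n) * sq_int (\<lambda>x. g n x - g (Suc n) x)"
      by (simp add: ennreal_mult nn_integral_cmult)
    also have "\<dots> \<le> ennreal (2 ^ n) * ennreal (C * (1 / 4) ^ n)"
      by (intro mult_left_mono C) auto
    also have "\<dots> \<le> ennreal (2 ^ n) * ennreal (\<bar>C\<bar> * (1 / 4) ^ n)"
      by (intro mult_left_mono ennreal_leI mult_right_mono) auto
    also have "\<dots> = ennreal (\<bar>C\<bar> * (1 / 2) ^ n)"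
    proof -
      have "(2::real) ^ n * (\<bar>C\<bar> * (1 / 4) ^ n) = \<bar>C\<bar> * (2 * (1 / 4)) ^ n"
        by (simp only: power_mult_distrib mult_ac)
      then show ?thesis by (simp add: ennreal_mult[symmetric])
    qed
    finally show "(\<integral>\<^sup>+x. ennreal (2 ^ n * (norm (g n x - g (Suc n) x))\<^sup>2) \<partial>lborel) \<le> ennreal (\<bar>C\<bar> * (1 / 2) ^ n)" .
  qed auto
  also have "\<dots> = ennreal (\<Sum>n. \<bar>C\<bar> * (1 / 2) ^ n)"
    by (intro suminf_ennreal2 summable_mult summable_geometric) auto
  finally have Tfin: "(\<integral>\<^sup>+x. T x \<partial>lborel) < \<infinity>"
    by (rule le_less_trans) simp
  have Tm: "T \<in> borel_measurable lborel" unfolding T_def by measurable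
  have "AE x in lborel. T x \<noteq> \<infinity>"
    using nn_integral_PInf_AE[OF Tm] Tfin by auto
  then have conv: "AE x in lborel. convergent (\<lambda>n. g n x)"
  proof eventually_elim
    case (elim x)
    have s: "summable (\<lambda>n. 2 ^ n * (norm (g n x - g (Suc n) x))\<^sup>2)"
      using elim unfolding T_def by (intro summable_suminf_not_top) auto
    have "summable (\<lambda>n. norm (g n x - g (Suc n) x))"
    proof (rule summable_comparison_test)
      show "summable (\<lambda>n. (1 / 2) ^ n + 2 ^ n * (norm (g n x - g (Suc n) x))\<^sup>2)"
        using s by (intro summable_add summable_geometric) auto
      have "norm d \<le> (1 / 2) ^ n + 2 ^ n * (norm d)\<^sup>2" for d :: complex and n
      proof (cases "norm d \<le> (1 / 2) ^ n")
        case True then show ?thesis by (simp add: add_increasing2)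
      next
        case False
        have "1 = 2 ^ n * (1 / 2 :: real) ^ n" by (simp add: power_one_over)
        also have "\<dots> \<le> 2 ^ n * norm d" using False by (intro mult_left_mono) auto
        finally have "norm d * 1 \<le> norm d * (2 ^ n * norm d)" by (intro mult_left_mono) auto
        then show ?thesis by (simp add: power2_eq_square mult_ac add_increasing)
      qed
      then show "\<exists>N. \<forall>n\<ge>N. norm (norm (g n x - g (Suc n) x)) \<le> (1 / 2) ^ n + 2 ^ n * (norm (g n x - g (Suc n) x))\<^sup>2"
        by auto
    qed
    then have "summable (\<lambda>n. g n x - g (Suc n) x)" by (rule summable_norm_cancel)
    then have "convergent (\<lambda>n. \<Sum>k<n. g k x - g (Suc k) x)" by (simp add: summable_iff_convergent)
    then have "convergent (\<lambda>n. g 0 x - g n x)" by (simp only: sum_lessThan_telescope'[of "\<lambda>n. g n x"])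
    then obtain l where "(\<lambda>n. g 0 x - g n x) \<longlonglongrightarrow> l" unfolding convergent_def by blast
    then have "(\<lambda>n. g 0 x - (g 0 x - g n x)) \<longlonglongrightarrow> g 0 x - l" by (intro tendsto_intros)
    then show ?case by (auto simp: convergent_def)
  qed
  \<comment> \<open>Where the sequence diverges, \<open>lim\<close> has an unspecified value; these
    points form a null set.\<close>
  define G where "G = (\<lambda>x. lim (\<lambda>n. g n x))"
  have Gm[measurable]: "G \<in> borel_measurable borel"
    unfolding G_def by (rule borel_measurable_lim_metric) measurable
  have bound: "sq_int (\<lambda>x. g n x - G x) \<le> ennreal (C * (1 / 4) ^ n)" for n
  proof -
    have "sq_int (\<lambda>x. g n x - G x) = (\<integral>\<^sup>+x. liminf (\<lambda>m. ennreal ((norm (g n x - g m x))\<^sup>2)) \<partial>lborel)"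
    proof (rule nn_integral_cong_AE)
      show "AE x in lborel. ennreal ((norm (g n x - G x))\<^sup>2) = liminf (\<lambda>m. ennreal ((norm (g n x - g m x))\<^sup>2))"
        using conv
      proof eventually_elim
        case (elim x)
        then have "(\<lambda>m. g m x) \<longlonglongrightarrow> G x" by (simp add: G_def convergent_LIMSEQ_iff)
        then have "(\<lambda>m. ennreal ((norm (g n x - g m x))\<^sup>2)) \<longlonglongrightarrow> ennreal ((norm (g n x - G x))\<^sup>2)"
          by (intro tendsto_ennrealI tendsto_intros)
        then show ?case by (rule lim_imp_Liminf[symmetric, OF sequentially_bot])
      qed
    qed
    also have "\<dots> \<le> liminf (\<lambda>m. sq_int (\<lambda>x. g n x - g m x))"
      by (intro nn_integral_liminf) measurable
    also have "\<dots> \<le> liminf (\<lambda>m. ennreal (C * (1 / 4) ^ n))"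
      using C by (intro Liminf_mono eventually_sequentiallyI[of n]) auto
    also have "\<dots> = ennreal (C * (1 / 4) ^ n)" by (rule Liminf_const) simp
    finally show ?thesis .
  qed
  have "(\<lambda>x. g 0 x - G x) \<in> L2"
    using bound[of 0] by (auto simp: L2_iff intro: le_less_trans)
  with g[of 0] have "(\<lambda>x. g 0 x - (g 0 x - G x)) \<in> L2" by (rule L2_diff)
  moreover have "(\<lambda>x. g 0 x - (g 0 x - G x)) = G" by (rule ext) simp
  ultimately have "G \<in> L2" by (simp only:)
  then show ?thesis using bound that by blast
qed

abbreviation sq_norm :: "(complex \<times> real \<Rightarrow> complex) \<Rightarrow> real" where
  "sq_norm f \<equiv> (\<integral>x. (norm (f x))\<^sup>2 \<partial>lborel)"

lemma sq_norm_nonneg: "sq_norm f \<ge> 0"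
  by (intro integral_nonneg_AE) auto

lemma sq_int_L2: "f \<in> L2 \<Longrightarrow> sq_int f = ennreal (sq_norm f)"
  by (intro sq_int_eq_integral L2_D)

text \<open>Young's inequality with a weight. The coefficient of the first term can be brought
  arbitrarily close to 1, which is needed to see that the limit of a minimising sequence attains the
  minimal distance.\<close>

lemma sq_norm_le_eps:
  assumes f: "f \<in> L2" and g: "g \<in> L2" and e: "e > 0"
  shows "sq_norm (\<lambda>x. f x + g x) \<le> (1 + e) * sq_norm f + (1 + 1 / e) * sq_norm g"
proof -
  have "sq_norm (\<lambda>x. f x + g x) \<le> (\<integral>x. (1 + e) * (norm (f x))\<^sup>2 + (1 + 1 / e) * (norm (g x))\<^sup>2 \<partial>lborel)"
  proof (rule integral_mono)
    show "integrable lborel (\<lambda>x. (norm (f x + g x))\<^sup>2)" using L2_D[OF L2_add[OF f g]] by simp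
    show "integrable lborel (\<lambda>x. (1 + e) * (norm (f x))\<^sup>2 + (1 + 1 / e) * (norm (g x))\<^sup>2)"
      using L2_D[OF f] L2_D[OF g] by (intro Bochner_Integration.integrable_add integrable_mult_right)
    fix x
    have "(norm (f x + g x))\<^sup>2 \<le> (norm (f x) + norm (g x))\<^sup>2"
      by (intro power_mono norm_triangle_ineq) auto
    also have "\<dots> = (norm (f x))\<^sup>2 + (norm (g x))\<^sup>2 + 2 * ((sqrt e * norm (f x)) * (norm (g x) / sqrt e))"
      using e by (simp add: power2_sum)
    also have "\<dots> \<le> (norm (f x))\<^sup>2 + (norm (g x))\<^sup>2 + ((sqrt e * norm (f x))\<^sup>2 + (norm (g x) / sqrt e)\<^sup>2)"
      using sum_squares_bound[of "sqrt e * norm (f x)" "norm (g x) / sqrt e"] e by (simp add: mult.assoc)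
    also have "\<dots> = (1 + e) * (norm (f x))\<^sup>2 + (1 + 1 / e) * (norm (g x))\<^sup>2"
      using e by (simp add: power_mult_distrib power_divide algebra_simps)
    finally show "(norm (f x + g x))\<^sup>2 \<le> (1 + e) * (norm (f x))\<^sup>2 + (1 + 1 / e) * (norm (g x))\<^sup>2" .
  qed
  also have "\<dots> = (1 + e) * sq_norm f + (1 + 1 / e) * sq_norm g"
    using L2_D[OF f] L2_D[OF g] by simp
  finally show ?thesis .
qed

lemma sq_norm_diff_scale:
  assumes u: "u \<in> L2" and h: "h \<in> L2"
  shows "sq_norm (\<lambda>x. u x - c * h x) = sq_norm u - 2 * Re (cnj c * L2_inner u h) + (norm c)\<^sup>2 * sq_norm h"
proof -
  have eq: "(norm (a - c * b))\<^sup>2 = (norm a)\<^sup>2 - 2 * Re (cnj c * (a * cnj b)) + (norm c)\<^sup>2 * (norm b)\<^sup>2" for a b :: complex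
    unfolding cmod_power2 by (simp add: power2_eq_square algebra_simps)
  have int: "integrable lborel (\<lambda>x. cnj c * (u x * cnj (h x)))"
    by (intro integrable_mult_right L2_integrable_inner u h)
  define r where "r = (\<lambda>x. Re (cnj c * (u x * cnj (h x))))"
  have r: "integrable lborel r" unfolding r_def by (rule integrable_Re[OF int])
  have "sq_norm (\<lambda>x. u x - c * h x) = (\<integral>x. (norm (u x))\<^sup>2 - 2 * r x + (norm c)\<^sup>2 * (norm (h x))\<^sup>2 \<partial>lborel)"
    by (simp only: eq r_def)
  also have "\<dots> = sq_norm u - 2 * (\<integral>x. r x \<partial>lborel) + (norm c)\<^sup>2 * sq_norm h"
    using L2_D[OF u] L2_D[OF h] r by simp
  also have "(\<integral>x. r x \<partial>lborel) = Re (cnj c * L2_inner u h)"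
    unfolding r_def using int by (simp only: integral_Re integral_mult_right_zero L2_inner_def)
  finally show ?thesis .
qed

text \<open>A minimising sequence with excess \<open>(1 / 4) ^ n\<close>. The midpoint of two
  members stays in \<open>V\<close>, so the parallelogram law bounds their distance by the excesses,
  at the rate that \<open>L2_complete\<close> asks for. Orthogonality follows by perturbing the
  minimiser.\<close>

lemma L2_projection_exists:
  assumes V: "V \<subseteq> L2" "(\<lambda>x. 0) \<in> V"
    and add: "\<And>f g. f \<in> V \<Longrightarrow> g \<in> V \<Longrightarrow> (\<lambda>x. f x + g x) \<in> V"
    and scale: "\<And>f c. f \<in> V \<Longrightarrow> (\<lambda>x. c * f x) \<in> V"
    and closed: "\<And>f g. (\<And>n. f n \<in> V) \<Longrightarrow> g \<in> L2 \<Longrightarrow> (\<lambda>n. sq_int (\<lambda>x. f n x - g x)) \<longlonglongrightarrow> 0 \<Longrightarrow> g \<in> V"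
    and f: "f \<in> L2"
  obtains g where "g \<in> V" "\<And>h. h \<in> V \<Longrightarrow> L2_inner (\<lambda>x. f x - g x) h = 0"
proof -
  define d where "d = (INF h\<in>V. sq_norm (\<lambda>x. f x - h x))"
  have bdd: "bdd_below ((\<lambda>h. sq_norm (\<lambda>x. f x - h x)) ` V)"
    by (rule bdd_belowI2[of _ 0]) (rule sq_norm_nonneg)
  have dle: "d \<le> sq_norm (\<lambda>x. f x - h x)" if "h \<in> V" for h
    unfolding d_def using that by (intro cINF_lower bdd)
  have "\<exists>h\<in>V. sq_norm (\<lambda>x. f x - h x) < d + (1 / 4) ^ n" for n :: nat
  proof (rule ccontr)
    assume "\<not> ?thesis"
    then have "d + (1 / 4) ^ n \<le> (INF h\<in>V. sq_norm (\<lambda>x. f x - h x))"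
      using V(2) by (intro cINF_greatest) (auto simp: not_less)
    moreover have "(1 / 4 :: real) ^ n > 0" by simp
    ultimately show False unfolding d_def[symmetric] by linarith
  qed
  then obtain g where gV: "\<And>n. g n \<in> V" and gd: "\<And>n. sq_norm (\<lambda>x. f x - g n x) < d + (1 / 4) ^ n"
    by metis
  have gL: "g n \<in> L2" for n using gV V by blast
  have cauchy: "sq_int (\<lambda>x. g n x - g m x) \<le> ennreal (4 * (1 / 4) ^ n)" if "n \<le> m" for m n
  proof -
    have mid: "(\<lambda>x. 1 / 2 * (g n x + g m x)) \<in> V" by (intro scale add gV)
    have par: "(norm (a - b))\<^sup>2 = 2 * (norm (c - a))\<^sup>2 + 2 * (norm (c - b))\<^sup>2 - 4 * (norm (c - 1 / 2 * (a + b)))\<^sup>2" for a b c :: complex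
      unfolding cmod_power2 by (simp add: power2_eq_square field_simps)
    have i: "integrable lborel (\<lambda>x. (norm (f x - g n x))\<^sup>2)" "integrable lborel (\<lambda>x. (norm (f x - g m x))\<^sup>2)"
      "integrable lborel (\<lambda>x. (norm (f x - 1 / 2 * (g n x + g m x)))\<^sup>2)"
      using mid V by (intro L2_D(2) L2_diff f gL; blast)+
    have "sq_norm (\<lambda>x. g n x - g m x) = (\<integral>x. 2 * (norm (f x - g n x))\<^sup>2 + 2 * (norm (f x - g m x))\<^sup>2
        - 4 * (norm (f x - 1 / 2 * (g n x + g m x)))\<^sup>2 \<partial>lborel)"
      by (rule Bochner_Integration.integral_cong[OF refl par])
    also have "\<dots> = 2 * sq_norm (\<lambda>x. f x - g n x) + 2 * sq_norm (\<lambda>x. f x - g m x)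
        - 4 * sq_norm (\<lambda>x. f x - 1 / 2 * (g n x + g m x))"
      using i by simp
    also have "\<dots> \<le> 2 * (d + (1 / 4) ^ n) + 2 * (d + (1 / 4) ^ m) - 4 * d"
    proof -
      have "2 * a + 2 * b - 4 * c \<le> 2 * (d + p) + 2 * (d + q) - 4 * d"
        if "a < d + p" "b < d + q" "d \<le> c" for a b c p q :: real
        using that by argo
      from this[OF gd[of n] gd[of m] dle[OF mid]] show ?thesis .
    qed
    also have "\<dots> \<le> 4 * (1 / 4) ^ n"
      using power_decreasing[OF that, of "1 / 4 :: real"] by simp
    finally show ?thesis
      using sq_int_L2[OF L2_diff[OF gL gL]] by (simp add: ennreal_leI)
  qed
  obtain G where G: "G \<in> L2" and Gb: "\<And>n. sq_int (\<lambda>x. g n x - G x) \<le> ennreal (4 * (1 / 4) ^ n)"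
    using L2_complete[OF gL cauchy] by blast
  have GV: "G \<in> V"
  proof (rule closed[OF gV G])
    have "(\<lambda>n. 4 * (1 / 4 :: real) ^ n) \<longlonglongrightarrow> 0" by real_asymp
    then have lim: "(\<lambda>n. ennreal (4 * (1 / 4) ^ n)) \<longlonglongrightarrow> 0"
      using tendsto_ennrealI by fastforce
    show "(\<lambda>n. sq_int (\<lambda>x. g n x - G x)) \<longlonglongrightarrow> 0"
      by (rule tendsto_sandwich[OF _ _ tendsto_const lim]; intro always_eventually allI) (simp, rule Gb)
  qed
  have Gd: "sq_norm (\<lambda>x. f x - G x) \<le> d"
  proof (rule field_le_epsilon)
    fix t :: real assume t: "t > 0"
    have d0: "d \<ge> 0" unfolding d_def using V(2) by (intro cINF_greatest sq_norm_nonneg) auto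
    \<comment> \<open>Chosen to make \<open>e * d \<le> t\<close>; the denominator
      \<open>d + 1\<close> covers the case \<open>d = 0\<close>.\<close>
    define e where "e = t / (d + 1)"
    have e: "e > 0" using t d0 by (simp add: e_def)
    have ub: "sq_norm (\<lambda>x. f x - G x) \<le> (1 + e) * (d + (1 / 4) ^ n) + (1 + 1 / e) * (4 * (1 / 4) ^ n)" for n
    proof -
      have "sq_norm (\<lambda>x. f x - G x) = sq_norm (\<lambda>x. (f x - g n x) + (g n x - G x))" by simp
      also have "\<dots> \<le> (1 + e) * sq_norm (\<lambda>x. f x - g n x) + (1 + 1 / e) * sq_norm (\<lambda>x. g n x - G x)"
        by (intro sq_norm_le_eps L2_diff f gL G e)
      also have "\<dots> \<le> (1 + e) * (d + (1 / 4) ^ n) + (1 + 1 / e) * (4 * (1 / 4) ^ n)"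
      proof (intro add_mono mult_left_mono)
        show "sq_norm (\<lambda>x. g n x - G x) \<le> 4 * (1 / 4) ^ n"
          using Gb[of n] sq_int_L2[OF L2_diff[OF gL G], of n] by (simp add: ennreal_le_iff)
      qed (use gd[of n] e in auto)
      finally show ?thesis .
    qed
    have "(\<lambda>n. (1 + e) * (d + (1 / 4) ^ n) + (1 + 1 / e) * (4 * (1 / 4) ^ n)) \<longlonglongrightarrow> (1 + e) * (d + 0) + (1 + 1 / e) * (4 * 0)"
      by (intro tendsto_intros LIMSEQ_power_zero) auto
    then have "sq_norm (\<lambda>x. f x - G x) \<le> (1 + e) * (d + 0) + (1 + 1 / e) * (4 * 0)"
      by (rule LIMSEQ_le_const) (use ub in auto)
    also have "\<dots> = d + e * d" by (simp add: algebra_simps)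
    also have "e * d \<le> t" using t d0 by (simp add: e_def field_simps)
    finally show "sq_norm (\<lambda>x. f x - G x) \<le> d + t" by simp
  qed
  have "L2_inner (\<lambda>x. f x - G x) h = 0" if h: "h \<in> V" for h
  proof (rule ccontr)
    assume I: "L2_inner (\<lambda>x. f x - G x) h \<noteq> 0"
    define I where "I = L2_inner (\<lambda>x. f x - G x) h"
    define N where "N = sq_norm h"
    \<comment> \<open>The perturbation by \<open>s * I\<close> times \<open>h\<close> changes the
      squared distance by a gain linear in \<open>s\<close> and a loss quadratic in
      \<open>s\<close>. With \<open>s * N < 1\<close> the gain wins.\<close>
    define s where "s = 1 / (N + 1)"
    have N: "N \<ge> 0" unfolding N_def by (rule sq_norm_nonneg)
    have s: "s > 0" "s * N < 1" using N by (auto simp: s_def field_simps)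
    have hL: "h \<in> L2" using h V by blast
    have I2: "(norm I)\<^sup>2 > 0" using I by (simp add: I_def)
    have "d \<le> sq_norm (\<lambda>x. f x - (G x + (of_real s * I) * h x))"
      by (intro dle add GV scale h)
    also have "\<dots> = sq_norm (\<lambda>x. (f x - G x) - (of_real s * I) * h x)"
      by (simp add: algebra_simps)
    also have "\<dots> = sq_norm (\<lambda>x. f x - G x) - 2 * Re (cnj (of_real s * I) * I) + (norm (of_real s * I))\<^sup>2 * N"
      unfolding I_def N_def by (intro sq_norm_diff_scale L2_diff f G hL)
    also have "Re (cnj (of_real s * I) * I) = s * (norm I)\<^sup>2"
      unfolding cmod_power2 by (simp add: power2_eq_square algebra_simps)
    also have "(norm (of_real s * I))\<^sup>2 * N = s * (norm I)\<^sup>2 * (s * N)"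
      using s by (simp add: norm_mult power_mult_distrib power2_eq_square)
    finally have "d \<le> d - 2 * (s * (norm I)\<^sup>2) + s * (norm I)\<^sup>2 * (s * N)"
      using Gd by linarith
    moreover have "s * (norm I)\<^sup>2 * (s * N) \<le> s * (norm I)\<^sup>2 * 1"
      using s I2 by (intro mult_left_mono) auto
    moreover have "s * (norm I)\<^sup>2 > 0" using s I2 by simp
    ultimately show False by linarith
  qed
  then show ?thesis using that GV by blast
qed

section \<open>The kernel\<close>

lemma nn_integral_tendsto_0_at_right:
  fixes u :: "real \<Rightarrow> 'a \<Rightarrow> ennreal"
  assumes m: "\<And>y. y > 0 \<Longrightarrow> u y \<in> borel_measurable M" and w: "w \<in> borel_measurable M" "(\<integral>\<^sup>+x. w x \<partial>M) < \<infinity>"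
    and bd: "\<And>y x. y > 0 \<Longrightarrow> u y x \<le> w x" and lim: "\<And>x. ((\<lambda>y. u y x) \<longlongrightarrow> 0) (at_right 0)"
  shows "((\<lambda>y. \<integral>\<^sup>+x. u y x \<partial>M) \<longlongrightarrow> 0) (at_right 0)"
proof (rule tendsto_at_right_sequentially[of 0 1])
  fix S :: "nat \<Rightarrow> real"
  assume S: "\<And>n. 0 < S n" "S \<longlonglongrightarrow> 0"
  have f: "filterlim S (at_right 0) sequentially"
    using S by (auto simp: filterlim_at less_imp_neq[symmetric] intro!: always_eventually)
  have "(\<lambda>n. \<integral>\<^sup>+x. u (S n) x \<partial>M) \<longlonglongrightarrow> (\<integral>\<^sup>+x. 0 \<partial>M)"
  proof (rule nn_integral_dominated_convergence[where w = w])
    show "AE x in M. (\<lambda>n. u (S n) x) \<longlonglongrightarrow> 0"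
      using filterlim_compose[OF lim f] by simp
  qed (use S m w bd in auto)
  then show "(\<lambda>n. \<integral>\<^sup>+x. u (S n) x \<partial>M) \<longlonglongrightarrow> 0" by simp
qed simp

lemma nn_integral_one_plus_abs_powr_finite:
  assumes b: "b > 0"
  shows "(\<integral>\<^sup>+s. ennreal ((1 + \<bar>s\<bar>) powr (- 1 - b)) \<partial>lborel) < \<infinity>"
proof -
  let ?f = "\<lambda>x. ennreal (indicator {1..} x * x powr (- 1 - b))"
  have fin: "(\<integral>\<^sup>+x. ?f x \<partial>lborel) < \<infinity>"
    using nn_integral_has_integral_lebesgue[OF _ has_integral_powr_to_inf[of "- 1 - b" 1]] b
    by (simp add: nn_integral_completion)
  have m: "?f \<in> borel_measurable borel" by measurable
  have "(\<integral>\<^sup>+s. ennreal ((1 + \<bar>s\<bar>) powr (- 1 - b)) \<partial>lborel) \<le> (\<integral>\<^sup>+s. ?f (1 + 1 * s) + ?f (1 + (- 1) * s) \<partial>lborel)"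
  proof (rule nn_integral_mono)
    fix s :: real
    show "ennreal ((1 + \<bar>s\<bar>) powr (- 1 - b)) \<le> ?f (1 + 1 * s) + ?f (1 + (- 1) * s)"
      by (cases "s \<ge> 0") (auto intro: add_increasing add_increasing2)
  qed
  also have "\<dots> = (\<integral>\<^sup>+s. ?f (1 + 1 * s) \<partial>lborel) + (\<integral>\<^sup>+s. ?f (1 + (- 1) * s) \<partial>lborel)"
    by (intro nn_integral_add) measurable
  also have "\<dots> = (\<integral>\<^sup>+x. ?f x \<partial>lborel) + (\<integral>\<^sup>+x. ?f x \<partial>lborel)"
    using nn_integral_real_affine[OF m, of 1 1] nn_integral_real_affine[OF m, of "-1" 1] by simp
  also have "\<dots> < \<infinity>" using fin by simp
  finally show ?thesis .
qed

section \<open>The weight |z|^\<alpha> and the closed form of its kernel\<close>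

locale pow_weight =
  fixes \<alpha> :: real
  assumes pos: "\<alpha> > 0"
begin

abbreviation p :: "complex \<Rightarrow> real" where "p \<equiv> \<lambda>z. norm z powr \<alpha>"

text \<open>The exponent for which \<open>p z powr b\<close> is the square of \<open>norm z\<close>;
  the image of planar measure under \<open>p\<close> has density proportional to
  \<open>v powr (b - 1)\<close>.\<close>

definition b :: real where "b = 2 / \<alpha>"

lemma b_pos: "b > 0" using pos by (simp add: b_def)

lemma p_cont: "continuous_on UNIV p"
  using pos by (intro continuous_on_powr' continuous_intros) auto

lemma p_nonneg: "p z \<ge> 0" by simp

lemma p_measurable [measurable]: "p \<in> borel_measurable borel"
  by (rule borel_measurable_continuous_onI[OF p_cont])

text \<open>Polarisation of the imaginary part of the second coordinate: holomorphic in
  \<open>Z\<close>, antiholomorphic in \<open>W\<close>, and equal to \<open>Im (snd Z)\<close> for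
  \<open>Z = W\<close>. On the boundary it is the quantity \<open>A\<close> of the theorem.\<close>

definition B :: "complex \<times> complex \<Rightarrow> complex \<times> complex \<Rightarrow> complex" where
  "B Z W = (\<i> * cnj (snd W) - \<i> * snd Z) / 2"

text \<open>Both arguments range over the closed domain, so that one expression gives the interior
  kernel, its Hardy extension in the other variable and the boundary kernel.\<close>

definition kern :: "complex \<times> complex \<Rightarrow> complex \<times> complex \<Rightarrow> complex" where
  "kern Z W = of_real (1 / (4 * pi\<^sup>2)) * B Z W powr of_real (- 1 - b)
     * (1 - fst Z * cnj (fst W) / B Z W powr of_real b) powi (- 2)"

lemma Re_B: "Re (B Z W) = (Im (snd Z) + Im (snd W)) / 2"
  and Im_B: "Im (B Z W) = (Re (snd W) - Re (snd Z)) / 2"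
  by (simp_all add: B_def)

lemma kern_alt: "kern Z W = of_real (1 / (4 * pi\<^sup>2)) * B Z W powr of_real (- 1 - b)
     / (1 - fst Z * cnj (fst W) / B Z W powr of_real b)\<^sup>2"
proof -
  have "x powi (- 2) = inverse (x\<^sup>2)" for x :: complex
    by (simp add: power_int_minus)
  then show ?thesis
    unfolding kern_def divide_inverse[of _ "_\<^sup>2"] by (simp only:)
qed

lemma B_cnj: "cnj (B Z W) = B W Z"
  by (simp add: complex_eq_iff Re_B Im_B add.commute minus_divide_left)

text \<open>What continuity of the kernel needs: the principal powers stay off their branch cut and
  the squared factor does not vanish.\<close>

definition good :: "complex \<times> complex \<Rightarrow> complex \<times> complex \<Rightarrow> bool" where
  "good Z W \<longleftrightarrow> B Z W \<notin> \<real>\<^sub>\<le>\<^sub>0 \<and> fst Z * cnj (fst W) \<noteq> B Z W powr of_real b"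

text \<open>Stated for arbitrary filters in order to cover continuity in either variable, on the
  diagonal \<open>Z = W\<close>, and in the approach to the boundary.\<close>

lemma kern_tendsto:
  assumes "(f \<longlongrightarrow> Z) F" "(g \<longlongrightarrow> W) F" and g: "good Z W"
  shows "((\<lambda>x. kern (f x) (g x)) \<longlongrightarrow> kern Z W) F"
proof -
  have B: "((\<lambda>x. B (f x) (g x)) \<longlongrightarrow> B Z W) F"
    unfolding B_def by (intro tendsto_divide tendsto_diff tendsto_mult tendsto_const tendsto_cnj tendsto_snd assms(1,2)) auto
  have n: "B Z W powr of_real b \<noteq> 0" using g by (auto simp: good_def)
  then have n2: "1 - fst Z * cnj (fst W) / B Z W powr of_real b \<noteq> 0"
    using g by (simp add: good_def)
  have P: "((\<lambda>x. B (f x) (g x) powr of_real e) \<longlongrightarrow> B Z W powr of_real e) F" for e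
    using g by (intro tendsto_powr_complex B tendsto_const) (auto simp: good_def)
  have "((\<lambda>x. fst (f x) * cnj (fst (g x)) / B (f x) (g x) powr of_real b)
      \<longlongrightarrow> fst Z * cnj (fst W) / B Z W powr of_real b) F"
    by (intro tendsto_divide tendsto_mult tendsto_fst tendsto_cnj assms(1,2) P n)
  then have "((\<lambda>x. (1 - fst (f x) * cnj (fst (g x)) / B (f x) (g x) powr of_real b)\<^sup>2)
      \<longlongrightarrow> (1 - fst Z * cnj (fst W) / B Z W powr of_real b)\<^sup>2) F"
    by (intro tendsto_power tendsto_diff tendsto_const)
  then show ?thesis
    unfolding kern_alt using n2 by (intro tendsto_divide tendsto_mult tendsto_const P) auto
qed

lemma kern_cnj:
  assumes "B Z W \<notin> \<real>\<^sub>\<le>\<^sub>0"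
  shows "cnj (kern Z W) = kern W Z"
proof -
  have "cnj (B Z W powr of_real c) = B W Z powr of_real c" for c
    using assms by (subst cnj_powr) (auto simp: B_cnj complex_nonpos_Reals_iff)
  note c = this
  show ?thesis
    unfolding kern_alt complex_cnj_divide complex_cnj_mult complex_cnj_power complex_cnj_diff
      complex_cnj_complex_of_real complex_cnj_one complex_cnj_cnj c
    by (simp add: mult.commute)
qed

lemma AM_GM_B:
  assumes "Im (snd Z) \<ge> 0" "Im (snd W) \<ge> 0"
  shows "Im (snd Z) * Im (snd W) \<le> (Re (B Z W))\<^sup>2"
proof -
  have "0 \<le> (Im (snd Z) - Im (snd W))\<^sup>2" by simp
  then show ?thesis unfolding Re_B by (simp add: power2_eq_square field_simps)
qed

text \<open>The real part of \<open>B\<close> is the arithmetic mean of the two imaginary parts,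
  hence at least their geometric mean. Raising this to the power \<open>1 / \<alpha>\<close> turns
  \<open>p\<close> back into the modulus.\<close>

lemma norm_B_powr_ge:
  assumes Z: "Im (snd Z) \<ge> 0" and W: "Im (snd W) \<ge> p (fst W)"
  shows "Im (snd Z) powr (1 / \<alpha>) * norm (fst W) \<le> norm (B Z W) powr b"
proof -
  have W0: "Im (snd W) \<ge> 0" using W p_nonneg order_trans by blast
  have "Im (snd Z) * p (fst W) \<le> Im (snd Z) * Im (snd W)"
    using W Z by (intro mult_left_mono)
  also have "\<dots> \<le> (Re (B Z W))\<^sup>2" by (rule AM_GM_B[OF Z W0])
  also have "\<dots> \<le> (norm (B Z W))\<^sup>2"
    by (simp add: cmod_power2)
  finally have "(Im (snd Z) * p (fst W)) powr (1 / \<alpha>) \<le> ((norm (B Z W))\<^sup>2) powr (1 / \<alpha>)"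
    using Z pos by (intro powr_mono2) auto
  moreover have "(Im (snd Z) * p (fst W)) powr (1 / \<alpha>) = Im (snd Z) powr (1 / \<alpha>) * norm (fst W)"
    using Z pos by (simp add: powr_mult powr_powr)
  moreover have "((norm (B Z W))\<^sup>2) powr (1 / \<alpha>) = norm (B Z W) powr b"
  proof -
    have "(norm (B Z W))\<^sup>2 = norm (B Z W) powr 2" by simp
    then show ?thesis by (simp only: powr_powr) (simp add: b_def)
  qed
  ultimately show ?thesis by simp
qed

text \<open>The slice of the domain at a fixed second coordinate is a disc about 0 of radius
  \<open>Im (snd Z) powr (1 / \<alpha>)\<close>, and \<open>\<rho>\<close> is the relative position
  in it. It bounds the ratio of the kernel series for all \<open>W\<close> at once.\<close>

definition \<rho> :: "complex \<times> complex \<Rightarrow> real" where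
  "\<rho> Z = norm (fst Z) / Im (snd Z) powr (1 / \<alpha>)"

lemma Omega_D:
  assumes "Z \<in> Omega p"
  shows "Im (snd Z) > p (fst Z)" "Im (snd Z) > 0"
proof -
  show "Im (snd Z) > p (fst Z)" using assms by (auto simp: Omega_def)
  from le_less_trans[OF p_nonneg this] show "Im (snd Z) > 0" .
qed

lemma \<rho>_bounds:
  assumes Z: "Z \<in> Omega p"
  shows "0 \<le> \<rho> Z" "\<rho> Z < 1"
proof -
  note zz = Omega_D[OF Z]
  show "0 \<le> \<rho> Z" by (simp add: \<rho>_def)
  have "norm (fst Z) = (p (fst Z)) powr (1 / \<alpha>)" using pos by (simp add: powr_powr)
  also have "\<dots> < Im (snd Z) powr (1 / \<alpha>)"
    using zz pos by (intro powr_less_mono2) auto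
  finally show "\<rho> Z < 1" using zz by (simp add: \<rho>_def)
qed

lemma ratio_bound:
  assumes Z: "Z \<in> Omega p" and W: "Im (snd W) \<ge> p (fst W)"
  shows "norm (fst Z) * norm (fst W) \<le> \<rho> Z * norm (B Z W) powr b"
proof -
  note zz = Omega_D[OF Z]
  have "\<rho> Z * (Im (snd Z) powr (1 / \<alpha>) * norm (fst W)) \<le> \<rho> Z * norm (B Z W) powr b"
    using zz W \<rho>_bounds[OF Z] by (intro mult_left_mono norm_B_powr_ge) auto
  then show ?thesis using zz by (simp add: \<rho>_def)
qed

lemma Re_B_pos:
  assumes Z: "Z \<in> Omega p" and W: "Im (snd W) \<ge> p (fst W)"
  shows "Re (B Z W) > 0"
proof -
  have "Im (snd W) \<ge> 0" using order_trans[OF p_nonneg W] .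
  then show ?thesis
    unfolding Re_B using Omega_D(2)[OF Z] by (simp add: add_pos_nonneg)
qed

lemma B_nonpos:
  assumes "Re (B Z W) > 0"
  shows "B Z W \<notin> \<real>\<^sub>\<le>\<^sub>0"
  using assms by (auto simp: complex_nonpos_Reals_iff)

lemma norm_B_powr: "norm (B Z W powr of_real c) = norm (B Z W) powr c"
  by (subst norm_powr_real_powr') auto

lemma quotient_bound:
  assumes Z: "Z \<in> Omega p" and W: "Im (snd W) \<ge> p (fst W)"
  shows "norm (fst Z * cnj (fst W) / B Z W powr of_real b) \<le> \<rho> Z"
proof -
  have "B Z W \<noteq> 0" using Re_B_pos[OF Z W] by auto
  then have "norm (B Z W) powr b > 0" by simp
  then show ?thesis
    using ratio_bound[OF Z W] unfolding norm_divide norm_mult norm_B_powr complex_mod_cnj by (simp add: field_simps)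
qed

lemma good_interior:
  assumes Z: "Z \<in> Omega p" and W: "Im (snd W) \<ge> p (fst W)"
  shows "good Z W" "good W Z"
proof -
  have n: "B Z W \<notin> \<real>\<^sub>\<le>\<^sub>0" "B W Z \<notin> \<real>\<^sub>\<le>\<^sub>0"
    using B_nonpos[of Z W] B_nonpos[of W Z] Re_B_pos[OF Z W] by (simp_all add: Re_B add.commute)
  have nBB: "norm (B W Z) = norm (B Z W)" by (metis B_cnj complex_mod_cnj)
  have "B Z W \<noteq> 0" using n by auto
  then have P: "norm (B Z W) powr b > 0" by simp
  have "norm (fst Z) * norm (fst W) < norm (B Z W) powr b"
    using le_less_trans[OF ratio_bound[OF Z W], of "norm (B Z W) powr b"] \<rho>_bounds[OF Z] P by simp
  then have l: "norm (fst Z * cnj (fst W)) < norm (B Z W powr of_real b)" 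
    "norm (fst W * cnj (fst Z)) < norm (B W Z powr of_real b)"
    unfolding norm_mult norm_B_powr complex_mod_cnj nBB by (simp_all add: mult.commute)
  from l n show "good Z W" "good W Z" by (auto simp: good_def)
qed

lemma kern_bound:
  assumes Z: "Z \<in> Omega p" and W: "Im (snd W) \<ge> p (fst W)"
  shows "norm (kern Z W) \<le> 1 / (4 * pi\<^sup>2 * (1 - \<rho> Z)\<^sup>2) * norm (B Z W) powr (- 1 - b)"
proof -
  let ?q = "fst Z * cnj (fst W) / B Z W powr of_real b"
  have "1 - \<rho> Z \<le> norm (1 - ?q)"
    using quotient_bound[OF Z W] norm_triangle_ineq2[of 1 ?q] by simp
  then have sq: "(1 - \<rho> Z)\<^sup>2 \<le> (norm (1 - ?q))\<^sup>2"
    using \<rho>_bounds[OF Z] by (intro power_mono) auto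
  have "norm (kern Z W) = 1 / (4 * pi\<^sup>2) * norm (B Z W) powr (- 1 - b) / (norm (1 - ?q))\<^sup>2"
    unfolding kern_alt norm_divide norm_mult norm_B_powr norm_power by (simp add: norm_divide norm_mult norm_power)
  also have "\<dots> \<le> 1 / (4 * pi\<^sup>2) * norm (B Z W) powr (- 1 - b) / (1 - \<rho> Z)\<^sup>2"
    using \<rho>_bounds[OF Z] by (intro frac_le sq) auto
  finally show ?thesis by (simp add: mult_ac)
qed

text \<open>An integrable majorant with separated variables for the squared kernel. The factor in
  the real variable has exponent below \<open>- 1\<close>; the other one integrates to a Bergman
  integral with \<open>r = 1\<close>.\<close>

definition dom :: "complex \<times> real \<Rightarrow> real" where
  "dom x = (1 + \<bar>snd x\<bar>) powr (- 1 - b) * (1 + p (fst x)) powr (- 1 - b)"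

lemma dom_integrable: "integrable lborel dom"
proof -
  have sm: "(\<lambda>s::real. ennreal ((1 + \<bar>s\<bar>) powr (- 1 - b))) \<in> borel_measurable borel" by measurable
  have m: "(\<lambda>x. ennreal (dom x)) \<in> borel_measurable (lborel \<Otimes>\<^sub>M lborel)"
    unfolding dom_def by measurable
  then have m': "dom \<in> borel_measurable (lborel \<Otimes>\<^sub>M lborel)"
    unfolding dom_def by measurable
  let ?S = "\<integral>\<^sup>+s. ennreal ((1 + \<bar>s\<bar>) powr (- 1 - b)) \<partial>lborel"
  let ?P = "\<integral>\<^sup>+w. ennreal ((1 + p (w::complex)) powr (- 1 - b)) \<partial>lborel"
  have "(\<integral>\<^sup>+x. ennreal (dom x) \<partial>(lborel \<Otimes>\<^sub>M lborel)) = (\<integral>\<^sup>+w. \<integral>\<^sup>+s. ennreal (dom (w, s)) \<partial>lborel \<partial>lborel)"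
    using m by (intro lborel.nn_integral_fst[symmetric])
  also have "\<dots> = (\<integral>\<^sup>+w. ?S * ennreal ((1 + p w) powr (- 1 - b)) \<partial>lborel)"
    using sm by (simp add: dom_def ennreal_mult nn_integral_multc)
  also have "\<dots> = ?S * ?P" by (intro nn_integral_cmult) measurable
  also have "\<dots> < \<infinity>"
  proof -
    have "?P = (\<integral>\<^sup>+v. ennreal ((1 + v) powr (- 1 - b)) \<partial>distr (lborel :: complex measure) borel p)"
      by (subst nn_integral_distr) auto
    also have "\<dots> = (\<integral>\<^sup>+v. ennreal (indicator {0<..} v * (2 * pi / \<alpha> * v powr (b - 1))) * ennreal ((1 + v) powr (- 1 - b)) \<partial>lborel)"
      unfolding distr_norm_powr_complex[OF pos] b_def by (subst nn_integral_density) auto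
    also have "\<dots> = (\<integral>\<^sup>+v. ennreal (2 * pi / \<alpha> * (indicator {0<..} v *\<^sub>R (v powr (b - 1) * (1 + v) powr (- b - 1)))) \<partial>lborel)"
      using pos by (intro nn_integral_cong) (auto simp: ennreal_mult[symmetric] mult_ac minus_diff_commute split: split_indicator)
    also have "\<dots> = ennreal (\<integral>v. 2 * pi / \<alpha> * (indicator {0<..} v *\<^sub>R (v powr (b - 1) * (1 + v) powr (- b - 1))) \<partial>lborel)"
      using Bergman_integral_real(1)[of 1 b, unfolded set_integrable_def] b_pos pos
      by (intro nn_integral_eq_integral integrable_mult_right) auto
    finally have "?P < \<infinity>" by simp
    then show ?thesis using nn_integral_one_plus_abs_powr_finite[OF b_pos] by (simp add: ennreal_mult_less_top)
  qed
  finally have "(\<integral>\<^sup>+x. ennreal (dom x) \<partial>(lborel \<Otimes>\<^sub>M lborel)) < \<infinity>" .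
  moreover have "dom x \<ge> 0" for x by (simp add: dom_def)
  ultimately have "integrable (lborel \<Otimes>\<^sub>M lborel) dom"
    using m' by (intro integrableI_bounded) auto
  then show ?thesis by (simp add: lborel_prod)
qed

lemma norm_B_ge:
  assumes Z: "Im (snd Z) > 0"
  obtains k where "k > 0" "\<And>x y. y \<ge> 0 \<Longrightarrow> k * (1 + \<bar>snd x\<bar>) \<le> norm (B Z (lift_pt p y x))"
    "\<And>x y. y \<ge> 0 \<Longrightarrow> k * (1 + p (fst x)) \<le> norm (B Z (lift_pt p y x))"
proof -
  define m where "m = min (Im (snd Z)) 1 / 2"
  have m: "m > 0" using Z by (simp add: m_def)
  \<comment> \<open>The imaginary part of \<open>B\<close> is half the difference of the real
    coordinates, whence the summand 2; the first summand absorbs the constant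
    \<open>1 + \<bar>Re (snd Z)\<bar>\<close>, as the modulus of \<open>B\<close> is at least
    \<open>m\<close>.\<close>
  define M where "M = (1 + \<bar>Re (snd Z)\<bar>) / m + 2"
  have M: "M > 0" using m by (auto simp: M_def intro: add_nonneg_pos)
  have 1: "m * (1 + p (fst x)) \<le> norm (B Z (lift_pt p y x))" if y: "y \<ge> 0" for x y
  proof -
    have "m * (1 + p (fst x)) = m + m * p (fst x)" by (simp add: algebra_simps)
    also have "\<dots> \<le> Im (snd Z) / 2 + 1 / 2 * p (fst x)"
      using p_nonneg[of "fst x"] by (intro add_mono mult_right_mono) (auto simp: m_def)
    also have "\<dots> \<le> Re (B Z (lift_pt p y x))"
      unfolding Re_B using y by (simp add: lift_pt_def)
    also have "\<dots> \<le> norm (B Z (lift_pt p y x))" by (rule complex_Re_le_cmod)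
    finally show ?thesis .
  qed
  have 2: "1 / M * (1 + \<bar>snd x\<bar>) \<le> norm (B Z (lift_pt p y x))" if y: "y \<ge> 0" for x y
  proof -
    let ?N = "norm (B Z (lift_pt p y x))"
    have "m * 1 \<le> m * (1 + p (fst x))" using m p_nonneg[of "fst x"] by (intro mult_left_mono) auto
    also have "\<dots> \<le> ?N" by (rule 1[OF y])
    finally have "(1 + \<bar>Re (snd Z)\<bar>) / m * m \<le> (1 + \<bar>Re (snd Z)\<bar>) / m * ?N"
      using m by (intro mult_left_mono) auto
    then have a: "1 + \<bar>Re (snd Z)\<bar> \<le> (1 + \<bar>Re (snd Z)\<bar>) / m * ?N" using m by simp
    have "\<bar>snd x\<bar> \<le> \<bar>Re (snd Z)\<bar> + 2 * \<bar>Im (B Z (lift_pt p y x))\<bar>"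
      unfolding Im_B by (simp add: lift_pt_def)
    also have "\<dots> \<le> \<bar>Re (snd Z)\<bar> + 2 * ?N" using abs_Im_le_cmod by (intro add_left_mono) simp
    finally have "1 + \<bar>snd x\<bar> \<le> M * ?N" using a by (simp add: M_def distrib_right)
    then show ?thesis using M by (simp add: field_simps)
  qed
  show ?thesis
  proof
    show "min m (1 / M) > 0" using m M by simp
    fix x :: "complex \<times> real" and y :: real assume y: "y \<ge> 0"
    have "min m (1 / M) * (1 + \<bar>snd x\<bar>) \<le> 1 / M * (1 + \<bar>snd x\<bar>)" by (intro mult_right_mono) auto
    with 2[OF y] show "min m (1 / M) * (1 + \<bar>snd x\<bar>) \<le> norm (B Z (lift_pt p y x))" by (rule order_trans[rotated])
    have "min m (1 / M) * (1 + p (fst x)) \<le> m * (1 + p (fst x))"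
      using p_nonneg[of "fst x"] by (intro mult_right_mono) auto
    with 1[OF y] show "min m (1 / M) * (1 + p (fst x)) \<le> norm (B Z (lift_pt p y x))" by (rule order_trans[rotated])
  qed
qed

text \<open>The square splits into two equal powers; the imaginary part of \<open>B\<close> pays for
  decay in the real variable with one of them, the real part for decay in the complex variable with
  the other.\<close>

lemma norm_B_powr_le_dom:
  assumes Z: "Im (snd Z) > 0"
  obtains D where "D \<ge> 0" "\<And>x y. y \<ge> 0 \<Longrightarrow> (norm (B Z (lift_pt p y x)) powr (- 1 - b))\<^sup>2 \<le> D * dom x"
proof -
  obtain k where k: "k > 0" "\<And>x y. y \<ge> 0 \<Longrightarrow> k * (1 + \<bar>snd x\<bar>) \<le> norm (B Z (lift_pt p y x))"
    "\<And>x y. y \<ge> 0 \<Longrightarrow> k * (1 + p (fst x)) \<le> norm (B Z (lift_pt p y x))"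
    using norm_B_ge[OF Z] by blast
  show ?thesis
  proof
    show "(k powr (- 1 - b))\<^sup>2 \<ge> 0" by simp
    fix x :: "complex \<times> real" and y :: real assume y: "y \<ge> 0"
    let ?N = "norm (B Z (lift_pt p y x))"
    have nb: "- 1 - b \<le> 0" using b_pos by simp
    have q: "1 + \<bar>snd x\<bar> > 0" "1 + p (fst x) > 0" using p_nonneg[of "fst x"] by linarith+
    have "?N powr (- 1 - b) \<le> (k * (1 + \<bar>snd x\<bar>)) powr (- 1 - b)"
      using k q by (intro powr_mono2' nb k(2)[OF y] mult_pos_pos)
    moreover have "?N powr (- 1 - b) \<le> (k * (1 + p (fst x))) powr (- 1 - b)"
      using k q by (intro powr_mono2' nb k(3)[OF y] mult_pos_pos)
    ultimately have "?N powr (- 1 - b) * ?N powr (- 1 - b) \<le> (k * (1 + \<bar>snd x\<bar>)) powr (- 1 - b) * (k * (1 + p (fst x))) powr (- 1 - b)"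
      by (intro mult_mono) auto
    also have "\<dots> = (k powr (- 1 - b))\<^sup>2 * dom x"
      using k q by (simp add: powr_mult dom_def power2_eq_square mult_ac)
    finally show "(?N powr (- 1 - b))\<^sup>2 \<le> (k powr (- 1 - b))\<^sup>2 * dom x"
      by (simp add: power2_eq_square)
  qed
qed

lemma kern_sq_le_dom:
  assumes Z: "Z \<in> Omega p"
  obtains D where "D \<ge> 0" "\<And>x y. y \<ge> 0 \<Longrightarrow> (norm (kern Z (lift_pt p y x)))\<^sup>2 \<le> D * dom x"
proof -
  obtain D where D: "D \<ge> 0" "\<And>x y. y \<ge> 0 \<Longrightarrow> (norm (B Z (lift_pt p y x)) powr (- 1 - b))\<^sup>2 \<le> D * dom x"
    using norm_B_powr_le_dom[OF Omega_D(2)[OF Z]] by blast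
  let ?c = "1 / (4 * pi\<^sup>2 * (1 - \<rho> Z)\<^sup>2)"
  show ?thesis
  proof
    show "?c\<^sup>2 * D \<ge> 0" using D by simp
    fix x :: "complex \<times> real" and y :: real assume y: "y \<ge> 0"
    have "norm (kern Z (lift_pt p y x)) \<le> ?c * norm (B Z (lift_pt p y x)) powr (- 1 - b)"
      using y by (intro kern_bound[OF Z]) (simp add: lift_pt_def)
    then have "(norm (kern Z (lift_pt p y x)))\<^sup>2 \<le> (?c * norm (B Z (lift_pt p y x)) powr (- 1 - b))\<^sup>2"
      by (intro power_mono) auto
    also have "\<dots> \<le> ?c\<^sup>2 * (D * dom x)"
      unfolding power_mult_distrib using D(2)[OF y] by (intro mult_left_mono) auto
    finally show "(norm (kern Z (lift_pt p y x)))\<^sup>2 \<le> ?c\<^sup>2 * D * dom x" by simp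
  qed
qed

lemma lift_pt_closed: "y \<ge> 0 \<Longrightarrow> Im (snd (lift_pt p y x)) \<ge> p (fst (lift_pt p y x))"
  by (simp add: lift_pt_def)

lemma lift_pt_tendsto: "((\<lambda>y. lift_pt p y x) \<longlongrightarrow> lift_pt p 0 x) (at_right 0)"
  unfolding lift_pt_def Complex_eq by (intro tendsto_intros)

lemma kern_lift_measurable:
  assumes Z: "Z \<in> Omega p" and y: "y \<ge> 0"
  shows "(\<lambda>x. kern Z (lift_pt p y x)) \<in> borel_measurable borel"
proof (rule borel_measurable_continuous_onI)
  have c: "continuous_on UNIV (lift_pt p y)"
    unfolding lift_pt_def Complex_eq by (intro continuous_intros continuous_on_compose2[OF p_cont]) auto
  have "(lift_pt p y \<longlongrightarrow> lift_pt p y x) (at x within UNIV)" for x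
    using c unfolding continuous_on_def by blast
  then show "continuous_on UNIV (\<lambda>x. kern Z (lift_pt p y x))"
    unfolding continuous_on_def
    by (intro ballI kern_tendsto good_interior(1)[OF Z] lift_pt_closed y tendsto_const)
qed

text \<open>The element representing evaluation at \<open>Z\<close>. The conjugate compensates for
  the one in \<open>L2_inner\<close>.\<close>

definition kZ :: "complex \<times> complex \<Rightarrow> complex \<times> real \<Rightarrow> complex" where
  "kZ Z x = cnj (kern Z (lift_pt p 0 x))"

lemma kern_holomorphic2:
  assumes Z: "Z \<in> Omega p"
  shows "holomorphic2_on (\<lambda>W. kern W Z) (Omega p)"
proof (rule holomorphic2_on_Osgood)
  show "open (Omega p)" by (rule open_Omega[OF p_cont])
  have g: "good W Z" if "W \<in> Omega p" for W
    using good_interior(2)[OF Z, of W] Omega_D[OF that] by simp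
  show "continuous_on (Omega p) (\<lambda>W. kern W Z)"
    unfolding continuous_on_def using g by (auto intro!: kern_tendsto)
  fix a c assume ac: "(a, c) \<in> Omega p"
  have n: "B (a, c) Z \<notin> \<real>\<^sub>\<le>\<^sub>0" and n1: "B (a, c) Z \<noteq> 0" using g[OF ac] by (auto simp: good_def)
  have n2: "1 - a * cnj (fst Z) / B (a, c) Z powr of_real b \<noteq> 0"
    using g[OF ac] n1 by (simp add: good_def)
  have f: "(\<lambda>\<sigma>. B (a, \<sigma>) Z) field_differentiable at c"
    unfolding B_def snd_conv by (auto intro!: derivative_intros)
  define \<beta> where "\<beta> = B (a, c) Z"
  have \<beta>: "B (w, c) Z = \<beta>" for w by (simp add: \<beta>_def B_def)
  have n3: "1 - a * cnj (fst Z) / \<beta> powr of_real b \<noteq> 0" using n2 by (simp add: \<beta>_def)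
  show "(\<lambda>w. kern (w, c) Z) field_differentiable at a"
    unfolding kern_alt fst_conv \<beta> using n3 n1[folded \<beta>_def] by (auto intro!: derivative_intros)
  have d: "(\<lambda>\<sigma>. B (a, \<sigma>) Z powr of_real e) field_differentiable at c" for e
  proof -
    have "(\<lambda>x. x powr of_real e) field_differentiable at (B (a, c) Z)"
      using has_field_derivative_powr[OF n] by (auto simp: field_differentiable_def)
    from field_differentiable_compose[OF f this] show ?thesis by (simp only: o_def)
  qed
  show "(\<lambda>\<sigma>. kern (a, \<sigma>) Z) field_differentiable at c"
    unfolding kern_alt fst_conv
    by (intro field_differentiable_divide field_differentiable_mult field_differentiable_const
        field_differentiable_power field_differentiable_diff d) (use n2 n1 in auto)
qed

text \<open>Hermitian symmetry makes the conjugated kernel the boundary function of the kernel in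
  its first argument. The majorant \<open>dom\<close> works for all heights simultaneously, so
  bounded slices and convergence at the boundary both follow by domination.\<close>

lemma kZ_hardy:
  assumes Z: "Z \<in> Omega p"
  shows "kZ Z \<in> L2" "hardy_extension p (kZ Z) (\<lambda>W. kern W Z)"
proof -
  obtain D where D: "D \<ge> 0" "\<And>x y. y \<ge> 0 \<Longrightarrow> (norm (kern Z (lift_pt p y x)))\<^sup>2 \<le> D * dom x"
    using kern_sq_le_dom[OF Z] by blast
  have dm[measurable]: "dom \<in> borel_measurable borel" using dom_integrable by auto
  have Dint: "(\<integral>\<^sup>+x. ennreal (c * D * dom x) \<partial>lborel) < \<infinity>" if "c \<ge> 0" for c
  proof -
    have "integrable lborel (\<lambda>x. c * D * dom x)" using dom_integrable by (rule integrable_mult_right)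
    then show ?thesis using nn_integral_eq_integral[of lborel "\<lambda>x. c * D * dom x"] that D(1) by (simp add: dom_def)
  qed
  have km: "kZ Z \<in> borel_measurable borel"
    unfolding kZ_def using kern_lift_measurable[OF Z, of 0] by measurable
  have n0: "(norm (kZ Z x))\<^sup>2 \<le> D * dom x" for x
    using D(2)[of 0 x] by (simp add: kZ_def)
  have "sq_int (kZ Z) \<le> (\<integral>\<^sup>+x. ennreal (1 * D * dom x) \<partial>lborel)"
    using n0 by (intro nn_integral_mono ennreal_leI) simp
  also have "\<dots> < \<infinity>" by (rule Dint) simp
  finally show "kZ Z \<in> L2" using km by (simp add: L2_iff)
  have eqn: "kern (lift_pt p y x) Z = cnj (kern Z (lift_pt p y x))" if "y \<ge> 0" for x y
    using kern_cnj[of Z "lift_pt p y x"] good_interior(1)[OF Z lift_pt_closed[OF that]] by (simp add: good_def)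
  have ny: "(norm (kern (lift_pt p y x) Z))\<^sup>2 \<le> D * dom x" if "y \<ge> 0" for x y
    using D(2)[OF that] by (simp add: eqn[OF that])
  show "hardy_extension p (kZ Z) (\<lambda>W. kern W Z)"
    unfolding hardy_extension_def
  proof (intro conjI)
    show "holomorphic2_on (\<lambda>W. kern W Z) (Omega p)" by (rule kern_holomorphic2[OF Z])
    have "(SUP y\<in>{0<..}. sq_int (\<lambda>x. kern (lift_pt p y x) Z)) \<le> (\<integral>\<^sup>+x. ennreal (1 * D * dom x) \<partial>lborel)"
      using ny by (intro SUP_least nn_integral_mono ennreal_leI) simp
    also have "\<dots> < \<infinity>" by (rule Dint) simp
    finally show "(SUP y\<in>{0<..}. sq_int (\<lambda>x. kern (lift_pt p y x) Z)) < \<infinity>" .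
    show "((\<lambda>y. sq_int (\<lambda>x. kern (lift_pt p y x) Z - kZ Z x)) \<longlongrightarrow> 0) (at_right 0)"
    proof (rule nn_integral_tendsto_0_at_right[where w = "\<lambda>x. ennreal (4 * D * dom x)"])
      show "(\<integral>\<^sup>+x. ennreal (4 * D * dom x) \<partial>lborel) < \<infinity>" by (rule Dint) simp
      fix y :: real assume y: "y > 0"
      have [measurable]: "(\<lambda>x. kern Z (lift_pt p y x)) \<in> borel_measurable borel"
        using kern_lift_measurable[OF Z, of y] y by simp
      show "(\<lambda>x. ennreal ((norm (kern (lift_pt p y x) Z - kZ Z x))\<^sup>2)) \<in> borel_measurable lborel"
        using km y by (simp add: eqn)
      fix x
      have "(norm (kern (lift_pt p y x) Z - kZ Z x))\<^sup>2 \<le> (norm (kern (lift_pt p y x) Z) + norm (kZ Z x))\<^sup>2"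
        by (intro power_mono norm_triangle_ineq4) auto
      also have "\<dots> \<le> 2 * (norm (kern (lift_pt p y x) Z))\<^sup>2 + 2 * (norm (kZ Z x))\<^sup>2"
        using sum_squares_bound[of "norm (kern (lift_pt p y x) Z)" "norm (kZ Z x)"] by (simp add: power2_sum)
      also have "\<dots> \<le> 4 * D * dom x" using ny[of y x] n0[of x] y by simp
      finally show "ennreal ((norm (kern (lift_pt p y x) Z - kZ Z x))\<^sup>2) \<le> ennreal (4 * D * dom x)"
        by (rule ennreal_leI)
    next
      fix x
      have "((\<lambda>y. kern (lift_pt p y x) Z) \<longlongrightarrow> kern (lift_pt p 0 x) Z) (at_right 0)"
        by (intro kern_tendsto lift_pt_tendsto tendsto_const good_interior(2)[OF Z] lift_pt_closed) simp
      moreover have "kern (lift_pt p 0 x) Z = kZ Z x" by (simp add: eqn kZ_def)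
      ultimately have "((\<lambda>y. ennreal ((norm (kern (lift_pt p y x) Z - kZ Z x))\<^sup>2)) \<longlongrightarrow> ennreal ((norm (kZ Z x - kZ Z x))\<^sup>2)) (at_right 0)"
        by (intro tendsto_ennrealI tendsto_intros) auto
      then show "((\<lambda>y. ennreal ((norm (kern (lift_pt p y x) Z - kZ Z x))\<^sup>2)) \<longlongrightarrow> 0) (at_right 0)" by simp
    qed simp
  qed
qed

end

section \<open>The reproducing property\<close>

lemma holomorphic2_on_divide:
  assumes U: "open U" and F: "holomorphic2_on F U" and G: "holomorphic2_on G U" and nz: "\<And>Z. Z \<in> U \<Longrightarrow> G Z \<noteq> 0"
  shows "holomorphic2_on (\<lambda>Z. F Z / G Z) U"
proof (rule holomorphic2_on_Osgood[OF U])
  show "continuous_on U (\<lambda>Z. F Z / G Z)"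
    using nz by (intro continuous_on_divide holomorphic2_on_imp_continuous_on[OF F] holomorphic2_on_imp_continuous_on[OF G]) auto
  show "(\<lambda>w. F (w, c) / G (w, c)) field_differentiable at a" if "(a, c) \<in> U" for a c
    using nz[OF that] by (intro field_differentiable_divide holomorphic2_on_slices(1)[OF F that] holomorphic2_on_slices(1)[OF G that])
  show "(\<lambda>\<sigma>. F (a, \<sigma>) / G (a, \<sigma>)) field_differentiable at c" if "(a, c) \<in> U" for a c
    using nz[OF that] by (intro field_differentiable_divide holomorphic2_on_slices(2)[OF F that] holomorphic2_on_slices(2)[OF G that])
qed

lemma holomorphic2_on_snd_affine:
  assumes U: "open U"
  shows "holomorphic2_on (\<lambda>Z. 1 - c * snd Z) U"
proof (rule holomorphic2_on_Osgood[OF U])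
  show "continuous_on U (\<lambda>Z. 1 - c * snd Z)" by (intro continuous_intros)
qed (auto intro!: derivative_intros)

lemma powr_power_complex:
  fixes x :: complex
  assumes "x \<noteq> 0"
  shows "(x powr u) ^ n = x powr (of_nat n * u)"
  using assms by (simp add: powr_def exp_of_nat_mult[symmetric] mult.assoc)

definition taylor_coeff :: "(complex \<times> complex \<Rightarrow> complex) \<Rightarrow> nat \<Rightarrow> complex \<Rightarrow> complex" where
  "taylor_coeff G n \<sigma> = (deriv ^^ n) (\<lambda>w. G (w, \<sigma>)) 0 / fact n"

section \<open>Taylor coefficients in the first variable\<close>

context pow_weight
begin

lemma Omega_slice_ball:
  assumes "Im \<sigma> > 0" "w \<in> ball 0 (Im \<sigma> powr (1 / \<alpha>))"
  shows "(w, \<sigma>) \<in> Omega p"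
proof -
  have "p w < (Im \<sigma> powr (1 / \<alpha>)) powr \<alpha>"
    using assms pos by (intro powr_less_mono2) auto
  also have "\<dots> = Im \<sigma>" using assms pos by (simp add: powr_powr)
  finally show ?thesis by (simp add: Omega_def)
qed

lemma slice_holomorphic:
  assumes G: "holomorphic2_on G (Omega p)" and "Im \<sigma> > 0"
  shows "(\<lambda>w. G (w, \<sigma>)) holomorphic_on ball 0 (Im \<sigma> powr (1 / \<alpha>))"
  using Omega_slice_ball[OF assms(2)] by (intro holomorphic2_on_slice1[OF G]) auto

lemma taylor_coeff_sums:
  assumes G: "holomorphic2_on G (Omega p)" and Z: "(z, \<sigma>) \<in> Omega p"
  shows "(\<lambda>n. taylor_coeff G n \<sigma> * z ^ n) sums G (z, \<sigma>)"
proof -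
  have s: "Im \<sigma> > 0" "p z < Im \<sigma>" using Omega_D[OF Z] by auto
  have "norm z = p z powr (1 / \<alpha>)" using pos by (simp add: powr_powr)
  also have "\<dots> < Im \<sigma> powr (1 / \<alpha>)" using s pos by (intro powr_less_mono2) auto
  finally have "z \<in> ball 0 (Im \<sigma> powr (1 / \<alpha>))" by simp
  from holomorphic_power_series[OF slice_holomorphic[OF G s(1)] this] show ?thesis
    by (simp add: taylor_coeff_def)
qed

lemma circle_mean_taylor_coeff:
  assumes G: "holomorphic2_on G (Omega p)" and w: "w \<noteq> 0" "p w < Im \<sigma>"
  shows "circle_mean (\<lambda>\<zeta>. cnj \<zeta> ^ n * G (\<zeta>, \<sigma>)) w = of_real (norm w) ^ (2 * n) * taylor_coeff G n \<sigma>"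
proof -
  have s: "Im \<sigma> > 0" using le_less_trans[OF p_nonneg w(2)] .
  have "norm w = p w powr (1 / \<alpha>)" using pos by (simp add: powr_powr)
  also have "\<dots> < Im \<sigma> powr (1 / \<alpha>)" using w pos by (intro powr_less_mono2) auto
  finally show ?thesis
    using circle_mean_Taylor[OF slice_holomorphic[OF G s], of w n] w(1) by (simp add: taylor_coeff_def)
qed

text \<open>A circle on which \<open>p = e / 2\<close> lies in the domain for every second
  coordinate of imaginary part above \<open>e\<close>. The coefficient is an integral over this
  fixed circle and can be differentiated under the integral sign.\<close>

lemma taylor_coeff_holomorphic:
  assumes G: "holomorphic2_on G (Omega p)" and e: "e > 0"
  shows "taylor_coeff G n holomorphic_on {\<sigma>. Im \<sigma> > e}"
proof -
  define r where "r = (e / 2) powr (1 / \<alpha>)"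
  have r: "r > 0" using e by (simp add: r_def)
  have pr: "p (cis \<theta> * of_real r) = e / 2" for \<theta>
    using e pos by (simp add: norm_mult r_def powr_powr)
  let ?U = "{\<sigma>. Im \<sigma> > e}"
  have U: "open ?U" "convex ?U" by (auto intro: open_halfspace_Im_gt convex_halfspace_Im_gt)
  have inO: "(cis \<theta> * of_real r, \<sigma>) \<in> Omega p" if "\<sigma> \<in> ?U" for \<theta> \<sigma>
    using that pr[of \<theta>] e by (simp add: Omega_def)
  let ?c = "\<lambda>\<theta>. cnj (cis \<theta> * of_real r) ^ n"
  let ?f = "\<lambda>\<sigma> \<theta>. ?c \<theta> * G (cis \<theta> * of_real r, \<sigma>)"
  have contG: "continuous_on (Omega p) G" using G by (rule holomorphic2_on_imp_continuous_on)
  have cont: "continuous_on {0..2*pi} (?f \<sigma>)" if "\<sigma> \<in> ?U" for \<sigma>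
    using inO[OF that] by (intro continuous_intros continuous_on_compose2[OF contG]) auto
  have eq: "taylor_coeff G n \<sigma> = integral (cbox 0 (2*pi)) (?f \<sigma>) / (2 * pi) / of_real r ^ (2 * n)" if s: "\<sigma> \<in> ?U" for \<sigma>
  proof -
    have "of_real (norm (of_real r :: complex)) ^ (2 * n) * taylor_coeff G n \<sigma> = circle_mean (\<lambda>\<zeta>. cnj \<zeta> ^ n * G (\<zeta>, \<sigma>)) (of_real r)"
      using r pr[of 0] s e by (intro circle_mean_taylor_coeff[OF G, symmetric]) auto
    also have "\<dots> = (LBINT \<theta>:{0..2*pi}. ?f \<sigma> \<theta>) / (2 * pi)"
      by (simp add: circle_mean_def)
    also have "(LBINT \<theta>:{0..2*pi}. ?f \<sigma> \<theta>) = integral {0..2*pi} (?f \<sigma>)"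
      by (intro set_borel_integral_eq_integral(2) borel_integrable_atLeastAtMost' cont s)
    finally show ?thesis using r by (simp add: field_simps)
  qed
  have "(\<lambda>\<sigma>. integral (cbox 0 (2*pi)) (?f \<sigma>)) holomorphic_on ?U"
  proof (rule leibniz_rule_holomorphic)
    let ?d = "\<lambda>w \<sigma>. deriv (\<lambda>\<sigma>. G (w, \<sigma>)) \<sigma>"
    show "((\<lambda>\<sigma>. ?f \<sigma> \<theta>) has_field_derivative ?c \<theta> * ?d (cis \<theta> * of_real r) \<sigma>) (at \<sigma> within ?U)" if "\<sigma> \<in> ?U" for \<sigma> \<theta>
      using holomorphic2_on_slices(2)[OF G inO[OF that]]
      by (intro DERIV_cmult has_field_derivative_at_within[OF field_differentiable_derivI]) auto
    show "?f \<sigma> integrable_on cbox 0 (2*pi)" if "\<sigma> \<in> ?U" for \<sigma>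
      using cont[OF that] by (simp add: integrable_continuous_interval)
    have dc: "continuous_on (Omega p) (\<lambda>(w, \<sigma>). ?d w \<sigma>)"
      using isCont_deriv_snd[OF open_Omega[OF p_cont] contG _ holomorphic2_on_slices(2)[OF G]]
      by (auto intro!: continuous_at_imp_continuous_on)
    have "continuous_on (?U \<times> cbox 0 (2*pi)) (\<lambda>x. (\<lambda>(w, \<sigma>). ?d w \<sigma>) (cis (snd x) * of_real r, fst x))"
      using inO by (intro continuous_on_compose2[OF dc] continuous_intros) auto
    then show "continuous_on (?U \<times> cbox 0 (2*pi)) (\<lambda>(\<sigma>, \<theta>). ?c \<theta> * ?d (cis \<theta> * of_real r) \<sigma>)"
      unfolding case_prod_unfold by (intro continuous_intros) auto
  qed (rule U)
  then have "(\<lambda>\<sigma>. integral (cbox 0 (2*pi)) (?f \<sigma>) / (2 * pi) / of_real r ^ (2 * n)) holomorphic_on ?U"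
    using r by (intro holomorphic_intros) auto
  then show ?thesis
    by (rule holomorphic_transform) (use eq in auto)
qed

text \<open>Cauchy's inequality on a circle where \<open>p = e / 2\<close>: at imaginary part
  \<open>e\<close> a margin \<open>e / 2\<close> is left, for which the decay of \<open>G\<close> is
  available.\<close>

lemma taylor_coeff_bound:
  assumes G: "holomorphic2_on G (Omega p)" and e: "e > 0"
    and decay: "\<And>R e. e > 0 \<Longrightarrow> \<exists>C\<ge>0. \<forall>z \<sigma>. norm z \<le> R \<longrightarrow> Im \<sigma> \<ge> p z + e \<longrightarrow> norm (G (z, \<sigma>)) \<le> C / (1 + norm \<sigma>)"
  obtains C where "C \<ge> 0" "\<And>\<sigma>. Im \<sigma> \<ge> e \<Longrightarrow> norm (taylor_coeff G n \<sigma>) \<le> C / (1 + norm \<sigma>)"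
proof -
  define r where "r = (e / 2) powr (1 / \<alpha>)"
  have r: "r > 0" using e by (simp add: r_def)
  have pr: "p w = e / 2" if "norm w = r" for w
    using e pos that by (simp add: r_def powr_powr)
  obtain C where C: "C \<ge> 0" "\<And>z \<sigma>. norm z \<le> r \<Longrightarrow> Im \<sigma> \<ge> p z + e / 2 \<Longrightarrow> norm (G (z, \<sigma>)) \<le> C / (1 + norm \<sigma>)"
    using decay[of "e / 2" r] e by auto
  show ?thesis
  proof
    show "C / r ^ n \<ge> 0" using C r by simp
    fix \<sigma> assume s: "Im \<sigma> \<ge> e"
    have s0: "Im \<sigma> > 0" using s e by linarith
    have "r < Im \<sigma> powr (1 / \<alpha>)" unfolding r_def using s e pos by (intro powr_less_mono2) auto
    then have sub: "cball 0 r \<subseteq> ball 0 (Im \<sigma> powr (1 / \<alpha>))" by auto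
    have hol: "(\<lambda>w. G (w, \<sigma>)) holomorphic_on cball 0 r"
      using slice_holomorphic[OF G s0] sub by (rule holomorphic_on_subset)
    have "norm ((deriv ^^ n) (\<lambda>w. G (w, \<sigma>)) 0) \<le> fact n * (C / (1 + norm \<sigma>)) / r ^ n"
    proof (rule Cauchy_inequality)
      show "(\<lambda>w. G (w, \<sigma>)) holomorphic_on ball 0 r" using hol by (rule holomorphic_on_subset) auto
      show "continuous_on (cball 0 r) (\<lambda>w. G (w, \<sigma>))" using hol by (rule holomorphic_on_imp_continuous_on)
      show "norm (G (w, \<sigma>)) \<le> C / (1 + norm \<sigma>)" if "norm (0 - w) = r" for w
        using that s pr[of w] by (intro C) auto
    qed (rule r)
    note Cauchy = this
    have "norm (taylor_coeff G n \<sigma>) = norm ((deriv ^^ n) (\<lambda>w. G (w, \<sigma>)) 0) / fact n"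
      by (simp add: taylor_coeff_def norm_divide)
    also have "\<dots> \<le> fact n * (C / (1 + norm \<sigma>)) / r ^ n / fact n"
      by (rule divide_right_mono[OF Cauchy]) simp
    also have "\<dots> = C / r ^ n / (1 + norm \<sigma>)" by simp
    finally show "norm (taylor_coeff G n \<sigma>) \<le> C / r ^ n / (1 + norm \<sigma>)" .
  qed
qed

section \<open>Expansion of the kernel and termwise integration\<close>

definition kterm :: "complex \<times> complex \<Rightarrow> nat \<Rightarrow> complex \<times> complex \<Rightarrow> complex" where
  "kterm Z n W = of_real (1 / (4 * pi\<^sup>2)) * of_nat (Suc n) * (fst Z * cnj (fst W)) ^ n
     * B Z W powr of_real (- (real (Suc n) * b) - 1)"

lemma kterm_eq:
  assumes "B Z W \<noteq> 0"
  shows "kterm Z n W = of_real (1 / (4 * pi\<^sup>2)) * B Z W powr of_real (- 1 - b)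
     * (of_nat (Suc n) * (fst Z * cnj (fst W) / B Z W powr of_real b) ^ n)"
proof -
  have "B Z W powr of_real (- (real (Suc n) * b) - 1) = B Z W powr (of_real (- 1 - b) - of_nat n * of_real b)"
    by (rule arg_cong[where f = "\<lambda>u. B Z W powr u"]) (simp add: algebra_simps)
  also have "\<dots> = B Z W powr of_real (- 1 - b) / (B Z W powr of_real b) ^ n"
    unfolding powr_power_complex[OF assms] by (rule powr_diff)
  finally show ?thesis
    unfolding kterm_def by (simp add: power_divide)
qed

text \<open>Differentiated geometric series: the sum of \<open>(n + 1) * q ^ n\<close> is
  \<open>1 / (1 - q)^2\<close>, whence the exponent \<open>- 2\<close> of the kernel. In
  \<open>kterm\<close> the powers of \<open>B\<close> are collected to \<open>- \<beta> - 1\<close>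
  with \<open>\<beta> = (n + 1) * b\<close>, the exponent in
  \<open>halfplane_Bergman\<close>.\<close>

lemma kterm_sums:
  assumes Z: "Z \<in> Omega p" and W: "Im (snd W) \<ge> p (fst W)"
  shows "(\<lambda>n. kterm Z n W) sums kern Z W"
proof -
  have B0: "B Z W \<noteq> 0" using Re_B_pos[OF Z W] by auto
  let ?q = "fst Z * cnj (fst W) / B Z W powr of_real b"
  have "norm ?q < 1" using quotient_bound[OF Z W] \<rho>_bounds[OF Z] by linarith
  from geometric_deriv_sums[OF this]
  have "(\<lambda>n. of_real (1 / (4 * pi\<^sup>2)) * B Z W powr of_real (- 1 - b) * (of_nat (Suc n) * ?q ^ n))
    sums (of_real (1 / (4 * pi\<^sup>2)) * B Z W powr of_real (- 1 - b) * (1 / (1 - ?q)\<^sup>2))"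
    by (rule sums_mult)
  then show ?thesis
    unfolding kern_alt kterm_eq[OF B0] by simp
qed

lemma norm_kterm_le:
  assumes Z: "Z \<in> Omega p" and W: "Im (snd W) \<ge> p (fst W)"
  shows "norm (kterm Z n W) \<le> real (Suc n) * \<rho> Z ^ n * norm (B Z W) powr (- 1 - b)"
proof -
  have B0: "B Z W \<noteq> 0" using Re_B_pos[OF Z W] by auto
  let ?q = "fst Z * cnj (fst W) / B Z W powr of_real b"
  have "norm (kterm Z n W) = 1 / (4 * pi\<^sup>2) * norm (B Z W) powr (- 1 - b) * (real (Suc n) * norm ?q ^ n)"
    unfolding kterm_eq[OF B0] norm_mult norm_B_powr norm_power norm_of_nat norm_of_real by simp
  also have "\<dots> \<le> 1 * norm (B Z W) powr (- 1 - b) * (real (Suc n) * \<rho> Z ^ n)"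
  proof (intro mult_mono mult_left_mono power_mono quotient_bound[OF Z W])
    have "1 \<le> pi" using pi_gt3 by simp
    then have "1 \<le> pi\<^sup>2" by (simp add: one_le_power)
    then show "1 / (4 * pi\<^sup>2) \<le> 1" by simp
  qed auto
  finally show ?thesis by (simp add: mult_ac)
qed

lemma lift_pt_0_measurable [measurable]: "(\<lambda>x. B Z (lift_pt p 0 x)) \<in> borel_measurable borel"
  unfolding B_def lift_pt_def Complex_eq snd_conv
  by (intro borel_measurable_continuous_onI continuous_intros continuous_on_compose2[OF p_cont]) auto

lemma B_powr_L2:
  assumes Z: "Z \<in> Omega p"
  shows "(\<lambda>x. of_real (norm (B Z (lift_pt p 0 x)) powr (- 1 - b))) \<in> L2"
proof -
  obtain D where D: "D \<ge> 0" "\<And>x y. y \<ge> 0 \<Longrightarrow> (norm (B Z (lift_pt p y x)) powr (- 1 - b))\<^sup>2 \<le> D * dom x"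
    using norm_B_powr_le_dom[OF Omega_D(2)[OF Z]] by blast
  have "integrable lborel (\<lambda>x. (norm (B Z (lift_pt p 0 x)) powr (- 1 - b))\<^sup>2)"
  proof (rule Bochner_Integration.integrable_bound)
    show "integrable lborel (\<lambda>x. D * dom x)" using dom_integrable by (rule integrable_mult_right)
    show "AE x in lborel. norm ((norm (B Z (lift_pt p 0 x)) powr (- 1 - b))\<^sup>2) \<le> norm (D * dom x)"
      using D(2)[of 0] by (intro AE_I2) (auto intro: order_trans[OF _ abs_ge_self])
  qed measurable
  then show ?thesis unfolding L2_def by simp
qed

lemma B_powr_mult_integrable:
  assumes Z: "Z \<in> Omega p" and h: "h \<in> L2"
  shows "integrable lborel (\<lambda>x. norm (B Z (lift_pt p 0 x)) powr (- 1 - b) * norm (h x))"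
  using integrable_norm[OF L2_integrable_inner[OF B_powr_L2[OF Z] h]] by (simp add: norm_mult)

lemma kterm_measurable [measurable]: "(\<lambda>x. kterm Z n (lift_pt p 0 x)) \<in> borel_measurable borel"
proof -
  have "(\<lambda>x::complex \<times> real. (fst Z * cnj (fst x)) ^ n) \<in> borel_measurable borel"
    by (intro borel_measurable_continuous_onI continuous_intros)
  then have [measurable]: "(\<lambda>x. (fst Z * cnj (fst (lift_pt p 0 x))) ^ n) \<in> borel_measurable borel"
    by (simp add: lift_pt_def)
  show ?thesis unfolding kterm_def by measurable
qed

lemma kterm_mult_bound:
  assumes Z: "Z \<in> Omega p"
  shows "norm (kterm Z n (lift_pt p 0 x) * u)
    \<le> real (Suc n) * \<rho> Z ^ n * (norm (B Z (lift_pt p 0 x)) powr (- 1 - b) * norm u)"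
  using mult_right_mono[OF norm_kterm_le[OF Z lift_pt_closed[of 0 x], of n] norm_ge_zero[of u]]
  by (simp add: norm_mult mult.assoc)

lemma kterm_mult_integrable:
  assumes Z: "Z \<in> Omega p" and h: "h \<in> L2"
  shows "integrable lborel (\<lambda>x. kterm Z n (lift_pt p 0 x) * h x)"
proof (rule Bochner_Integration.integrable_bound)
  have [measurable]: "h \<in> borel_measurable borel" using h by (rule L2_D)
  show "(\<lambda>x. kterm Z n (lift_pt p 0 x) * h x) \<in> borel_measurable lborel" by measurable
  show "integrable lborel (\<lambda>x. real (Suc n) * \<rho> Z ^ n * (norm (B Z (lift_pt p 0 x)) powr (- 1 - b) * norm (h x)))"
    by (intro integrable_mult_right B_powr_mult_integrable Z h)
  show "AE x in lborel. norm (kterm Z n (lift_pt p 0 x) * h x)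
      \<le> norm (real (Suc n) * \<rho> Z ^ n * (norm (B Z (lift_pt p 0 x)) powr (- 1 - b) * norm (h x)))"
    using order_trans[OF kterm_mult_bound[OF Z] abs_ge_self] by (intro AE_I2) simp
qed

text \<open>On the boundary \<open>B Z\<close> depends on \<open>w\<close> only through
  \<open>p w\<close>, so the angular mean acts on \<open>cnj w ^ n * G\<close> alone and yields a
  Taylor coefficient. The remaining power of \<open>norm w\<close> and the radial density combine to
  \<open>v powr (bn - 1)\<close>, the weight of \<open>halfplane_Bergman\<close>. The function is
  taken at height \<open>e\<close> and the kernel at height 0, which makes the coefficient
  holomorphic past the closed half-plane.\<close>

lemma kterm_integral:
  assumes Z: "Z \<in> Omega p" and G: "holomorphic2_on G (Omega p)" and e: "e > 0"
    and decay: "\<And>R e. e > 0 \<Longrightarrow> \<exists>C\<ge>0. \<forall>z \<sigma>. norm z \<le> R \<longrightarrow> Im \<sigma> \<ge> p z + e \<longrightarrow> norm (G (z, \<sigma>)) \<le> C / (1 + norm \<sigma>)"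
    and hL: "(\<lambda>x. G (lift_pt p e x)) \<in> L2"
  shows "(\<integral>x. kterm Z n (lift_pt p 0 x) * G (lift_pt p e x) \<partial>lborel)
    = fst Z ^ n * taylor_coeff G n (snd Z + \<i> * of_real e)"
proof -
  define f where "f = (\<lambda>w s. kterm Z n (lift_pt p 0 (w, s)) * G (lift_pt p e (w, s)))"
  define bn where "bn = real (Suc n) * b"
  define A where "A = (\<lambda>s v. - \<i> * (snd Z - of_real s) / 2 + complex_of_real (v / 2))"
  define a where "a = (\<lambda>\<sigma>. taylor_coeff G n (\<sigma> + \<i> * of_real e))"
  define c0 where "c0 = of_real (1 / (4 * pi\<^sup>2)) * of_nat (Suc n) * fst Z ^ n"
  define \<phi> where "\<phi> = (\<lambda>s v. indicator {0<..} v *\<^sub>R a (Complex s v) * (c0 * A s v powr of_real (- bn - 1) * of_real (v powr (real n * b))))"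
  have bn: "bn > 0" using b_pos by (simp add: bn_def)
  have z2: "Im (snd Z) > 0" using Omega_D[OF Z] by simp
  have int: "integrable (lborel \<Otimes>\<^sub>M lborel) (case_prod f)"
    using kterm_mult_integrable[OF Z hL, of n] by (simp add: lborel_prod case_prod_unfold f_def)
  have hola: "a holomorphic_on {\<sigma>. Im \<sigma> > - (e / 2)}"
    unfolding a_def by (rule holomorphic_on_translate[OF taylor_coeff_holomorphic[OF G, of "e / 2"]]) (use e in auto)
  obtain C where C: "C \<ge> 0" "\<And>\<sigma>. Im \<sigma> \<ge> e \<Longrightarrow> norm (taylor_coeff G n \<sigma>) \<le> C / (1 + norm \<sigma>)"
    using taylor_coeff_bound[OF G e decay] by blast
  have bda: "norm (a \<sigma>) \<le> C / (1 + norm \<sigma>)" if "Im \<sigma> \<ge> 0" for \<sigma>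
  proof -
    have "norm (a \<sigma>) \<le> C / (1 + norm (\<sigma> + \<i> * of_real e))"
      unfolding a_def using that by (intro C) auto
    also have "\<dots> \<le> C / (1 + norm \<sigma>)"
    proof (intro frac_le C)
      have "(Im \<sigma>)\<^sup>2 \<le> (Im \<sigma> + e)\<^sup>2" using that e by (intro power_mono) auto
      then show "1 + norm \<sigma> \<le> 1 + norm (\<sigma> + \<i> * of_real e)" by (simp add: cmod_def)
    qed (auto intro: add_pos_nonneg)
    finally show ?thesis .
  qed
  have BA: "B Z (lift_pt p 0 (w, s)) = A s (p w)" for w s
    by (simp add: B_def A_def lift_pt_def complex_eq_iff field_simps)
  have f_eq: "f \<zeta> s = c0 * A s (p w) powr of_real (- bn - 1) * (cnj \<zeta> ^ n * G (\<zeta>, Complex s (p w + e)))"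
    if "norm \<zeta> = norm w" for \<zeta> w s
    unfolding f_def kterm_def BA c0_def bn_def using that by (simp add: lift_pt_def power_mult_distrib mult_ac)
  have cm: "circle_mean (\<lambda>w. f w s) w = \<phi> s (p w)" if w: "w \<noteq> 0" for w s
  proof -
    let ?\<sigma> = "Complex s (p w + e)"
    have pw: "p w > 0" using w by simp
    have "circle_mean (\<lambda>w. f w s) w
        = (LBINT \<theta>:{0..2*pi}. c0 * A s (p w) powr of_real (- bn - 1) * (cnj (cis \<theta> * w) ^ n * G (cis \<theta> * w, ?\<sigma>))) / (2 * pi)"
      unfolding circle_mean_def by (subst f_eq[of _ w]) (simp_all add: norm_mult)
    also have "\<dots> = c0 * A s (p w) powr of_real (- bn - 1) * circle_mean (\<lambda>\<zeta>. cnj \<zeta> ^ n * G (\<zeta>, ?\<sigma>)) w"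
      unfolding circle_mean_def set_integral_mult_right by simp
    also have "circle_mean (\<lambda>\<zeta>. cnj \<zeta> ^ n * G (\<zeta>, ?\<sigma>)) w = of_real (norm w) ^ (2 * n) * taylor_coeff G n ?\<sigma>"
      using e by (intro circle_mean_taylor_coeff[OF G w]) simp
    also have "?\<sigma> = Complex s (p w) + \<i> * of_real e" by (simp add: complex_eq_iff)
    also have "of_real (norm w) ^ (2 * n) = complex_of_real (p w powr (real n * b))"
    proof -
      have "p w powr (real n * b) = norm w powr real (2 * n)"
        using pos by (simp add: powr_powr b_def mult.commute)
      also have "\<dots> = norm w ^ (2 * n)" using w by (subst powr_realpow) auto
      finally show ?thesis by simp
    qed
    finally show ?thesis using pw by (simp add: \<phi>_def a_def mult_ac)
  qed
  have \<phi>m: "\<phi> s \<in> borel_measurable borel" for s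
  proof -
    have "(\<lambda>v. indicator {0<..} v *\<^sub>R a (Complex s v)) \<in> borel_measurable borel"
    proof (rule borel_measurable_continuous_on_indicator)
      show "continuous_on {0<..} (\<lambda>v. a (Complex s v))"
        unfolding Complex_eq using e
        by (intro continuous_on_compose2[OF holomorphic_on_imp_continuous_on[OF hola]] continuous_intros) (auto intro: less_trans[of _ 0])
    qed simp
    moreover have "(\<lambda>v. A s v) \<in> borel_measurable borel"
      unfolding A_def by (intro borel_measurable_continuous_onI continuous_intros) auto
    ultimately show ?thesis unfolding \<phi>_def by measurable
  qed
  let ?I = "\<lambda>s. LBINT v:{0<..}. of_real (v powr (bn - 1)) * A s v powr of_real (- bn - 1) * a (Complex s v)"
  \<comment> \<open>Fubini guarantees integrability in \<open>w\<close> only for almost every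
    \<open>s\<close>, and the circle mean needs it.\<close>
  have inner: "AE s in lborel. (\<integral>w. f w s \<partial>lborel) = of_real (2 * pi / \<alpha>) * c0 * ?I s"
    using lborel_pair.AE_integrable_snd[OF int]
  proof eventually_elim
    case (elim s)
    have "(\<integral>w. f w s \<partial>lborel) = (\<integral>w. circle_mean (\<lambda>w. f w s) w \<partial>lborel)"
      by (rule integral_circle_mean(1)[OF elim])
    also have "\<dots> = (\<integral>w. \<phi> s (p w) \<partial>lborel)"
    proof (rule integral_cong_AE)
      show "circle_mean (\<lambda>w. f w s) \<in> borel_measurable lborel"
        using integral_circle_mean(2)[OF elim] by auto
      show "(\<lambda>w. \<phi> s (p w)) \<in> borel_measurable lborel"
        using measurable_compose[OF p_measurable \<phi>m] by simp
      show "AE w in lborel. circle_mean (\<lambda>w. f w s) w = \<phi> s (p w)"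
        using AE_lborel_singleton[of 0] by eventually_elim (rule cm)
    qed
    also have "\<dots> = (LBINT v:{0<..}. of_real (2 * pi / \<alpha> * v powr (2 / \<alpha> - 1)) * \<phi> s v)"
      by (rule integral_radial_powr[OF pos \<phi>m])
    also have "\<dots> = (LBINT v:{0<..}. (of_real (2 * pi / \<alpha>) * c0) * (of_real (v powr (bn - 1)) * A s v powr of_real (- bn - 1) * a (Complex s v)))"
    proof (rule set_lebesgue_integral_cong)
      show "\<forall>v. v \<in> {0<..} \<longrightarrow> of_real (2 * pi / \<alpha> * v powr (2 / \<alpha> - 1)) * \<phi> s v
         = (of_real (2 * pi / \<alpha>) * c0) * (of_real (v powr (bn - 1)) * A s v powr of_real (- bn - 1) * a (Complex s v))"
      proof (intro allI impI)
        fix v :: real assume v: "v \<in> {0<..}"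
        have "v powr (2 / \<alpha> - 1) * v powr (real n * b) = v powr (bn - 1)"
          unfolding powr_add[symmetric] by (simp add: bn_def b_def algebra_simps add_divide_distrib)
        then have "complex_of_real (v powr (2 / \<alpha> - 1)) * of_real (v powr (real n * b)) = of_real (v powr (bn - 1))"
          by (metis of_real_mult)
        then show "of_real (2 * pi / \<alpha> * v powr (2 / \<alpha> - 1)) * \<phi> s v
         = (of_real (2 * pi / \<alpha>) * c0) * (of_real (v powr (bn - 1)) * A s v powr of_real (- bn - 1) * a (Complex s v))"
          using v by (simp only: \<phi>_def of_real_mult) (simp add: mult_ac)
      qed
    qed simp
    also have "\<dots> = of_real (2 * pi / \<alpha>) * c0 * ?I s"
      by (rule set_integral_mult_right)
    finally show ?case .
  qed
  have e2: "e / 2 > 0" using e by simp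
  note HB = halfplane_Bergman[OF hola e2 bda z2 bn]
  have Iint: "integrable lborel ?I" and Ival: "(\<integral>s. ?I s \<partial>lborel) = of_real (4 * pi / bn) * a (snd Z)"
    unfolding A_def by (rule HB(1), assumption, rule HB(2), assumption)
  have "(\<integral>x. kterm Z n (lift_pt p 0 x) * G (lift_pt p e x) \<partial>lborel) = integral\<^sup>L (lborel \<Otimes>\<^sub>M lborel) (case_prod f)"
    by (simp add: lborel_prod case_prod_unfold f_def)
  also have "\<dots> = (\<integral>s. (\<integral>w. f w s \<partial>lborel) \<partial>lborel)"
    by (rule lborel_pair.integral_snd[OF int, symmetric])
  also have "\<dots> = (\<integral>s. of_real (2 * pi / \<alpha>) * c0 * ?I s \<partial>lborel)"
  proof (rule integral_cong_AE[OF _ _ inner])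
    show "(\<lambda>s. \<integral>w. f w s \<partial>lborel) \<in> borel_measurable lborel"
      using lborel_pair.integrable_snd[OF int] by auto
    have "integrable lborel (\<lambda>s. of_real (2 * pi / \<alpha>) * c0 * ?I s)"
      by (rule integrable_mult_right[OF Iint])
    then show "(\<lambda>s. of_real (2 * pi / \<alpha>) * c0 * ?I s) \<in> borel_measurable lborel"
      by auto
  qed
  also have "\<dots> = of_real (2 * pi / \<alpha>) * c0 * (of_real (4 * pi / bn) * a (snd Z))"
    unfolding integral_mult_right_zero Ival ..
  also have "\<dots> = fst Z ^ n * a (snd Z)"
  proof -
    \<comment> \<open>This identity fixes the constant of the kernel: both \<open>\<alpha>\<close>
      and \<open>Suc n\<close> cancel against \<open>bn\<close>.\<close>
    have "(2 * pi / \<alpha>) * (1 / (4 * pi\<^sup>2) * real (Suc n)) * (4 * pi / bn) = 1"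
    proof -
      have "(2 * pi / \<alpha>) * (1 / (4 * pi\<^sup>2) * N) * (4 * pi / (N * (2 / \<alpha>))) = 1" if "N > 0" for N
        using pos that by (simp add: power2_eq_square)
      from this[of "real (Suc n)"] show ?thesis unfolding bn_def b_def by (simp only: of_nat_0_less_iff zero_less_Suc)
    qed
    then have "complex_of_real ((2 * pi / \<alpha>) * (1 / (4 * pi\<^sup>2) * real (Suc n)) * (4 * pi / bn)) = 1"
      by (simp only: of_real_1)
    moreover have "of_real (2 * pi / \<alpha>) * c0 * (of_real (4 * pi / bn) * a (snd Z))
        = complex_of_real ((2 * pi / \<alpha>) * (1 / (4 * pi\<^sup>2) * real (Suc n)) * (4 * pi / bn)) * (fst Z ^ n * a (snd Z))"
      by (simp only: c0_def of_real_mult of_real_of_nat_eq mult_ac)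
    ultimately show ?thesis by simp
  qed
  finally show ?thesis by (simp add: a_def)
qed

text \<open>The terms are dominated by \<open>(n + 1) * \<rho> Z ^ n\<close> times a product of two
  square integrable functions, so the series may be integrated termwise. What results is the Taylor
  series of \<open>G\<close> in its first variable at the shifted point.\<close>

lemma kern_reproduces_decaying:
  assumes Z: "Z \<in> Omega p" and G: "holomorphic2_on G (Omega p)" and e: "e > 0"
    and decay: "\<And>R e. e > 0 \<Longrightarrow> \<exists>C\<ge>0. \<forall>z \<sigma>. norm z \<le> R \<longrightarrow> Im \<sigma> \<ge> p z + e \<longrightarrow> norm (G (z, \<sigma>)) \<le> C / (1 + norm \<sigma>)"
    and hL: "(\<lambda>x. G (lift_pt p e x)) \<in> L2"
  shows "(\<integral>x. kern Z (lift_pt p 0 x) * G (lift_pt p e x) \<partial>lborel) = G (fst Z, snd Z + \<i> * of_real e)"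
proof -
  let ?t = "\<lambda>n x. kterm Z n (lift_pt p 0 x) * G (lift_pt p e x)"
  let ?g = "\<lambda>x. norm (B Z (lift_pt p 0 x)) powr (- 1 - b) * norm (G (lift_pt p e x))"
  have r: "norm (\<rho> Z) < 1" using \<rho>_bounds[OF Z] by simp
  have sumr: "summable (\<lambda>n. real (Suc n) * \<rho> Z ^ n)"
    using geometric_deriv_sums[OF r] by (rule sums_summable)
  have bd: "norm (?t n x) \<le> real (Suc n) * \<rho> Z ^ n * ?g x" for n x
    by (rule kterm_mult_bound[OF Z])
  have ti: "integrable lborel (?t n)" for n
    by (rule kterm_mult_integrable[OF Z hL])
  have gi: "integrable lborel ?g" by (rule B_powr_mult_integrable[OF Z hL])
  have sx: "summable (\<lambda>n. norm (?t n x))" for x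
    by (rule summable_comparison_test'[of "\<lambda>n. real (Suc n) * \<rho> Z ^ n * ?g x" 0]) (use bd sumr in \<open>auto intro: summable_mult2\<close>)
  have si: "summable (\<lambda>n. \<integral>x. norm (?t n x) \<partial>lborel)"
  proof (rule summable_comparison_test'[of "\<lambda>n. real (Suc n) * \<rho> Z ^ n * (\<integral>x. ?g x \<partial>lborel)" 0])
    show "summable (\<lambda>n. real (Suc n) * \<rho> Z ^ n * (\<integral>x. ?g x \<partial>lborel))" by (rule summable_mult2[OF sumr])
    fix n
    have "(\<integral>x. norm (?t n x) \<partial>lborel) \<le> (\<integral>x. real (Suc n) * \<rho> Z ^ n * ?g x \<partial>lborel)"
      using bd by (intro integral_mono integrable_norm ti integrable_mult_right gi)
    then show "norm (\<integral>x. norm (?t n x) \<partial>lborel) \<le> real (Suc n) * \<rho> Z ^ n * (\<integral>x. ?g x \<partial>lborel)"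
      by (simp add: integral_nonneg_AE)
  qed
  have "(\<lambda>n. \<integral>x. ?t n x \<partial>lborel) sums (\<integral>x. (\<Sum>n. ?t n x) \<partial>lborel)"
    by (rule sums_integral[OF ti _ si]) (use sx in auto)
  moreover have "(\<Sum>n. ?t n x) = kern Z (lift_pt p 0 x) * G (lift_pt p e x)" for x
    using sums_mult2[OF kterm_sums[OF Z lift_pt_closed[of 0 x]]] by (intro sums_unique[symmetric]) simp
  ultimately have s1: "(\<lambda>n. fst Z ^ n * taylor_coeff G n (snd Z + \<i> * of_real e)) sums (\<integral>x. kern Z (lift_pt p 0 x) * G (lift_pt p e x) \<partial>lborel)"
    using kterm_integral[OF Z G e decay hL] by simp
  have "(fst Z, snd Z + \<i> * of_real e) \<in> Omega p"
    using Omega_D[OF Z] e by (simp add: Omega_def)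
  from taylor_coeff_sums[OF G this]
  have "(\<lambda>n. fst Z ^ n * taylor_coeff G n (snd Z + \<i> * of_real e)) sums G (fst Z, snd Z + \<i> * of_real e)"
    by (simp add: mult.commute)
  with s1 show ?thesis by (rule sums_unique2)
qed

lemma kern_cnj_kZ: "kern Z (lift_pt p 0 x) * u = u * cnj (kZ Z x)"
  by (simp add: kZ_def)

text \<open>Two successive limits. At a fixed height \<open>e\<close> the mollifier is removed by
  dominated convergence. Then \<open>e\<close> tends to 0: the integrals converge by the
  Cauchy-Schwarz inequality against \<open>kZ Z\<close>, the values by continuity of
  \<open>H\<close> at the interior point.\<close>

lemma kern_reproduces:
  assumes Z: "Z \<in> Omega p" and h: "h \<in> L2" and H: "hardy_extension p h H"
  shows "(\<integral>x. kern Z (lift_pt p 0 x) * h x \<partial>lborel) = H Z"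
proof -
  have Hh: "holomorphic2_on H (Omega p)" using H by (simp add: hardy_extension_def)
  obtain K where K: "K \<ge> 0" "\<And>y. y > 0 \<Longrightarrow> sq_int (\<lambda>x. H (lift_pt p y x)) \<le> ennreal K"
    using hardy_extension_bound[OF p_cont H] by blast
  have HL: "(\<lambda>x. H (lift_pt p y x)) \<in> L2" if "y > 0" for y
    using measurable_slice[OF p_cont Hh that] K(2)[OF that] by (auto simp: L2_iff intro: le_less_trans)
  have kL: "kZ Z \<in> L2" by (rule kZ_hardy(1)[OF Z])
  have ki: "integrable lborel (\<lambda>x. kern Z (lift_pt p 0 x) * u x)" if "u \<in> L2" for u
    unfolding kern_cnj_kZ by (rule L2_integrable_inner[OF that kL])
  have step: "(\<integral>x. kern Z (lift_pt p 0 x) * H (lift_pt p e x) \<partial>lborel) = H (fst Z, snd Z + \<i> * of_real e)" if e: "e > 0" for e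
  proof -
    define d where "d = (\<lambda>n. 1 / real (Suc n))"
    have d: "d n > 0" for n by (simp add: d_def)
    define m where "m = (\<lambda>n (W :: complex \<times> complex). 1 - \<i> * of_real (d n) * snd W)"
    have mW: "1 \<le> norm (m n W)" if "Im (snd W) \<ge> 0" for n W
      unfolding m_def by (rule norm_mollifier_ge(1)[OF d that])
    have G: "holomorphic2_on (\<lambda>W. H W / m n W) (Omega p)" for n
    proof (rule holomorphic2_on_divide[OF open_Omega[OF p_cont] Hh])
      show "holomorphic2_on (m n) (Omega p)"
        unfolding m_def by (rule holomorphic2_on_snd_affine[OF open_Omega[OF p_cont]])
      show "m n W \<noteq> 0" if "W \<in> Omega p" for W
        using mW[of W n] Omega_D[OF that] by auto
    qed
    have le: "norm (H W / m n W) \<le> norm (H W)" if "Im (snd W) \<ge> 0" for n W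
    proof -
      have "norm (H W) / norm (m n W) \<le> norm (H W) / 1" using mW[OF that] by (intro frac_le) auto
      then show ?thesis by (simp add: norm_divide)
    qed
    have imge: "0 \<le> Im (snd (lift_pt p e x))" for x
      using order_trans[OF p_nonneg lift_pt_closed[of e x]] e by simp
    have GL: "(\<lambda>x. H (lift_pt p e x) / m n (lift_pt p e x)) \<in> L2" for n
    proof -
      have "(\<lambda>x. H (lift_pt p e x) / m n (lift_pt p e x)) \<in> borel_measurable borel"
        by (rule measurable_slice[OF p_cont G e])
      moreover have "sq_int (\<lambda>x. H (lift_pt p e x) / m n (lift_pt p e x)) \<le> sq_int (\<lambda>x. H (lift_pt p e x))"
        by (intro nn_integral_mono ennreal_leI power_mono le imge) auto
      ultimately show ?thesis using HL[OF e] by (auto simp: L2_iff intro: le_less_trans)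
    qed
    have decay: "\<exists>C\<ge>0. \<forall>z \<sigma>. norm z \<le> R \<longrightarrow> Im \<sigma> \<ge> p z + e' \<longrightarrow> norm (H (z, \<sigma>) / m n (z, \<sigma>)) \<le> C / (1 + norm \<sigma>)"
      if e': "e' > 0" for n R e'
    proof -
      obtain C where "C \<ge> 0" "\<And>z \<sigma>. norm z \<le> R \<Longrightarrow> Im \<sigma> \<ge> p z + e' \<Longrightarrow>
          norm (H (z, \<sigma>) / (1 - \<i> * of_real (d n) * \<sigma>)) \<le> C / (1 + norm \<sigma>)"
        using mollifier_bound[OF p_cont p_nonneg Hh K(2) e' d] by blast
      then show ?thesis unfolding m_def snd_conv by blast
    qed
    have rep: "(\<integral>x. kern Z (lift_pt p 0 x) * (H (lift_pt p e x) / m n (lift_pt p e x)) \<partial>lborel)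
        = H (fst Z, snd Z + \<i> * of_real e) / m n (fst Z, snd Z + \<i> * of_real e)" for n
      by (rule kern_reproduces_decaying[OF Z G e decay GL])
    have lim: "(\<lambda>n. H W / m n W) \<longlonglongrightarrow> H W" for W
    proof -
      have "d \<longlonglongrightarrow> 0" unfolding d_def by real_asymp
      then have "(\<lambda>n. complex_of_real (d n)) \<longlonglongrightarrow> of_real 0" by (rule tendsto_of_real)
      then have "(\<lambda>n. H W / m n W) \<longlonglongrightarrow> H W / (1 - \<i> * of_real 0 * snd W)"
        unfolding m_def by (intro tendsto_divide tendsto_diff tendsto_mult tendsto_const) auto
      then show ?thesis by simp
    qed
    have "(\<lambda>n. \<integral>x. kern Z (lift_pt p 0 x) * (H (lift_pt p e x) / m n (lift_pt p e x)) \<partial>lborel)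
        \<longlonglongrightarrow> (\<integral>x. kern Z (lift_pt p 0 x) * H (lift_pt p e x) \<partial>lborel)"
    proof (rule integral_dominated_convergence[where w = "\<lambda>x. norm (kern Z (lift_pt p 0 x) * H (lift_pt p e x))"])
      show "integrable lborel (\<lambda>x. norm (kern Z (lift_pt p 0 x) * H (lift_pt p e x)))"
        by (intro integrable_norm ki HL e)
      show "AE x in lborel. (\<lambda>n. kern Z (lift_pt p 0 x) * (H (lift_pt p e x) / m n (lift_pt p e x)))
          \<longlonglongrightarrow> kern Z (lift_pt p 0 x) * H (lift_pt p e x)"
        by (intro AE_I2 tendsto_mult tendsto_const lim)
      show "AE x in lborel. norm (kern Z (lift_pt p 0 x) * (H (lift_pt p e x) / m n (lift_pt p e x)))
          \<le> norm (kern Z (lift_pt p 0 x) * H (lift_pt p e x))" for n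
        unfolding norm_mult by (intro AE_I2 mult_left_mono le imge) auto
      show "(\<lambda>x. kern Z (lift_pt p 0 x) * H (lift_pt p e x)) \<in> borel_measurable lborel"
        using ki[OF HL[OF e]] by auto
      show "(\<lambda>x. kern Z (lift_pt p 0 x) * (H (lift_pt p e x) / m n (lift_pt p e x))) \<in> borel_measurable lborel" for n
        using ki[OF GL] by auto
    qed
    then show ?thesis
      unfolding rep using lim LIMSEQ_unique by blast
  qed
  define e where "e = (\<lambda>n. 1 / real (Suc n))"
  have e: "e n > 0" for n by (simp add: e_def)
  have elim: "e \<longlonglongrightarrow> 0" unfolding e_def by real_asymp
  have er: "filterlim e (at_right 0) sequentially"
    using elim e by (auto simp: filterlim_at less_imp_neq[symmetric] intro!: always_eventually)
  have "(\<lambda>n. H (fst Z, snd Z + \<i> * of_real (e n))) \<longlonglongrightarrow> H Z"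
  proof -
    have "isCont H Z"
      using holomorphic2_on_imp_continuous_on[OF Hh] Z open_Omega[OF p_cont] continuous_on_eq_continuous_at by blast
    moreover have "(\<lambda>n. (fst Z, snd Z + \<i> * of_real (e n))) \<longlonglongrightarrow> (fst Z, snd Z + \<i> * of_real 0)"
      by (intro tendsto_intros elim)
    then have "(\<lambda>n. (fst Z, snd Z + \<i> * of_real (e n))) \<longlonglongrightarrow> Z" by simp
    ultimately show ?thesis by (rule isCont_tendsto_compose)
  qed
  moreover have "(\<lambda>n. H (fst Z, snd Z + \<i> * of_real (e n))) \<longlonglongrightarrow> (\<integral>x. kern Z (lift_pt p 0 x) * h x \<partial>lborel)"
  proof -
    have "((\<lambda>y. sq_int (\<lambda>x. H (lift_pt p y x) - h x)) \<longlongrightarrow> 0) (at_right 0)"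
      using H by (simp add: hardy_extension_def)
    from filterlim_compose[OF this er]
    have l0: "(\<lambda>n. sq_int (\<lambda>x. H (lift_pt p (e n) x) - h x)) \<longlonglongrightarrow> 0" .
    have dL: "(\<lambda>x. H (lift_pt p (e n) x) - h x) \<in> L2" for n by (intro L2_diff HL e h)
    have "(\<lambda>n. enn2real (sq_int (\<lambda>x. H (lift_pt p (e n) x) - h x))) \<longlonglongrightarrow> enn2real 0"
      using l0 by (intro tendsto_enn2real) auto
    then have l1: "(\<lambda>n. sq_norm (\<lambda>x. H (lift_pt p (e n) x) - h x)) \<longlonglongrightarrow> 0"
      using sq_int_L2[OF dL] sq_norm_nonneg by simp
    have le: "(norm (H (fst Z, snd Z + \<i> * of_real (e n)) - (\<integral>x. kern Z (lift_pt p 0 x) * h x \<partial>lborel)))\<^sup>2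
        \<le> sq_norm (\<lambda>x. H (lift_pt p (e n) x) - h x) * sq_norm (kZ Z)" for n
    proof -
      have "H (fst Z, snd Z + \<i> * of_real (e n)) - (\<integral>x. kern Z (lift_pt p 0 x) * h x \<partial>lborel)
          = (\<integral>x. kern Z (lift_pt p 0 x) * H (lift_pt p (e n) x) - kern Z (lift_pt p 0 x) * h x \<partial>lborel)"
        unfolding step[OF e, symmetric] by (intro Bochner_Integration.integral_diff[symmetric] ki HL e h)
      also have "\<dots> = (\<integral>x. (H (lift_pt p (e n) x) - h x) * cnj (kZ Z x) \<partial>lborel)"
        by (simp add: kern_cnj_kZ left_diff_distrib)
      finally have eq: "H (fst Z, snd Z + \<i> * of_real (e n)) - (\<integral>x. kern Z (lift_pt p 0 x) * h x \<partial>lborel)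
          = (\<integral>x. (H (lift_pt p (e n) x) - h x) * cnj (kZ Z x) \<partial>lborel)" .
      show ?thesis
        unfolding eq
      proof (rule integral_Cauchy_Schwarz)
        show "(\<lambda>x. H (lift_pt p (e n) x) - h x) \<in> borel_measurable lborel" "kZ Z \<in> borel_measurable lborel"
          using L2_D(1)[OF dL[of n]] L2_D(1)[OF kL] by simp_all
      qed (rule L2_D(2)[OF dL] L2_D(2)[OF kL])+
    qed
    define u where "u = (\<lambda>n. H (fst Z, snd Z + \<i> * of_real (e n)) - (\<integral>x. kern Z (lift_pt p 0 x) * h x \<partial>lborel))"
    define v where "v = (\<lambda>n. sq_norm (\<lambda>x. H (lift_pt p (e n) x) - h x) * sq_norm (kZ Z))"
    have "v \<longlonglongrightarrow> 0 * sq_norm (kZ Z)"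
      unfolding v_def by (intro tendsto_mult l1 tendsto_const)
    then have v: "v \<longlonglongrightarrow> 0" by (simp only: mult_zero_left)
    have uv: "(norm (u n))\<^sup>2 \<le> v n" for n
      unfolding u_def v_def by (rule le)
    have "(\<lambda>n. (norm (u n))\<^sup>2) \<longlonglongrightarrow> 0"
      by (rule tendsto_sandwich[OF _ _ tendsto_const v]) (simp_all add: uv)
    then have "(\<lambda>n. sqrt ((norm (u n))\<^sup>2)) \<longlonglongrightarrow> sqrt 0"
      by (rule tendsto_real_sqrt)
    then have "u \<longlonglongrightarrow> 0"
      by (simp add: tendsto_norm_zero_iff)
    then have "(\<lambda>n. H (fst Z, snd Z + \<i> * of_real (e n)) - (\<integral>x. kern Z (lift_pt p 0 x) * h x \<partial>lborel)) \<longlonglongrightarrow> 0"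
      by (simp only: u_def)
    then show ?thesis by (simp only: LIM_zero_iff)
  qed
  ultimately show ?thesis using LIMSEQ_unique by blast
qed

end

section \<open>The Hardy space is a closed subspace\<close>

lemma ennreal_tendsto_0I:
  fixes X :: "'a \<Rightarrow> ennreal"
  assumes "\<And>r. r > 0 \<Longrightarrow> eventually (\<lambda>y. X y \<le> ennreal r) F"
  shows "(X \<longlongrightarrow> 0) F"
proof (rule order_tendstoI)
  fix a :: ennreal assume "0 < a"
  then obtain c where c: "0 < c" "c < a" using dense by blast
  then obtain r where r: "c = ennreal r" "r > 0"
    by (cases c) (auto simp: ennreal_less_zero_iff)
  show "eventually (\<lambda>y. X y < a) F"
    using assms[OF r(2)] by eventually_elim (use c r in auto)
qed (simp add: not_less)

lemma tendsto_ennreal_0D: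
  fixes X :: "'a \<Rightarrow> ennreal"
  assumes "(X \<longlongrightarrow> 0) F" "r > 0"
  shows "eventually (\<lambda>y. X y \<le> ennreal r) F"
  using order_tendstoD(2)[OF assms(1), of "ennreal r"] assms(2) by (auto elim: eventually_mono)

lemma hardy_extension_combine:
  assumes p: "continuous_on UNIV p"
    and f: "f \<in> borel_measurable borel" "hardy_extension p f F"
    and g: "g \<in> borel_measurable borel" "hardy_extension p g G"
  shows "hardy_extension p (\<lambda>x. c * f x + d * g x) (\<lambda>Z. c * F Z + d * G Z)"
  unfolding hardy_extension_def
proof (intro conjI)
  have F: "holomorphic2_on F (Omega p)" and G: "holomorphic2_on G (Omega p)"
    using f g by (simp_all add: hardy_extension_def)
  show "holomorphic2_on (\<lambda>Z. c * F Z + d * G Z) (Omega p)"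
  proof (rule holomorphic2_on_Osgood[OF open_Omega[OF p]])
    show "continuous_on (Omega p) (\<lambda>Z. c * F Z + d * G Z)"
      by (intro continuous_intros holomorphic2_on_imp_continuous_on[OF F] holomorphic2_on_imp_continuous_on[OF G])
    fix u v assume uv: "(u, v) \<in> Omega p"
    note [derivative_intros] = holomorphic2_on_slices[OF F uv] holomorphic2_on_slices[OF G uv]
    show "(\<lambda>w. c * F (w, v) + d * G (w, v)) field_differentiable at u"
      by (intro derivative_intros)
    show "(\<lambda>\<sigma>. c * F (u, \<sigma>) + d * G (u, \<sigma>)) field_differentiable at v"
      by (intro derivative_intros)
  qed
  obtain K where K: "\<And>y. y > 0 \<Longrightarrow> sq_int (\<lambda>x. F (lift_pt p y x)) \<le> ennreal K"
    using hardy_extension_bound[OF p f(2)] by blast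
  obtain L where L: "\<And>y. y > 0 \<Longrightarrow> sq_int (\<lambda>x. G (lift_pt p y x)) \<le> ennreal L"
    using hardy_extension_bound[OF p g(2)] by blast
  have le: "sq_int (\<lambda>x. c * u x + d * v x) \<le> 2 * (ennreal ((norm c)\<^sup>2) * sq_int u) + 2 * (ennreal ((norm d)\<^sup>2) * sq_int v)"
    if "u \<in> borel_measurable borel" "v \<in> borel_measurable borel" for u v :: "complex \<times> real \<Rightarrow> complex"
    using sq_int_add_le[of "\<lambda>x. c * u x" "\<lambda>x. d * v x"] that by (simp only: sq_int_scale) measurable
  have "(SUP y\<in>{0<..}. sq_int (\<lambda>x. c * F (lift_pt p y x) + d * G (lift_pt p y x)))
      \<le> 2 * (ennreal ((norm c)\<^sup>2) * ennreal K) + 2 * (ennreal ((norm d)\<^sup>2) * ennreal L)"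
  proof (rule SUP_least)
    fix y :: real assume "y \<in> {0<..}"
    then have y: "y > 0" by simp
    show "sq_int (\<lambda>x. c * F (lift_pt p y x) + d * G (lift_pt p y x))
      \<le> 2 * (ennreal ((norm c)\<^sup>2) * ennreal K) + 2 * (ennreal ((norm d)\<^sup>2) * ennreal L)"
      by (rule order_trans[OF le[OF measurable_slice[OF p F y] measurable_slice[OF p G y]]])
        (intro add_mono mult_left_mono K L y; simp)
  qed
  also have "\<dots> < \<infinity>" by (simp add: ennreal_mult_less_top)
  finally show "(SUP y\<in>{0<..}. sq_int (\<lambda>x. c * F (lift_pt p y x) + d * G (lift_pt p y x))) < \<infinity>" .
  have lf: "((\<lambda>y. sq_int (\<lambda>x. F (lift_pt p y x) - f x)) \<longlongrightarrow> 0) (at_right 0)"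
    and lg: "((\<lambda>y. sq_int (\<lambda>x. G (lift_pt p y x) - g x)) \<longlongrightarrow> 0) (at_right 0)"
    using f g by (simp_all add: hardy_extension_def)
  have "((\<lambda>y. 2 * (ennreal ((norm c)\<^sup>2) * sq_int (\<lambda>x. F (lift_pt p y x) - f x)) + 2 * (ennreal ((norm d)\<^sup>2) * sq_int (\<lambda>x. G (lift_pt p y x) - g x)))
      \<longlongrightarrow> 2 * (ennreal ((norm c)\<^sup>2) * 0) + 2 * (ennreal ((norm d)\<^sup>2) * 0)) (at_right 0)"
    by (intro tendsto_add ennreal_tendsto_cmult lf lg) auto
  then have l0: "((\<lambda>y. 2 * (ennreal ((norm c)\<^sup>2) * sq_int (\<lambda>x. F (lift_pt p y x) - f x)) + 2 * (ennreal ((norm d)\<^sup>2) * sq_int (\<lambda>x. G (lift_pt p y x) - g x)))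
      \<longlongrightarrow> 0) (at_right 0)" by simp
  show "((\<lambda>y. sq_int (\<lambda>x. c * F (lift_pt p y x) + d * G (lift_pt p y x) - (c * f x + d * g x))) \<longlongrightarrow> 0) (at_right 0)"
  proof (rule tendsto_sandwich[OF _ _ tendsto_const l0])
    show "\<forall>\<^sub>F y in at_right 0. sq_int (\<lambda>x. c * F (lift_pt p y x) + d * G (lift_pt p y x) - (c * f x + d * g x))
        \<le> 2 * (ennreal ((norm c)\<^sup>2) * sq_int (\<lambda>x. F (lift_pt p y x) - f x)) + 2 * (ennreal ((norm d)\<^sup>2) * sq_int (\<lambda>x. G (lift_pt p y x) - g x))"
      using eventually_at_right_less[of 0]
    proof eventually_elim
      case (elim y)
      have "c * a + d * a' - (c * e + d * e') = c * (a - e) + d * (a' - e')" for a a' e e'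
        by (simp add: algebra_simps)
      then show ?case
        using le[of "\<lambda>x. F (lift_pt p y x) - f x" "\<lambda>x. G (lift_pt p y x) - g x"]
          measurable_slice[OF p F elim] measurable_slice[OF p G elim] f(1) g(1) by simp
    qed
  qed simp
qed

lemma hardy_extension_cong:
  assumes p: "continuous_on UNIV p" and F: "hardy_extension p f F" and eq: "\<And>Z. Z \<in> Omega p \<Longrightarrow> F Z = G Z"
  shows "hardy_extension p f G"
  unfolding hardy_extension_def
proof (intro conjI)
  show "holomorphic2_on G (Omega p)"
    using F by (intro holomorphic2_on_cong[OF open_Omega[OF p] _ eq]) (simp_all add: hardy_extension_def)
  have e: "F (lift_pt p y x) = G (lift_pt p y x)" if "y > 0" for x y
    using that by (intro eq lift_pt_in_Omega)
  have "(SUP y\<in>{0<..}. sq_int (\<lambda>x. G (lift_pt p y x))) = (SUP y\<in>{0<..}. sq_int (\<lambda>x. F (lift_pt p y x)))"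
    by (intro SUP_cong) (auto simp: e)
  then show "(SUP y\<in>{0<..}. sq_int (\<lambda>x. G (lift_pt p y x))) < \<infinity>"
    using F by (simp add: hardy_extension_def)
  have "((\<lambda>y. sq_int (\<lambda>x. F (lift_pt p y x) - f x)) \<longlongrightarrow> 0) (at_right 0)"
    using F by (simp add: hardy_extension_def)
  moreover have "\<forall>\<^sub>F y in at_right 0. sq_int (\<lambda>x. F (lift_pt p y x) - f x) = sq_int (\<lambda>x. G (lift_pt p y x) - f x)"
    using eventually_at_right_less[of 0] by eventually_elim (simp add: e)
  ultimately show "((\<lambda>y. sq_int (\<lambda>x. G (lift_pt p y x) - f x)) \<longlongrightarrow> 0) (at_right 0)"
    by (rule Lim_transform_eventually)
qed

lemma H2_combine:
  assumes p: "continuous_on UNIV p" and f: "f \<in> H2 p" and g: "g \<in> H2 p"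
  shows "(\<lambda>x. c * f x + d * g x) \<in> H2 p"
proof -
  obtain F G where FG: "hardy_extension p f F" "hardy_extension p g G" and L: "f \<in> L2" "g \<in> L2"
    using f g by (auto simp: H2_def)
  have "hardy_extension p (\<lambda>x. c * f x + d * g x) (\<lambda>Z. c * F Z + d * G Z)"
    by (intro hardy_extension_combine p FG L2_D(1) L)
  moreover have "(\<lambda>x. c * f x + d * g x) \<in> L2" by (intro L2_add L2_scale L)
  ultimately show ?thesis by (auto simp: H2_def)
qed

lemma zero_in_H2:
  assumes p: "continuous_on UNIV p"
  shows "(\<lambda>x. 0) \<in> H2 p"
proof -
  have "holomorphic2_on (\<lambda>Z. 0) (Omega p)"
    by (rule holomorphic2_on_Osgood[OF open_Omega[OF p]]) auto
  then have "hardy_extension p (\<lambda>x. 0) (\<lambda>Z. 0)"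
    by (simp add: hardy_extension_def)
  then show ?thesis by (auto simp: H2_def L2_def)
qed

section \<open>Limits of Hardy functions through the kernel\<close>

context pow_weight
begin

text \<open>The kernel reproduces \<open>kZ Z\<close>, and evaluating its extension at
  \<open>Z\<close> itself gives the squared norm.\<close>

lemma sq_norm_kZ:
  assumes Z: "Z \<in> Omega p"
  shows "sq_norm (kZ Z) = norm (kern Z Z)"
proof -
  have "kern Z Z = (\<integral>x. kern Z (lift_pt p 0 x) * kZ Z x \<partial>lborel)"
    using kern_reproduces[OF Z kZ_hardy[OF Z]] by simp
  also have "\<dots> = (\<integral>x. complex_of_real ((norm (kZ Z x))\<^sup>2) \<partial>lborel)"
    unfolding kern_cnj_kZ complex_norm_square ..
  also have "\<dots> = of_real (sq_norm (kZ Z))" by (rule integral_complex_of_real)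
  finally show ?thesis using sq_norm_nonneg[of "kZ Z"] by simp
qed

text \<open>For a member of the Hardy space this is its holomorphic extension in the domain; for a
  general square integrable \<open>f\<close> it turns out to be the extension of the projection of
  \<open>f\<close>.\<close>

definition ext :: "(complex \<times> real \<Rightarrow> complex) \<Rightarrow> complex \<times> complex \<Rightarrow> complex" where
  "ext f Z = (\<integral>x. kern Z (lift_pt p 0 x) * f x \<partial>lborel)"

lemma kern_mult_integrable:
  assumes Z: "Z \<in> Omega p" and f: "f \<in> L2"
  shows "integrable lborel (\<lambda>x. kern Z (lift_pt p 0 x) * f x)"
  unfolding kern_cnj_kZ by (rule L2_integrable_inner[OF f kZ_hardy(1)[OF Z]])

lemma ext_eq_inner: "ext f Z = L2_inner f (kZ Z)"
  by (simp add: ext_def L2_inner_def kern_cnj_kZ)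

lemma ext_diff_bound:
  assumes Z: "Z \<in> Omega p" and f: "f \<in> L2" and g: "g \<in> L2"
  shows "(norm (ext f Z - ext g Z))\<^sup>2 \<le> sq_norm (\<lambda>x. f x - g x) * norm (kern Z Z)"
proof -
  note d = L2_diff[OF f g] and k = kZ_hardy(1)[OF Z]
  have eq: "ext f Z - ext g Z = (\<integral>x. (f x - g x) * cnj (kZ Z x) \<partial>lborel)"
    unfolding ext_eq_inner L2_inner_def left_diff_distrib
    by (rule Bochner_Integration.integral_diff[symmetric]) (intro L2_integrable_inner f g k)+
  show ?thesis
    unfolding eq sq_norm_kZ[OF Z, symmetric]
  proof (rule integral_Cauchy_Schwarz)
    show "(\<lambda>x. f x - g x) \<in> borel_measurable lborel" "kZ Z \<in> borel_measurable lborel"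
      using L2_D(1)[OF d] L2_D(1)[OF k] by simp_all
  qed (rule L2_D(2)[OF d] L2_D(2)[OF k])+
qed

text \<open>The norm of evaluation at \<open>Z\<close> is the square root of
  \<open>norm (kern Z Z)\<close>, which is continuous and hence bounded on compact sets.\<close>

lemma ext_uniform_limit:
  assumes f: "\<And>n. f n \<in> L2" and g: "g \<in> L2" and lim: "(\<lambda>n. sq_int (\<lambda>x. f n x - g x)) \<longlonglongrightarrow> 0"
    and C: "compact C" "C \<subseteq> Omega p"
  shows "uniform_limit C (\<lambda>n. ext (f n)) (ext g) sequentially"
proof -
  have "continuous_on C (\<lambda>Z. kern Z Z)"
    unfolding continuous_on_def
  proof
    fix Z assume "Z \<in> C"
    then have Z: "Z \<in> Omega p" using C by auto
    have "good Z Z" using Omega_D[OF Z] by (intro good_interior(1)[OF Z]) simp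
    then show "((\<lambda>Z. kern Z Z) \<longlongrightarrow> kern Z Z) (at Z within C)"
      by (intro kern_tendsto tendsto_ident_at)
  qed
  from compact_imp_bounded[OF compact_continuous_image[OF this C(1)]]
  obtain M where M: "M > 0" "\<And>Z. Z \<in> C \<Longrightarrow> norm (kern Z Z) \<le> M"
    unfolding bounded_pos by auto
  show ?thesis
    unfolding uniform_limit_iff
  proof (intro allI impI)
    fix e :: real assume e: "e > 0"
    have "\<forall>\<^sub>F n in sequentially. sq_int (\<lambda>x. f n x - g x) \<le> ennreal (e\<^sup>2 / (2 * M))"
      using e M by (intro tendsto_ennreal_0D[OF lim]) auto
    then show "\<forall>\<^sub>F n in sequentially. \<forall>Z\<in>C. dist (ext (f n) Z) (ext g Z) < e"
    proof eventually_elim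
      case (elim n)
      show ?case
      proof
        fix Z assume Z: "Z \<in> C"
        have "ennreal (sq_norm (\<lambda>x. f n x - g x)) \<le> ennreal (e\<^sup>2 / (2 * M))"
          using elim sq_int_L2[OF L2_diff[OF f g], of n] by simp
        then have s: "sq_norm (\<lambda>x. f n x - g x) \<le> e\<^sup>2 / (2 * M)"
          using e M by (subst (asm) ennreal_le_iff) auto
        have "(norm (ext (f n) Z - ext g Z))\<^sup>2 \<le> sq_norm (\<lambda>x. f n x - g x) * norm (kern Z Z)"
          using Z C by (intro ext_diff_bound f g) auto
        also have "\<dots> \<le> e\<^sup>2 / (2 * M) * M"
          using s M(1) M(2)[OF Z] by (intro mult_mono) auto
        also have "\<dots> < e\<^sup>2" using e M by simp
        finally have "norm (ext (f n) Z - ext g Z) < e"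
          using e by (intro power2_less_imp_less[of _ e]) auto
        then show "dist (ext (f n) Z) (ext g Z) < e" by (simp add: dist_norm)
      qed
    qed
  qed
qed

lemma hardy_extension_ext:
  assumes "f \<in> L2" "hardy_extension p f F"
  shows "hardy_extension p f (ext f)"
  using kern_reproduces[OF _ assms] unfolding ext_def
  by (intro hardy_extension_cong[OF p_cont assms(2)]) auto

text \<open>Locally uniform convergence gives continuity, and on each slice holomorphy by the
  theorem of Weierstrass; Osgood's lemma joins the two variables.\<close>

lemma ext_limit_holomorphic2:
  assumes f: "\<And>n. f n \<in> L2" and hol: "\<And>n. holomorphic2_on (ext (f n)) (Omega p)"
    and g: "g \<in> L2" and lim: "(\<lambda>n. sq_int (\<lambda>x. f n x - g x)) \<longlonglongrightarrow> 0"
  shows "holomorphic2_on (ext g) (Omega p)"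
proof (rule holomorphic2_on_Osgood)
  show O: "open (Omega p)" by (rule open_Omega[OF p_cont])
  show "continuous_on (Omega p) (ext g)"
    unfolding continuous_on_eq_continuous_at[OF O]
  proof
    fix Z assume "Z \<in> Omega p"
    then obtain r where r: "r > 0" "cball Z r \<subseteq> Omega p" using O open_contains_cball by blast
    have "uniform_limit (cball Z r) (\<lambda>n. ext (f n)) (ext g) sequentially"
      by (rule ext_uniform_limit[OF f g lim compact_cball r(2)])
    note ul = this
    have "continuous_on (cball Z r) (ext g)"
    proof (rule uniform_limit_theorem[OF _ ul sequentially_bot])
      show "\<forall>\<^sub>F n in sequentially. continuous_on (cball Z r) (ext (f n))"
        by (intro always_eventually allI continuous_on_subset[OF holomorphic2_on_imp_continuous_on[OF hol] r(2)])
    qed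
    then show "isCont (ext g) Z"
      using r(1) by (intro continuous_on_interior) auto
  qed
  fix a c assume ac: "(a, c) \<in> Omega p"
  have cts: "continuous_on UNIV (\<lambda>w. (w, c))" "continuous_on UNIV (\<lambda>\<sigma>. (a, \<sigma>))"
    by (auto intro!: continuous_intros)
  have sub1: "open {w. (w, c) \<in> Omega p}" and sub2: "open {\<sigma>. (a, \<sigma>) \<in> Omega p}"
    using open_vimage[OF O cts(1)] open_vimage[OF O cts(2)] by (simp_all add: vimage_def)
  have "(\<lambda>w. ext g (w, c)) holomorphic_on {w. (w, c) \<in> Omega p}"
  proof (rule holomorphic_uniform_sequence[OF sub1])
    show "(\<lambda>w. ext (f n) (w, c)) holomorphic_on {w. (w, c) \<in> Omega p}" for n
      by (rule holomorphic2_on_slice1[OF hol]) simp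
    fix w assume "w \<in> {w. (w, c) \<in> Omega p}"
    then obtain d where d: "d > 0" "cball w d \<subseteq> {w. (w, c) \<in> Omega p}"
      using sub1 open_contains_cball by blast
    have "uniform_limit (cball w d \<times> {c}) (\<lambda>n. ext (f n)) (ext g) sequentially"
      using d by (intro ext_uniform_limit[OF f g lim] compact_Times) auto
    then have "uniform_limit (cball w d) (\<lambda>n w. ext (f n) (w, c)) (\<lambda>w. ext g (w, c)) sequentially"
      by (auto simp: uniform_limit_iff elim!: eventually_mono)
    with d show "\<exists>d>0. cball w d \<subseteq> {w. (w, c) \<in> Omega p} \<and>
        uniform_limit (cball w d) (\<lambda>n w. ext (f n) (w, c)) (\<lambda>w. ext g (w, c)) sequentially" by blast
  qed
  with ac sub1 show "(\<lambda>w. ext g (w, c)) field_differentiable at a"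
    by (auto simp: holomorphic_on_open field_differentiable_def)
  have "(\<lambda>\<sigma>. ext g (a, \<sigma>)) holomorphic_on {\<sigma>. (a, \<sigma>) \<in> Omega p}"
  proof (rule holomorphic_uniform_sequence[OF sub2])
    show "(\<lambda>\<sigma>. ext (f n) (a, \<sigma>)) holomorphic_on {\<sigma>. (a, \<sigma>) \<in> Omega p}" for n
      by (rule holomorphic2_on_slice2[OF hol]) simp
    fix \<sigma> assume "\<sigma> \<in> {\<sigma>. (a, \<sigma>) \<in> Omega p}"
    then obtain d where d: "d > 0" "cball \<sigma> d \<subseteq> {\<sigma>. (a, \<sigma>) \<in> Omega p}"
      using sub2 open_contains_cball by blast
    have "uniform_limit ({a} \<times> cball \<sigma> d) (\<lambda>n. ext (f n)) (ext g) sequentially"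
      using d by (intro ext_uniform_limit[OF f g lim] compact_Times) auto
    then have "uniform_limit (cball \<sigma> d) (\<lambda>n \<sigma>. ext (f n) (a, \<sigma>)) (\<lambda>\<sigma>. ext g (a, \<sigma>)) sequentially"
      by (auto simp: uniform_limit_iff elim!: eventually_mono)
    with d show "\<exists>d>0. cball \<sigma> d \<subseteq> {\<sigma>. (a, \<sigma>) \<in> Omega p} \<and>
        uniform_limit (cball \<sigma> d) (\<lambda>n \<sigma>. ext (f n) (a, \<sigma>)) (\<lambda>\<sigma>. ext g (a, \<sigma>)) sequentially" by blast
  qed
  with ac sub2 show "(\<lambda>\<sigma>. ext g (a, \<sigma>)) field_differentiable at c"
    by (auto simp: holomorphic_on_open field_differentiable_def)
qed

text \<open>The candidate extension is \<open>ext g\<close>. Differences of the approximating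
  extensions are bounded on every slice by their boundary norms, uniformly in the height, and
  Fatou's lemma carries this over to the limit. Uniformity allows the height to tend to 0 for one
  fixed \<open>n\<close>.\<close>

lemma H2_closed:
  assumes f: "\<And>n. f n \<in> H2 p" and g: "g \<in> L2" and lim: "(\<lambda>n. sq_int (\<lambda>x. f n x - g x)) \<longlonglongrightarrow> 0"
  shows "g \<in> H2 p"
proof -
  have fL: "f n \<in> L2" for n using f[of n] by (simp add: H2_def)
  have fE: "hardy_extension p (f n) (ext (f n))" for n
    using f[of n] hardy_extension_ext by (auto simp: H2_def)
  have fh: "holomorphic2_on (ext (f n)) (Omega p)" for n
    using fE by (simp add: hardy_extension_def)
  have gh: "holomorphic2_on (ext g) (Omega p)"
    by (rule ext_limit_holomorphic2[OF fL fh g lim])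
  have gm: "g \<in> borel_measurable borel" and fm: "f n \<in> borel_measurable borel" for n
    using L2_D(1)[OF g] L2_D(1)[OF fL] by auto
  define D where "D = (\<lambda>n. sq_int (\<lambda>x. f n x - g x))"
  have D0: "D \<longlonglongrightarrow> 0" using lim by (simp add: D_def)
  have sl: "(\<lambda>x. ext (f n) (lift_pt p y x)) \<in> borel_measurable borel"
    "(\<lambda>x. ext g (lift_pt p y x)) \<in> borel_measurable borel" if "y > 0" for n y
    using measurable_slice[OF p_cont fh that] measurable_slice[OF p_cont gh that] by auto
  have mn: "sq_int (\<lambda>x. ext (f n) (lift_pt p y x) - ext (f m) (lift_pt p y x)) \<le> 4 * D n + 4 * D m" if y: "y > 0" for n m y
  proof -
    have h: "hardy_extension p (\<lambda>x. 1 * f n x + (- 1) * f m x) (\<lambda>Z. 1 * ext (f n) Z + (- 1) * ext (f m) Z)"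
      by (intro hardy_extension_combine[OF p_cont] fm fE)
    have "(\<lambda>x. 1 * f n x + (- 1) * f m x) \<in> borel_measurable borel" using fm[of n] fm[of m] by simp
    from hardy_extension_sq_int_le[OF p_cont p_nonneg h this y]
    have "sq_int (\<lambda>x. ext (f n) (lift_pt p y x) - ext (f m) (lift_pt p y x)) \<le> 2 * sq_int (\<lambda>x. f n x - f m x)"
      by simp
    also have "(\<lambda>x. f n x - f m x) = (\<lambda>x. (f n x - g x) + (- 1) * (f m x - g x))" by auto
    also have "sq_int \<dots> \<le> 2 * sq_int (\<lambda>x. f n x - g x) + 2 * sq_int (\<lambda>x. (- 1) * (f m x - g x))"
      using fm[of n] fm[of m] gm by (intro sq_int_add_le) auto
    also have "sq_int (\<lambda>x. (- 1) * (f m x - g x)) = D m"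
      by (simp add: D_def norm_minus_commute)
    also have "2 * (2 * sq_int (\<lambda>x. f n x - g x) + 2 * D m) = 4 * D n + 4 * D m"
      by (simp add: D_def distrib_left mult.assoc[symmetric])
    finally show ?thesis by (simp add: mult_left_mono)
  qed
  have gn: "sq_int (\<lambda>x. ext (f n) (lift_pt p y x) - ext g (lift_pt p y x)) \<le> 4 * D n" if y: "y > 0" for n y
  proof -
    have "sq_int (\<lambda>x. ext (f n) (lift_pt p y x) - ext g (lift_pt p y x))
        = (\<integral>\<^sup>+x. liminf (\<lambda>m. ennreal ((norm (ext (f n) (lift_pt p y x) - ext (f m) (lift_pt p y x)))\<^sup>2)) \<partial>lborel)"
    proof (intro nn_integral_cong)
      fix x
      have "(\<lambda>m. ext (f m) (lift_pt p y x)) \<longlonglongrightarrow> ext g (lift_pt p y x)"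
        by (rule tendsto_uniform_limitI[OF ext_uniform_limit[OF fL g lim, of "{lift_pt p y x}"]])
          (use lift_pt_in_Omega[OF y] in auto)
      then have "(\<lambda>m. ennreal ((norm (ext (f n) (lift_pt p y x) - ext (f m) (lift_pt p y x)))\<^sup>2))
          \<longlonglongrightarrow> ennreal ((norm (ext (f n) (lift_pt p y x) - ext g (lift_pt p y x)))\<^sup>2)"
        by (intro tendsto_ennrealI tendsto_intros)
      then show "ennreal ((norm (ext (f n) (lift_pt p y x) - ext g (lift_pt p y x)))\<^sup>2)
          = liminf (\<lambda>m. ennreal ((norm (ext (f n) (lift_pt p y x) - ext (f m) (lift_pt p y x)))\<^sup>2))"
        by (rule lim_imp_Liminf[symmetric, OF sequentially_bot])
    qed
    also have "\<dots> \<le> liminf (\<lambda>m. sq_int (\<lambda>x. ext (f n) (lift_pt p y x) - ext (f m) (lift_pt p y x)))"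
      using sl[OF y] by (intro nn_integral_liminf) auto
    also have "\<dots> \<le> liminf (\<lambda>m. 4 * D n + 4 * D m)"
      using mn[OF y] by (intro Liminf_mono always_eventually) auto
    also have "\<dots> = 4 * D n"
    proof (rule lim_imp_Liminf[OF sequentially_bot])
      have "(\<lambda>m. 4 * D n + 4 * D m) \<longlonglongrightarrow> 4 * D n + 4 * 0"
        by (intro tendsto_add tendsto_const ennreal_tendsto_cmult D0) auto
      then show "(\<lambda>m. 4 * D n + 4 * D m) \<longlonglongrightarrow> 4 * D n" by simp
    qed
    finally show ?thesis .
  qed
  have gn': "sq_int (\<lambda>x. ext g (lift_pt p y x) - ext (f n) (lift_pt p y x)) \<le> 4 * D n" if y: "y > 0" for n y
    using gn[OF y, of n] by (simp add: norm_minus_commute)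
  have "hardy_extension p g (ext g)"
    unfolding hardy_extension_def
  proof (intro conjI gh)
    obtain K where K: "\<And>y. y > 0 \<Longrightarrow> sq_int (\<lambda>x. ext (f 0) (lift_pt p y x)) \<le> ennreal K"
      using hardy_extension_bound[OF p_cont fE] by blast
    have "(SUP y\<in>{0<..}. sq_int (\<lambda>x. ext g (lift_pt p y x))) \<le> 2 * (4 * D 0) + 2 * ennreal K"
    proof (rule SUP_least)
      fix y :: real assume "y \<in> {0<..}"
      then have y: "y > 0" by simp
      have "sq_int (\<lambda>x. ext g (lift_pt p y x)) = sq_int (\<lambda>x. (ext g (lift_pt p y x) - ext (f 0) (lift_pt p y x)) + ext (f 0) (lift_pt p y x))"
        by simp
      also have "\<dots> \<le> 2 * sq_int (\<lambda>x. ext g (lift_pt p y x) - ext (f 0) (lift_pt p y x)) + 2 * sq_int (\<lambda>x. ext (f 0) (lift_pt p y x))"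
        using sl[OF y] by (intro sq_int_add_le) auto
      also have "\<dots> \<le> 2 * (4 * D 0) + 2 * ennreal K"
        by (intro add_mono mult_left_mono gn' K y) auto
      finally show "sq_int (\<lambda>x. ext g (lift_pt p y x)) \<le> 2 * (4 * D 0) + 2 * ennreal K" .
    qed
    also have "\<dots> < \<infinity>"
      using L2_diff[OF fL[of 0] g] by (simp add: D_def L2_iff ennreal_mult_less_top)
    finally show "(SUP y\<in>{0<..}. sq_int (\<lambda>x. ext g (lift_pt p y x))) < \<infinity>" .
    show "((\<lambda>y. sq_int (\<lambda>x. ext g (lift_pt p y x) - g x)) \<longlongrightarrow> 0) (at_right 0)"
    proof (rule ennreal_tendsto_0I)
      fix r :: real assume r: "r > 0"
      \<comment> \<open>Each triangle inequality doubles the squares, and the slice estimate carries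
        a factor 4. The three contributions are then \<open>r / 3\<close>, \<open>r / 2\<close> and
        \<open>r / 6\<close>.\<close>
      have "\<forall>\<^sub>F n in sequentially. D n \<le> ennreal (r / 24)"
        using r by (intro tendsto_ennreal_0D[OF D0]) simp
      then obtain n where n: "D n \<le> ennreal (r / 24)"
        by (meson eventually_happens' sequentially_bot)
      have "((\<lambda>y. sq_int (\<lambda>x. ext (f n) (lift_pt p y x) - f n x)) \<longlongrightarrow> 0) (at_right 0)"
        using fE[of n] by (simp add: hardy_extension_def)
      then have "\<forall>\<^sub>F y in at_right 0. sq_int (\<lambda>x. ext (f n) (lift_pt p y x) - f n x) \<le> ennreal (r / 8)"
        using r by (intro tendsto_ennreal_0D) auto
      then show "\<forall>\<^sub>F y in at_right 0. sq_int (\<lambda>x. ext g (lift_pt p y x) - g x) \<le> ennreal r"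
        using eventually_at_right_less[of 0]
      proof eventually_elim
        case (elim y)
        have "sq_int (\<lambda>x. ext g (lift_pt p y x) - g x)
            = sq_int (\<lambda>x. (ext g (lift_pt p y x) - ext (f n) (lift_pt p y x)) + ((ext (f n) (lift_pt p y x) - f n x) + (f n x - g x)))"
          by simp
        also have "\<dots> \<le> 2 * sq_int (\<lambda>x. ext g (lift_pt p y x) - ext (f n) (lift_pt p y x))
            + 2 * sq_int (\<lambda>x. (ext (f n) (lift_pt p y x) - f n x) + (f n x - g x))"
          using sl[OF elim(2)] fm[of n] gm by (intro sq_int_add_le) auto
        also have "\<dots> \<le> 2 * (4 * D n) + 2 * (2 * sq_int (\<lambda>x. ext (f n) (lift_pt p y x) - f n x) + 2 * D n)"
          unfolding D_def using sl[OF elim(2)] fm[of n] gm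
          by (intro add_mono mult_left_mono gn'[OF elim(2), unfolded D_def] sq_int_add_le) auto
        also have "\<dots> \<le> 2 * (4 * ennreal (r / 24)) + 2 * (2 * ennreal (r / 8) + 2 * ennreal (r / 24))"
          by (intro add_mono mult_left_mono n elim) auto
        also have "\<dots> = ennreal (2 * (4 * (r / 24)) + 2 * (2 * (r / 8) + 2 * (r / 24)))"
        proof -
          have m: "numeral k * ennreal a = ennreal (numeral k * a)" for k a
            by (simp add: ennreal_mult')
          have pl: "ennreal a + ennreal c = ennreal (a + c)" if "a \<ge> 0" "c \<ge> 0" for a c
            using that by simp
          show ?thesis using r by (simp add: m pl del: ennreal_plus)
        qed
        also have "2 * (4 * (r / 24)) + 2 * (2 * (r / 8) + 2 * (r / 24)) = r" by simp
        finally show ?case .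
      qed
    qed
  qed
  with g show ?thesis by (auto simp: H2_def)
qed

text \<open>Since \<open>kZ Z\<close> lies in the Hardy space, \<open>f - g\<close> is orthogonal to
  it. Hence integration against the kernel does not distinguish \<open>f\<close> from its
  projection, and for the projection it gives the extension.\<close>

lemma szego_projection_exists:
  assumes f: "f \<in> L2"
  obtains g where "szego_projection p f g" "hardy_extension p g (ext f)"
proof -
  obtain g where g: "g \<in> H2 p" "\<And>h. h \<in> H2 p \<Longrightarrow> L2_inner (\<lambda>x. f x - g x) h = 0"
  proof (rule L2_projection_exists[of "H2 p" f])
    show "H2 p \<subseteq> L2" by (auto simp: H2_def)
    show "(\<lambda>x. 0) \<in> H2 p" by (rule zero_in_H2[OF p_cont])
    show "(\<lambda>x. u x + v x) \<in> H2 p" if "u \<in> H2 p" "v \<in> H2 p" for u v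
      using H2_combine[OF p_cont that, of 1 1] by simp
    show "(\<lambda>x. c * u x) \<in> H2 p" if "u \<in> H2 p" for u c
      using H2_combine[OF p_cont that that, of c 0] by simp
    show "v \<in> H2 p" if "\<And>n. u n \<in> H2 p" "v \<in> L2" "(\<lambda>n. sq_int (\<lambda>x. u n x - v x)) \<longlonglongrightarrow> 0" for u v
      using that by (rule H2_closed)
  qed (use f in auto)
  have gL: "g \<in> L2" using g by (simp add: H2_def)
  have gE: "hardy_extension p g (ext g)"
    using g hardy_extension_ext by (auto simp: H2_def)
  have eq: "ext g Z = ext f Z" if Z: "Z \<in> Omega p" for Z
  proof -
    have k: "kZ Z \<in> H2 p" "kZ Z \<in> L2" using kZ_hardy[OF Z] by (auto simp: H2_def)
    have "0 = L2_inner (\<lambda>x. f x - g x) (kZ Z)" using g(2)[OF k(1)] by simp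
    also have "\<dots> = L2_inner f (kZ Z) - L2_inner g (kZ Z)"
      unfolding L2_inner_def left_diff_distrib
      by (intro Bochner_Integration.integral_diff L2_integrable_inner f gL k)
    finally show ?thesis by (simp add: ext_eq_inner)
  qed
  have "hardy_extension p g (ext f)"
    by (rule hardy_extension_cong[OF p_cont gE eq])
  moreover have "szego_projection p f g"
    using f g by (simp add: szego_projection_def)
  ultimately show ?thesis using that by blast
qed

text \<open>The difference of two projections lies in the Hardy space and is orthogonal to itself.
  Functions represent classes, so only almost everywhere equality can result.\<close>

lemma szego_projection_unique:
  assumes "szego_projection p f g" "szego_projection p f g'"
  shows "AE x in lborel. g x = g' x"
proof -
  have f: "f \<in> L2" and g: "g \<in> H2 p" "g' \<in> H2 p" "g \<in> L2" "g' \<in> L2"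
    using assms by (auto simp: szego_projection_def H2_def)
  define u where "u = (\<lambda>x. g x - g' x)"
  have u: "u \<in> H2 p" using H2_combine[OF p_cont g(1,2), of 1 "- 1"] by (simp add: u_def)
  then have uL: "u \<in> L2" by (simp add: H2_def)
  have "L2_inner (\<lambda>x. f x - g x) u = 0" "L2_inner (\<lambda>x. f x - g' x) u = 0"
    using assms u by (auto simp: szego_projection_def)
  moreover have "L2_inner (\<lambda>x. f x - g' x) u - L2_inner (\<lambda>x. f x - g x) u = L2_inner u u"
  proof -
    have "L2_inner (\<lambda>x. f x - g' x) u - L2_inner (\<lambda>x. f x - g x) u
        = (\<integral>x. (f x - g' x) * cnj (u x) - (f x - g x) * cnj (u x) \<partial>lborel)"
      unfolding L2_inner_def
      by (rule Bochner_Integration.integral_diff[symmetric]) (intro L2_integrable_inner L2_diff f g uL)+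
    then show ?thesis by (simp add: L2_inner_def u_def algebra_simps)
  qed
  ultimately have "L2_inner u u = 0" by simp
  then have "complex_of_real (sq_norm u) = 0"
    unfolding L2_inner_def complex_norm_square[symmetric] integral_complex_of_real .
  then have "sq_norm u = 0" by simp
  then have "AE x in lborel. (norm (u x))\<^sup>2 = 0"
    using integral_nonneg_eq_0_iff_AE[OF L2_D(2)[OF uL]] by simp
  then show ?thesis by eventually_elim (simp add: u_def)
qed

lemma kern_interior: "szego_kernel_interior p (\<lambda>Z x. kern Z (lift_pt p 0 x))"
  unfolding szego_kernel_interior_def ext_def[symmetric]
  using kern_mult_integrable szego_projection_exists by blast

section \<open>Boundary values\<close>

text \<open>The singularity is confined to the equality case of the mean inequality. Comparing
  moduli forces \<open>p z = p w\<close> and \<open>s = t\<close>; then \<open>A\<close> is the real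
  number \<open>p z\<close>, and the remaining equation \<open>z * cnj w = norm z ^ 2\<close> forces
  \<open>z = w\<close>.\<close>

lemma good_boundary:
  assumes ne: "x \<noteq> x'"
  shows "good (lift_pt p 0 x) (lift_pt p 0 x')"
proof -
  obtain z t w s where x: "x = (z, t)" "x' = (w, s)" by (cases x, cases x')
  define A where "A = B (lift_pt p 0 x) (lift_pt p 0 x')"
  have ReA: "Re A = (p z + p w) / 2" and ImA: "Im A = (s - t) / 2"
    by (simp_all add: A_def Re_B Im_B lift_pt_def x)
  have A0: "A \<notin> \<real>\<^sub>\<le>\<^sub>0"
  proof
    assume "A \<in> \<real>\<^sub>\<le>\<^sub>0"
    then have "Re A \<le> 0" "Im A = 0" by (auto simp: complex_nonpos_Reals_iff)
    then have "s = t" "p z + p w \<le> 0" by (simp_all add: ReA ImA)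
    then have "p z = 0" "p w = 0" using p_nonneg[of z] p_nonneg[of w] by linarith+
    then have "z = 0" "w = 0" by auto
    with \<open>s = t\<close> ne show False by (simp add: x)
  qed
  have "z * cnj w \<noteq> A powr of_real b"
  proof
    assume eq: "z * cnj w = A powr of_real b"
    have "norm z * norm w = norm A powr b"
      using arg_cong[OF eq, of norm] by (simp add: norm_mult A_def norm_B_powr)
    then have "(norm z * norm w) powr \<alpha> = (norm A powr b) powr \<alpha>" by simp
    then have "p z * p w = norm A powr 2"
      using pos by (simp add: powr_mult powr_powr b_def)
    then have n: "p z * p w = (norm A)\<^sup>2" by simp
    have "(norm A)\<^sup>2 = ((p z + p w) / 2)\<^sup>2 + ((s - t) / 2)\<^sup>2"
      by (simp add: cmod_power2 ReA ImA)
    then have "(p z - p w)\<^sup>2 + (s - t)\<^sup>2 = 0"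
      using n by (simp add: power2_eq_square field_simps)
    then have st: "p z = p w" "s = t"
      by (simp_all add: sum_power2_eq_zero_iff)
    have "norm z = norm w"
    proof -
      have "p z powr (1 / \<alpha>) = p w powr (1 / \<alpha>)" by (simp only: st)
      then show ?thesis using pos by (simp add: powr_powr)
    qed
    moreover have "A = of_real (p z)"
      by (simp add: complex_eq_iff ReA ImA st del: powr_eq_0_iff)
    then have "A powr of_real b = of_real (p z powr b)"
      using powr_of_real[of "p z" b] by simp
    then have "z * cnj w = of_real ((norm z)\<^sup>2)"
      using eq pos by (simp add: powr_powr b_def)
    ultimately have e: "z * cnj w = w * cnj w" by (simp add: complex_norm_square del: of_real_power)
    then have "z = w"
      using \<open>norm z = norm w\<close> by (cases "w = 0") auto
    with st ne show False by (simp add: x)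
  qed
  with A0 show ?thesis by (simp add: good_def A_def lift_pt_def x)
qed

lemma kern_boundary_limit:
  assumes "x \<noteq> x'"
  shows "((\<lambda>y. kern (lift_pt p y x) (lift_pt p 0 x')) \<longlongrightarrow> kern (lift_pt p 0 x) (lift_pt p 0 x')) (at_right 0)"
  by (intro kern_tendsto lift_pt_tendsto tendsto_const good_boundary assms)

text \<open>The ratio bound through \<open>\<rho>\<close> degenerates as the first point approaches
  the boundary. Where \<open>B\<close> is large, the quotient in the kernel is at most one half
  because \<open>z\<close> is fixed; where \<open>B\<close> is bounded, the points \<open>x'\<close>
  stay in a compact set off the diagonal, on which the kernel is continuous down to height
  0.\<close>

lemma kern_dominated:
  assumes e: "e > 0"
  obtains D where "D \<ge> 0" "\<And>y x'. 0 \<le> y \<Longrightarrow> y \<le> 1 \<Longrightarrow> e \<le> dist x' x \<Longrightarrow>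
    (norm (kern (lift_pt p y x) (lift_pt p 0 x')))\<^sup>2 \<le> D * dom x'"
proof -
  obtain z t where x: "x = (z, t)" by (cases x)
  \<comment> \<open>For \<open>N \<ge> R\<close> this makes
    \<open>(2 * norm z) powr \<alpha>\<close> at most \<open>N / 2\<close>, which is what bounds the
    quotient by one half. The summand 1 ensures \<open>N \<ge> 1\<close>.\<close>
  define R where "R = 2 * (2 * norm z) powr \<alpha> + 1"
  have R: "R \<ge> 1" by (simp add: R_def)
  have nb: "- 1 - b \<le> 0" using b_pos by simp
  have Re_ge: "p (fst x') \<le> 2 * norm (B (lift_pt p y x) (lift_pt p 0 x'))" if "y \<ge> 0" for y x'
  proof -
    have "p (fst x') \<le> 2 * Re (B (lift_pt p y x) (lift_pt p 0 x'))"
      unfolding Re_B using that p_nonneg[of "fst x"] by (simp add: lift_pt_def)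
    then show ?thesis using complex_Re_le_cmod[of "B (lift_pt p y x) (lift_pt p 0 x')"] by linarith
  qed
  have Im_ge: "\<bar>snd x'\<bar> \<le> \<bar>t\<bar> + 2 * norm (B (lift_pt p y x) (lift_pt p 0 x'))" for y :: real and x'
  proof -
    have "\<bar>snd x'\<bar> \<le> \<bar>t\<bar> + 2 * \<bar>Im (B (lift_pt p y x) (lift_pt p 0 x'))\<bar>"
      unfolding Im_B by (simp add: lift_pt_def x)
    then show ?thesis using abs_Im_le_cmod[of "B (lift_pt p y x) (lift_pt p 0 x')"] by linarith
  qed
  \<comment> \<open>For \<open>N \<ge> 1\<close> both \<open>1 + \<bar>snd x'\<bar>\<close> and
    \<open>1 + p (fst x')\<close> are at most \<open>(3 + \<bar>t\<bar>) * N\<close>.\<close>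
  define k where "k = 1 / (3 + \<bar>t\<bar>)"
  have k: "k > 0" by (simp add: k_def)
  have far: "(norm (kern (lift_pt p y x) (lift_pt p 0 x')))\<^sup>2 \<le> (k powr (- 1 - b))\<^sup>2 * dom x'"
    if y: "0 \<le> y" and NR: "R \<le> norm (B (lift_pt p y x) (lift_pt p 0 x'))" for y x'
  proof -
    let ?B = "B (lift_pt p y x) (lift_pt p 0 x')"
    define N where "N = norm ?B"
    have N: "N \<ge> R" "N \<ge> 1" using NR R by (auto simp: N_def)
    have "norm (fst x') = p (fst x') powr (1 / \<alpha>)" using pos by (simp add: powr_powr)
    also have "\<dots> \<le> (2 * N) powr (1 / \<alpha>)"
      using Re_ge[OF y, of x'] pos unfolding N_def by (intro powr_mono2) auto
    finally have w: "norm (fst x') \<le> (2 * N) powr (1 / \<alpha>)" .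
    have zz: "2 * norm z \<le> (N / 2) powr (1 / \<alpha>)"
    proof -
      have "(2 * norm z) powr \<alpha> \<le> N / 2" using N(1) by (simp add: R_def)
      then have "((2 * norm z) powr \<alpha>) powr (1 / \<alpha>) \<le> (N / 2) powr (1 / \<alpha>)"
        using pos by (intro powr_mono2) auto
      then show ?thesis using pos by (simp add: powr_powr)
    qed
    have "2 * (norm z * norm (fst x')) = 2 * norm z * norm (fst x')" by simp
    also have "\<dots> \<le> (N / 2) powr (1 / \<alpha>) * (2 * N) powr (1 / \<alpha>)"
      using w zz by (intro mult_mono) auto
    also have "\<dots> = (N / 2 * (2 * N)) powr (1 / \<alpha>)"
      using N by (subst powr_mult) auto
    also have "\<dots> = (N powr 2) powr (1 / \<alpha>)" using N by (simp add: power2_eq_square)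
    also have "\<dots> = N powr b" unfolding powr_powr by (simp add: b_def)
    finally have zw: "norm z * norm (fst x') \<le> N powr b / 2" by simp
    let ?q = "fst (lift_pt p y x) * cnj (fst (lift_pt p 0 x')) / ?B powr of_real b"
    have "norm ?q = norm z * norm (fst x') / N powr b"
      unfolding norm_divide norm_mult norm_B_powr complex_mod_cnj N_def by (simp add: lift_pt_def x)
    also have "\<dots> \<le> 1 / 2" using zw N by (simp add: divide_le_eq)
    finally have "1 / 2 \<le> norm (1 - ?q)"
      using norm_triangle_ineq2[of 1 ?q] by simp
    then have q: "(1 / 2)\<^sup>2 \<le> (norm (1 - ?q))\<^sup>2" by (intro power_mono) auto
    have "norm (kern (lift_pt p y x) (lift_pt p 0 x')) = 1 / (4 * pi\<^sup>2) * N powr (- 1 - b) / (norm (1 - ?q))\<^sup>2"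
      unfolding kern_alt norm_divide norm_mult norm_B_powr norm_power N_def by (simp add: norm_divide norm_mult norm_power)
    also have "\<dots> \<le> 1 / (4 * pi\<^sup>2) * N powr (- 1 - b) / (1 / 2)\<^sup>2"
      by (intro frac_le q) auto
    also have "\<dots> = 1 / pi\<^sup>2 * N powr (- 1 - b)" by (simp add: power2_eq_square)
    also have "\<dots> \<le> 1 * N powr (- 1 - b)"
    proof (intro mult_right_mono)
      have "1 \<le> pi" using pi_gt3 by simp
      then have "1 \<le> pi\<^sup>2" by (simp add: one_le_power)
      then show "1 / pi\<^sup>2 \<le> 1" by simp
    qed simp
    finally have "(norm (kern (lift_pt p y x) (lift_pt p 0 x')))\<^sup>2 \<le> (N powr (- 1 - b))\<^sup>2"
      by (intro power_mono) auto
    also have "\<dots> = N powr (- 1 - b) * N powr (- 1 - b)" by (simp add: power2_eq_square)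
    also have "\<dots> \<le> (k * (1 + \<bar>snd x'\<bar>)) powr (- 1 - b) * (k * (1 + p (fst x'))) powr (- 1 - b)"
    proof (intro mult_mono powr_mono2' nb)
      have T: "(3 + \<bar>t\<bar>) * N = 3 * N + \<bar>t\<bar> * N" by (simp add: distrib_right)
      have tN: "\<bar>t\<bar> \<le> \<bar>t\<bar> * N" using N mult_left_mono[of 1 N "\<bar>t\<bar>"] by simp
      have "1 + \<bar>snd x'\<bar> \<le> (3 + \<bar>t\<bar>) * N"
        using Im_ge[of x' y] N tN unfolding T N_def[symmetric] by linarith
      then show "k * (1 + \<bar>snd x'\<bar>) \<le> N" by (simp add: k_def field_simps)
      have "1 + p (fst x') \<le> (3 + \<bar>t\<bar>) * N"
        using Re_ge[OF y, of x'] N tN unfolding T N_def[symmetric] by linarith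
      then show "k * (1 + p (fst x')) \<le> N" by (simp add: k_def field_simps)
      show "0 < k * (1 + p (fst x'))" using k p_nonneg[of "fst x'"] by (intro mult_pos_pos add_pos_nonneg) auto
    qed (use k in \<open>auto intro!: mult_pos_pos\<close>)
    also have "\<dots> = (k powr (- 1 - b))\<^sup>2 * dom x'"
      using k by (simp add: powr_mult dom_def power2_eq_square mult_ac)
    finally show ?thesis .
  qed
  \<comment> \<open>Heights up to 1 together with all points at distance at least \<open>e\<close>
    from \<open>x\<close> inside a box; the box contains every point at which the modulus of
    \<open>B\<close> is at most \<open>R\<close>.\<close>
  define S where "S = {0..1::real} \<times> ({x'. e \<le> dist x' x} \<inter> (cball (0::complex) ((2 * R) powr (1 / \<alpha>)) \<times> {- (\<bar>t\<bar> + 2 * R) .. \<bar>t\<bar> + 2 * R}))"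
  have "compact S"
    unfolding S_def
    by (intro compact_Times closed_Int_compact closed_Collect_le continuous_intros) auto
  moreover have "continuous_on S (\<lambda>q. kern (lift_pt p (fst q) x) (lift_pt p 0 (snd q)))"
    unfolding continuous_on_def
  proof
    fix q assume q: "q \<in> S"
    have g: "good (lift_pt p (fst q) x) (lift_pt p 0 (snd q))"
    proof (cases "fst q = 0")
      case True
      have "x \<noteq> snd q" using q e by (auto simp: S_def)
      then show ?thesis using good_boundary True by simp
    next
      case False
      then have "fst q > 0" using q by (auto simp: S_def)
      then show ?thesis by (intro good_interior(1) lift_pt_in_Omega lift_pt_closed) auto
    qed
    have c1: "continuous_on UNIV (\<lambda>q::real \<times> (complex \<times> real). lift_pt p (fst q) x)"
      unfolding lift_pt_def Complex_eq by (intro continuous_intros)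
    have c2: "continuous_on UNIV (\<lambda>q::real \<times> (complex \<times> real). lift_pt p 0 (snd q))"
      unfolding lift_pt_def Complex_eq by (intro continuous_intros continuous_on_compose2[OF p_cont]) auto
    show "((\<lambda>q. kern (lift_pt p (fst q) x) (lift_pt p 0 (snd q))) \<longlongrightarrow> kern (lift_pt p (fst q) x) (lift_pt p 0 (snd q))) (at q within S)"
      using continuous_on_subset[OF c1 subset_UNIV] continuous_on_subset[OF c2 subset_UNIV] q
      by (intro kern_tendsto g) (auto simp: continuous_on_def)
  qed
  ultimately have "bounded ((\<lambda>q. kern (lift_pt p (fst q) x) (lift_pt p 0 (snd q))) ` S)"
    using compact_continuous_image compact_imp_bounded by blast
  then obtain M where M: "M > 0" "\<And>q. q \<in> S \<Longrightarrow> norm (kern (lift_pt p (fst q) x) (lift_pt p 0 (snd q))) \<le> M"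
    unfolding bounded_pos by auto
  \<comment> \<open>A lower bound of \<open>dom\<close> over that box, used to express the constant
    bound \<open>M\<close> by the majorant.\<close>
  define d where "d = (1 + (\<bar>t\<bar> + 2 * R)) powr (- 1 - b) * (1 + 2 * R) powr (- 1 - b)"
  have d: "d > 0" unfolding d_def using R by (intro mult_pos_pos) auto
  have near: "(norm (kern (lift_pt p y x) (lift_pt p 0 x')))\<^sup>2 \<le> M\<^sup>2 / d * dom x'"
    if y: "0 \<le> y" "y \<le> 1" and ex: "e \<le> dist x' x" and NR: "norm (B (lift_pt p y x) (lift_pt p 0 x')) \<le> R" for y x'
  proof -
    have pw: "p (fst x') \<le> 2 * R" using Re_ge[OF y(1), of x'] NR by linarith
    have s: "\<bar>snd x'\<bar> \<le> \<bar>t\<bar> + 2 * R" using Im_ge[of x' y] NR by linarith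
    have "norm (fst x') = p (fst x') powr (1 / \<alpha>)" using pos by (simp add: powr_powr)
    also have "\<dots> \<le> (2 * R) powr (1 / \<alpha>)" using pw pos by (intro powr_mono2) auto
    finally have "(y, x') \<in> S" using y ex s by (cases x') (auto simp: S_def abs_le_iff)
    from M(2)[OF this] have "(norm (kern (lift_pt p y x) (lift_pt p 0 x')))\<^sup>2 \<le> M\<^sup>2"
      by (intro power_mono) auto
    also have "M\<^sup>2 = M\<^sup>2 / d * d" using d by simp
    also have "\<dots> \<le> M\<^sup>2 / d * dom x'"
    proof (intro mult_left_mono)
      show "d \<le> dom x'"
        unfolding d_def dom_def using s pw p_nonneg[of "fst x'"]
        by (intro mult_mono powr_mono2' nb) (auto intro: add_pos_nonneg)
    qed (use d in auto)
    finally show ?thesis .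
  qed
  have dom0: "dom x' \<ge> 0" for x' by (simp add: dom_def)
  show ?thesis
  proof
    show "(k powr (- 1 - b))\<^sup>2 + M\<^sup>2 / d \<ge> 0" using d by simp
    fix y :: real and x' assume y: "0 \<le> y" "y \<le> 1" and ex: "e \<le> dist x' x"
    show "(norm (kern (lift_pt p y x) (lift_pt p 0 x')))\<^sup>2 \<le> ((k powr (- 1 - b))\<^sup>2 + M\<^sup>2 / d) * dom x'"
    proof (cases "norm (B (lift_pt p y x) (lift_pt p 0 x')) \<le> R")
      case True
      have "M\<^sup>2 / d * dom x' \<le> ((k powr (- 1 - b))\<^sup>2 + M\<^sup>2 / d) * dom x'"
        using dom0[of x'] by (intro mult_right_mono) auto
      with near[OF y ex True] show ?thesis by (rule order_trans)
    next
      case False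
      have "(k powr (- 1 - b))\<^sup>2 * dom x' \<le> ((k powr (- 1 - b))\<^sup>2 + M\<^sup>2 / d) * dom x'"
        using dom0[of x'] d by (intro mult_right_mono) auto
      with far[OF y(1), of x'] False show ?thesis by linarith
    qed
  qed
qed

text \<open>Off its closed support \<open>f\<close> vanishes in a ball about \<open>x\<close>, so
  only points at a positive distance contribute. There the kernel is dominated, uniformly in the
  height, by the square root of a multiple of \<open>dom\<close>, which is square integrable and so
  has an integrable product with \<open>f\<close>.\<close>

lemma ext_boundary_limit:
  assumes f: "f \<in> L2" and x: "x \<notin> closure {x'. f x' \<noteq> 0}"
  shows "integrable lborel (\<lambda>x'. kern (lift_pt p 0 x) (lift_pt p 0 x') * f x')"
    and "((\<lambda>y. ext f (lift_pt p y x)) \<longlongrightarrow> (\<integral>x'. kern (lift_pt p 0 x) (lift_pt p 0 x') * f x' \<partial>lborel)) (at_right 0)"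
proof -
  have [measurable]: "f \<in> borel_measurable borel" using L2_D[OF f] by simp
  obtain e where e: "e > 0" "\<And>x'. dist x' x < e \<Longrightarrow> f x' = 0"
    using x unfolding closure_approachable by (auto simp: not_less) (metis not_less)
  obtain D where D: "D \<ge> 0" "\<And>y x'. 0 \<le> y \<Longrightarrow> y \<le> 1 \<Longrightarrow> e \<le> dist x' x \<Longrightarrow>
      (norm (kern (lift_pt p y x) (lift_pt p 0 x')))\<^sup>2 \<le> D * dom x'"
    using kern_dominated[OF e(1), of x] by blast
  define m where "m = (\<lambda>x'. sqrt (D * dom x'))"
  have dm[measurable]: "dom \<in> borel_measurable borel" using dom_integrable by auto
  have dom0: "D * dom x' \<ge> 0" for x' using D(1) by (simp add: dom_def)
  have mL: "(\<lambda>x'. of_real (m x')) \<in> L2"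
  proof -
    have "integrable lborel (\<lambda>x'. D * dom x')" using dom_integrable by (rule integrable_mult_right)
    then show ?thesis using dom0 by (simp add: L2_def m_def)
  qed
  have mi: "integrable lborel (\<lambda>x'. m x' * norm (f x'))"
    using integrable_norm[OF L2_integrable_inner[OF mL f]] dom0 by (simp add: norm_mult m_def)
  have bd: "norm (kern (lift_pt p y x) (lift_pt p 0 x') * f x') \<le> m x' * norm (f x')" if "0 \<le> y" "y \<le> 1" for y x'
  proof (cases "dist x' x < e")
    case True
    then show ?thesis using e by simp
  next
    case False
    then have "norm (kern (lift_pt p y x) (lift_pt p 0 x')) \<le> m x'"
      unfolding m_def using D(2)[OF that, of x'] by (intro real_le_rsqrt) auto
    then show ?thesis by (simp add: norm_mult mult_right_mono)
  qed
  have lim: "((\<lambda>y. kern (lift_pt p y x) (lift_pt p 0 x') * f x') \<longlongrightarrow> kern (lift_pt p 0 x) (lift_pt p 0 x') * f x') (at_right 0)" for x'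
  proof (cases "x' = x")
    case True
    then have "f x' = 0" using e by simp
    then show ?thesis by simp
  next
    case False
    then show ?thesis by (intro tendsto_mult tendsto_const kern_boundary_limit) auto
  qed
  have km: "(\<lambda>x'. kern (lift_pt p y x) (lift_pt p 0 x') * f x') \<in> borel_measurable borel" if "y > 0" for y
    using kern_lift_measurable[OF lift_pt_in_Omega[OF that, of p x], of 0] by measurable
  have seq: "filterlim (\<lambda>n. 1 / real (Suc n)) (at_right 0) sequentially"
  proof -
    have "(\<lambda>n. 1 / real (Suc n)) \<longlonglongrightarrow> 0" by real_asymp
    then show ?thesis by (auto simp: filterlim_at intro!: always_eventually)
  qed
  \<comment> \<open>The boundary kernel is singular at \<open>x' = x\<close>; measurability is
    obtained from the limit of interior kernels, which exists there too because \<open>f\<close>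
    vanishes near \<open>x\<close>.\<close>
  have km0: "(\<lambda>x'. kern (lift_pt p 0 x) (lift_pt p 0 x') * f x') \<in> borel_measurable borel"
  proof (rule borel_measurable_LIMSEQ_metric)
    show "(\<lambda>x'. kern (lift_pt p (1 / real (Suc n)) x) (lift_pt p 0 x') * f x') \<in> borel_measurable borel" for n
      by (rule km) simp
    show "(\<lambda>n. kern (lift_pt p (1 / real (Suc n)) x) (lift_pt p 0 x') * f x') \<longlonglongrightarrow> kern (lift_pt p 0 x) (lift_pt p 0 x') * f x'" for x'
      by (rule filterlim_compose[OF lim seq])
  qed
  show "integrable lborel (\<lambda>x'. kern (lift_pt p 0 x) (lift_pt p 0 x') * f x')"
  proof (rule Bochner_Integration.integrable_bound[OF mi])
    show "AE x' in lborel. norm (kern (lift_pt p 0 x) (lift_pt p 0 x') * f x') \<le> norm (m x' * norm (f x'))"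
      using order_trans[OF bd[of 0] abs_ge_self] by (intro AE_I2) simp
  qed (use km0 in simp)
  show "((\<lambda>y. ext f (lift_pt p y x)) \<longlongrightarrow> (\<integral>x'. kern (lift_pt p 0 x) (lift_pt p 0 x') * f x' \<partial>lborel)) (at_right 0)"
  proof (rule tendsto_at_right_sequentially[of 0 1])
    fix S :: "nat \<Rightarrow> real"
    assume S: "\<And>n. 0 < S n" "\<And>n. S n < 1" "S \<longlonglongrightarrow> 0"
    have fl: "filterlim S (at_right 0) sequentially"
      using S by (auto simp: filterlim_at less_imp_neq[symmetric] intro!: always_eventually)
    show "(\<lambda>n. ext f (lift_pt p (S n) x)) \<longlonglongrightarrow> (\<integral>x'. kern (lift_pt p 0 x) (lift_pt p 0 x') * f x' \<partial>lborel)"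
      unfolding ext_def
    proof (rule integral_dominated_convergence[OF _ _ mi])
      show "AE x' in lborel. (\<lambda>n. kern (lift_pt p (S n) x) (lift_pt p 0 x') * f x') \<longlonglongrightarrow> kern (lift_pt p 0 x) (lift_pt p 0 x') * f x'"
        by (intro AE_I2 filterlim_compose[OF lim fl])
      show "AE x' in lborel. norm (kern (lift_pt p (S n) x) (lift_pt p 0 x') * f x') \<le> m x' * norm (f x')" for n
        using S by (intro AE_I2 bd) (auto intro: less_imp_le)
    qed (use km0 km S in auto)
  qed simp
qed

text \<open>The slices of \<open>ext f\<close> have two limits at the boundary: in the square mean
  they tend to the projection, hence along a subsequence of heights almost everywhere, and off the
  support of \<open>f\<close> they tend pointwise to the integral. Uniqueness of the projection
  transfers the equality to an arbitrary representative \<open>g\<close>.\<close>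

lemma szego_projection_off_support:
  assumes P: "szego_projection p f g"
  shows "AE x in lborel. x \<notin> closure {x'. f x' \<noteq> 0} \<longrightarrow>
    integrable lborel (\<lambda>x'. kern (lift_pt p 0 x) (lift_pt p 0 x') * f x') \<and>
    g x = (\<integral>x'. kern (lift_pt p 0 x) (lift_pt p 0 x') * f x' \<partial>lborel)"
proof -
  have f: "f \<in> L2" using P by (simp add: szego_projection_def)
  obtain g0 where g0: "szego_projection p f g0" "hardy_extension p g0 (ext f)"
    using szego_projection_exists[OF f] by blast
  have gL: "g0 \<in> L2" using g0 by (simp add: szego_projection_def H2_def)
  have fh: "holomorphic2_on (ext f) (Omega p)" using g0 by (simp add: hardy_extension_def)
  define y where "y = (\<lambda>n. 1 / real (Suc n))"
  have y: "y n > 0" for n by (simp add: y_def)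
  have yr: "filterlim y (at_right 0) sequentially"
  proof -
    have "y \<longlonglongrightarrow> 0" unfolding y_def by real_asymp
    then show ?thesis using y by (auto simp: filterlim_at less_imp_neq[symmetric] intro!: always_eventually)
  qed
  obtain K where K: "\<And>y. y > 0 \<Longrightarrow> sq_int (\<lambda>x. ext f (lift_pt p y x)) \<le> ennreal K"
    using hardy_extension_bound[OF p_cont g0(2)] by blast
  have eL: "(\<lambda>x. ext f (lift_pt p (y n) x)) \<in> L2" for n
    using measurable_slice[OF p_cont fh y] le_less_trans[OF K[OF y] ennreal_less_top] by (simp add: L2_iff)
  note dL = L2_diff[OF eL gL]
  have "((\<lambda>y. sq_int (\<lambda>x. ext f (lift_pt p y x) - g0 x)) \<longlongrightarrow> 0) (at_right 0)"
    using g0 by (simp add: hardy_extension_def)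
  from filterlim_compose[OF this yr]
  have "(\<lambda>n. sq_int (\<lambda>x. ext f (lift_pt p (y n) x) - g0 x)) \<longlonglongrightarrow> 0" .
  then have "(\<lambda>n. enn2real (sq_int (\<lambda>x. ext f (lift_pt p (y n) x) - g0 x))) \<longlonglongrightarrow> enn2real 0"
    by (intro tendsto_enn2real) auto
  then have "(\<lambda>n. sq_norm (\<lambda>x. ext f (lift_pt p (y n) x) - g0 x)) \<longlonglongrightarrow> 0"
    using sq_int_L2[OF dL] sq_norm_nonneg by simp
  then have "(\<lambda>n. \<integral>x. norm ((norm (ext f (lift_pt p (y n) x) - g0 x))\<^sup>2) \<partial>lborel) \<longlonglongrightarrow> 0"
    by simp
  from tendsto_L1_AE_subseq[OF L2_D(2)[OF dL] this]
  obtain r :: "nat \<Rightarrow> nat" where r: "strict_mono r"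
    "AE x in lborel. (\<lambda>n. (norm (ext f (lift_pt p (y (r n)) x) - g0 x))\<^sup>2) \<longlonglongrightarrow> 0"
    by blast
  have yrr: "filterlim (\<lambda>n. y (r n)) (at_right 0) sequentially"
    by (rule filterlim_compose[OF yr filterlim_subseq[OF r(1)]])
  from r(2) szego_projection_unique[OF P g0(1)] show ?thesis
  proof eventually_elim
    case (elim x)
    show ?case
    proof (intro impI conjI)
      assume x: "x \<notin> closure {x'. f x' \<noteq> 0}"
      show "integrable lborel (\<lambda>x'. kern (lift_pt p 0 x) (lift_pt p 0 x') * f x')"
        by (rule ext_boundary_limit(1)[OF f x])
      have l1: "(\<lambda>n. ext f (lift_pt p (y (r n)) x)) \<longlonglongrightarrow> (\<integral>x'. kern (lift_pt p 0 x) (lift_pt p 0 x') * f x' \<partial>lborel)"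
        by (rule filterlim_compose[OF ext_boundary_limit(2)[OF f x] yrr])
      have "(\<lambda>n. sqrt ((norm (ext f (lift_pt p (y (r n)) x) - g0 x))\<^sup>2)) \<longlonglongrightarrow> sqrt 0"
        by (rule tendsto_real_sqrt[OF elim(1)])
      then have "(\<lambda>n. ext f (lift_pt p (y (r n)) x) - g0 x) \<longlonglongrightarrow> 0"
        by (simp add: tendsto_norm_zero_iff)
      then have "(\<lambda>n. ext f (lift_pt p (y (r n)) x)) \<longlonglongrightarrow> g0 x" by (simp only: LIM_zero_iff)
      from LIMSEQ_unique[OF this l1] elim(2)
      show "g x = (\<integral>x'. kern (lift_pt p 0 x) (lift_pt p 0 x') * f x' \<partial>lborel)" by simp
    qed
  qed
qed

lemma kern_is_szego_kernel: "is_szego_kernel p (\<lambda>x x'. kern (lift_pt p 0 x) (lift_pt p 0 x'))"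
  unfolding is_szego_kernel_def
  using kern_interior kern_boundary_limit szego_projection_off_support by blast

lemma B_boundary: "B (lift_pt p 0 x) (lift_pt p 0 x') = szego_A \<alpha> x x'"
  by (cases x, cases x') (simp add: B_def szego_A_def lift_pt_def complex_eq_iff field_simps)

end

theorem mainTheorem3:
  fixes \<alpha> :: real
  assumes "\<alpha> > 0"
  shows "is_szego_kernel (\<lambda>z. norm z powr \<alpha>)
    (\<lambda>(z, t) (w, s).
       let A = szego_A \<alpha> (z, t) (w, s) in
       of_real (1 / (4 * pi\<^sup>2)) * A powr of_real (- 1 - 2 / \<alpha>)
         * (1 - z * cnj w / A powr of_real (2 / \<alpha>)) powi (- 2))"
proof -
  interpret pow_weight \<alpha> by unfold_locales (rule assms)
  have "(\<lambda>x x'. kern (lift_pt p 0 x) (lift_pt p 0 x')) = (\<lambda>(z, t) (w, s).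
       let A = szego_A \<alpha> (z, t) (w, s) in
       of_real (1 / (4 * pi\<^sup>2)) * A powr of_real (- 1 - 2 / \<alpha>)
         * (1 - z * cnj w / A powr of_real (2 / \<alpha>)) powi (- 2))"
  proof (intro ext)
    fix x x' :: "complex \<times> real"
    obtain z t w s where "x = (z, t)" "x' = (w, s)" by (cases x, cases x')
    then show "kern (lift_pt p 0 x) (lift_pt p 0 x') = (case x of (z, t) \<Rightarrow> \<lambda>(w, s).
       let A = szego_A \<alpha> (z, t) (w, s) in
       of_real (1 / (4 * pi\<^sup>2)) * A powr of_real (- 1 - 2 / \<alpha>)
         * (1 - z * cnj w / A powr of_real (2 / \<alpha>)) powi (- 2)) x'"
      unfolding kern_def B_boundary by (simp only: b_def lift_pt_def Let_def case_prod_conv fst_conv)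
  qed
  then show ?thesis using kern_is_szego_kernel by simp
qed

end
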